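(* Let $K$ be a real compact nc convex set and let $f\in M_n(B(K))_{\rm sa}$. Then $f$ is real nc convex (resp. lowersemicontinuous) if and only if its complexification $f_c\in M_n(B(K_c))$ is complex nc convex (resp. lowersemicontinuous).
   Context: Let $\mathbb F=\mathbb R$ or $\mathbb C$. $M_{m,k}(\mathbb F)$ denotes the bounded operators $\ell^2_k\to\ell^2_m$ (possibly infinite cardinals, nonzero and bounded by a fixed large enough infinite cardinal $\kappa$); for an operator space $E$, $M_m(E)$ is the space of $m\times m$ matrices over $E$ whose finitely supported submatrices are uniformly bounded, and $\mathcal M(E)=\bigsqcup_{m\le\kappa}M_m(E)$. A real (resp. complex) nc convex set over a real (resp. complex) dual operator space $E$ is $K=\bigsqcup_mK_m\subseteq\mathcal M(E)$ closed under direct sums ($\sum_i\alpha_ix_i\alpha_i^*\in K_m$ for bounded families $x_i\in K_{m_i}$ and isometries $\alpha_i\in M_{m,m_i}(\mathbb F)$ with $\sum_i\alpha_i\alpha_i^*=1_m$) and compressions ($\beta^*x\beta\in K_k$ for $x\in K_m$, $\beta\in M_{m,k}(\mathbb F)$ an isometry). It is compact if each $K_m$ is weak* compact. For $x,y\in M_m(E)$, $c(x+iy)=\begin{bmatrix} x & -y \\ y & x \end{bmatrix}$, and the complexification of a real nc convex set $K$ is the complex nc convex set $K_c$ with $(K_c)_m=\{x+iy:c(x+iy)\in K_{2m}\}$. $M_n(B(K))$ is the set of bounded nc functions $f:K\to M_n(\mathcal M(\mathbb F))$: $f(x)\in M_n(M_m(\mathbb F))$ for $x\in K_m$, $f(UxU^*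 )=(1_n\otimes U)f(x)(1_n\otimes U^* )$ for unitaries $U\in M_m(\mathbb F)$, $f$ respects direct sums ($f(\sum_i\alpha_ix_i\alpha_i^* )=\sum_i(1_n\otimes\alpha_i)f(x_i)(1_n\otimes\alpha_i^* )$ for isometries with $\sum_i\alpha_i\alpha_i^*=1$), and $\sup_x\|f(x)\|<\infty$. $f$ is selfadjoint, $f\in M_n(B(K))_{\rm sa}$, if $f(x)=f(x)^*$ for all $x$. The epigraph of a selfadjoint $f$ is given by $\mathrm{Epi}_m(f)=\{(x,\alpha)\in K_m\times M_n(M_m(\mathbb F))_{\rm sa}:\alpha\ge f(x)\}$. $f$ is (real or complex, according to $\mathbb F$) nc convex if $\mathrm{Epi}(f)=\bigsqcup_m\mathrm{Epi}_m(f)$ is a nc convex set over $\mathbb F$ (operations $\alpha^*(x,\gamma)\alpha=(\alpha^*x\alpha,(1_n\otimes\alpha^* )\gamma(1_n\otimes\alpha))$), and lowersemicontinuous if each $\mathrm{Epi}_m(f)$ is weak* closed. For $f\in M_n(B(K))$ with $K$ real, $f_c\in M_n(B(K_c))$ is $f_c(z)=(1_n\otimes u_m^* )f(c(z))(1_n\otimes u_m)$ for $z\in(K_c)_m$, where $u_m=\frac1{\sqrt2}\begin{bmatrix} 1_m \\ -i1_m \end{bmatrix}$. *)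

theory Defs
  imports "HOL-Analysis.Analysis"
begin

text \<open>The scalar field: the only instances below are \<open>real\<close> and \<open>complex\<close>, so that
  each notion is defined once and read over either field.\<close>

class star_field = real_normed_field +
  fixes star :: "'a \<Rightarrow> 'a"
  assumes star_star: "star (star x) = x"
    and star_add: "star (x + y) = star x + star y"
    and star_mult: "star (x * y) = star x * star y"
    and mult_star: "x * star x = (norm x)\<^sup>2 *\<^sub>R 1"

instantiation real :: star_field
begin
definition star_real :: "real \<Rightarrow> real" where "star_real x = x"
instance by standard (simp_all add: star_real_def power2_eq_square)
end

instantiation complex :: star_field
begin
definition star_complex :: "complex \<Rightarrow> complex" where "star_complex z = cnj z"
instance by standard
    (simp_all add: star_complex_def complex_norm_square [symmetric] scaleR_conv_of_real del: of_real_power)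
end


section \<open>Scalar matrices\<close>

text \<open>A matrix with rows indexed by \<open>I\<close> and columns by \<open>J\<close> is a function on the
  ambient index types that vanishes off \<open>I \<times> J\<close>.  An operator from
  \<open>\<ell>\<^sup>2(J)\<close> to \<open>\<ell>\<^sup>2(I)\<close> is identified with its matrix;
  boundedness is tested on the (dense) finitely supported vectors.\<close>

type_synonym ('a, 'b, 'f) mat = "'a \<Rightarrow> 'b \<Rightarrow> 'f"

definition op_bound :: "'a set \<Rightarrow> 'b set \<Rightarrow> ('a, 'b, 'f::star_field) mat \<Rightarrow> real \<Rightarrow> bool" where
  "op_bound I J \<alpha> C \<longleftrightarrow> 0 \<le> C \<and>
     (\<forall>F G \<eta> \<xi>. finite F \<and> F \<subseteq> I \<and> finite G \<and> G \<subseteq> J \<longrightarrow>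
        norm (\<Sum>i\<in>F. \<Sum>j\<in>G. star (\<eta> i) * \<alpha> i j * \<xi> j)
          \<le> C * sqrt (\<Sum>i\<in>F. (norm (\<eta> i))\<^sup>2) * sqrt (\<Sum>j\<in>G. (norm (\<xi> j))\<^sup>2))"

definition op_norm :: "'a set \<Rightarrow> 'b set \<Rightarrow> ('a, 'b, 'f::star_field) mat \<Rightarrow> real" where
  "op_norm I J \<alpha> = Inf {C. op_bound I J \<alpha> C}"

definition bdd_mats :: "'a set \<Rightarrow> 'b set \<Rightarrow> ('a, 'b, 'f::star_field) mat set" where
  "bdd_mats I J = {\<alpha>. (\<forall>i j. i \<notin> I \<or> j \<notin> J \<longrightarrow> \<alpha> i j = 0) \<and> (\<exists>C. op_bound I J \<alpha> C)}"

definition madj :: "('a, 'b, 'f::star_field) mat \<Rightarrow> ('b, 'a, 'f) mat" where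
  "madj \<alpha> = (\<lambda>i j. star (\<alpha> j i))"

definition mmul :: "('a, 'b, 'f::star_field) mat \<Rightarrow> ('b, 'c, 'f) mat \<Rightarrow> ('a, 'c, 'f) mat" where
  "mmul \<alpha> \<beta> = (\<lambda>i j. \<Sum>\<^sub>\<infinity>k. \<alpha> i k * \<beta> k j)"

definition mone :: "'a set \<Rightarrow> ('a, 'a, 'f::star_field) mat" where
  "mone I = (\<lambda>i j. if i = j \<and> i \<in> I then 1 else 0)"

definition isometry_mat :: "'a set \<Rightarrow> 'b set \<Rightarrow> ('a, 'b, 'f::star_field) mat \<Rightarrow> bool" where
  "isometry_mat I J \<alpha> \<longleftrightarrow> \<alpha> \<in> bdd_mats I J \<and> mmul (madj \<alpha>) \<alpha> = mone J"

definition unitary_mat :: "'a set \<Rightarrow> ('a, 'a, 'f::star_field) mat \<Rightarrow> bool" where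
  "unitary_mat I U \<longleftrightarrow> U \<in> bdd_mats I I \<and> mmul (madj U) U = mone I \<and> mmul U (madj U) = mone I"

text \<open>\<open>1\<^sub>n \<otimes> \<alpha>\<close>, where \<open>n\<close> is the cardinality of the type \<open>'n\<close>.\<close>

definition ampl :: "('a, 'b, 'f::star_field) mat \<Rightarrow> ('n \<times> 'a, 'n \<times> 'b, 'f) mat" where
  "ampl \<alpha> = (\<lambda>(r, i) (s, j). if r = s then \<alpha> i j else 0)"

definition mat_pos :: "'a set \<Rightarrow> ('a, 'a, 'f::star_field) mat \<Rightarrow> bool" where
  "mat_pos I T \<longleftrightarrow> madj T = T \<and>
     (\<forall>F \<xi>. finite F \<and> F \<subseteq> I \<longrightarrow>
        (\<Sum>i\<in>F. \<Sum>j\<in>F. star (\<xi> i) * T i j * \<xi> j) \<in> of_real ` {0..})"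


section \<open>Operator spaces and dual operator spaces\<close>

text \<open>The underlying space is the whole type \<open>'e\<close>.  \<open>os_norm E n\<close> is the norm of
  \<open>M\<^sub>n(E)\<close>, a function of the entries with indices below \<open>n\<close>.
  \<open>os_predual E\<close> is the predual, viewed inside the dual of \<open>E\<close>.\<close>

record ('e, 'f) dual_os =
  os_scale :: "'f \<Rightarrow> 'e \<Rightarrow> 'e"
  os_norm :: "nat \<Rightarrow> (nat, nat, 'e) mat \<Rightarrow> real"
  os_predual :: "('e \<Rightarrow> 'f) set"

text \<open>Ruan's axioms.  The norm of the type \<open>'e\<close> only supplies the topology and need
  not coincide with \<open>os_norm E 1\<close>: on a complexification, of type \<open>'e \<times> 'e\<close>, it
  is merely equivalent to it.\<close>

definition operator_space :: "('e::banach, 'f::star_field) dual_os \<Rightarrow> bool" where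
  "operator_space E \<longleftrightarrow>
     vector_space (os_scale E) \<and>
     (\<forall>r x. os_scale E (of_real r) x = r *\<^sub>R x) \<and>
     (\<exists>a>0. \<exists>b. \<forall>x. a * norm x \<le> os_norm E 1 (\<lambda>_ _. x) \<and> os_norm E 1 (\<lambda>_ _. x) \<le> b * norm x) \<and>
     (\<forall>n x y. (\<forall>i<n. \<forall>j<n. x i j = y i j) \<longrightarrow> os_norm E n x = os_norm E n y) \<and>
     (\<forall>n x. 0 \<le> os_norm E n x \<and> (os_norm E n x = 0 \<longleftrightarrow> (\<forall>i<n. \<forall>j<n. x i j = 0))) \<and>
     (\<forall>n c x. os_norm E n (\<lambda>i j. os_scale E c (x i j)) = norm c * os_norm E n x) \<and>
     (\<forall>n x y. os_norm E n (\<lambda>i j. x i j + y i j) \<le> os_norm E n x + os_norm E n y) \<and>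
     (\<forall>n p x y. os_norm E (n + p)
          (\<lambda>i j. if i < n \<and> j < n then x i j
                 else if n \<le> i \<and> n \<le> j then y (i - n) (j - n) else 0)
        = max (os_norm E n x) (os_norm E p y)) \<and>
     (\<forall>n p \<alpha> x \<beta>. os_norm E n (\<lambda>i j. \<Sum>k<p. \<Sum>l<p. os_scale E (\<alpha> i k * \<beta> l j) (x k l))
        \<le> op_norm {..<n} {..<p} \<alpha> * os_norm E p x * op_norm {..<p} {..<n} \<beta>)"

text \<open>Norm of the scalar matrix \<open>[\<phi>\<^sub>k\<^sub>l(x\<^sub>i\<^sub>j)]\<close>.\<close>

definition pairing_norm :: "nat \<Rightarrow> (nat, nat, 'e \<Rightarrow> 'f::star_field) mat \<Rightarrow> nat \<Rightarrow> (nat, nat, 'e) mat \<Rightarrow> real" where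
  "pairing_norm p \<phi> n x =
     op_norm ({..<p} \<times> {..<n}) ({..<p} \<times> {..<n}) (\<lambda>(k, i) (l, j). \<phi> k l (x i j))"

text \<open>The completely bounded norm of \<open>\<phi> : E \<rightarrow> M\<^sub>p(F)\<close>.  These are the matrix norms of
  the operator space dual of \<open>E\<close>, in which the predual sits completely isometrically.\<close>

definition cb_norm :: "('e, 'f::star_field) dual_os \<Rightarrow> nat \<Rightarrow> (nat, nat, 'e \<Rightarrow> 'f) mat \<Rightarrow> real" where
  "cb_norm E p \<phi> = Sup {pairing_norm p \<phi> n x | n x. os_norm E n x \<le> 1}"

text \<open>\<open>E\<close> is, completely isometrically via evaluation, the operator space dual of
  \<open>os_predual E\<close>.\<close>

definition dual_operator_space :: "('e::banach, 'f::star_field) dual_os \<Rightarrow> bool" where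
  "dual_operator_space E \<longleftrightarrow>
     operator_space E \<and>
     (\<lambda>_. 0) \<in> os_predual E \<and>
     (\<forall>\<phi>\<in>os_predual E. \<forall>\<psi>\<in>os_predual E. (\<lambda>x. \<phi> x + \<psi> x) \<in> os_predual E) \<and>
     (\<forall>c. \<forall>\<phi>\<in>os_predual E. (\<lambda>x. c * \<phi> x) \<in> os_predual E) \<and>
     (\<forall>\<phi>\<in>os_predual E.
        (\<forall>x y. \<phi> (x + y) = \<phi> x + \<phi> y) \<and> (\<forall>c x. \<phi> (os_scale E c x) = c * \<phi> x) \<and>
        (\<exists>C. \<forall>x. norm (\<phi> x) \<le> C * norm x)) \<and>
     (\<forall>n x. os_norm E n x =
        Sup {pairing_norm p \<phi> n x | p \<phi>. (\<forall>k l. \<phi> k l \<in> os_predual E) \<and> cb_norm E p \<phi> \<le> 1}) \<and>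
     (\<forall>L. (\<forall>\<phi>\<in>os_predual E. \<forall>\<psi>\<in>os_predual E. L (\<lambda>x. \<phi> x + \<psi> x) = L \<phi> + L \<psi>) \<and>
          (\<forall>c. \<forall>\<phi>\<in>os_predual E. L (\<lambda>x. c * \<phi> x) = c * L \<phi>) \<and>
          (\<exists>C. \<forall>\<phi>\<in>os_predual E. norm (L \<phi>) \<le> C * cb_norm E 1 (\<lambda>_ _. \<phi>))
        \<longrightarrow> (\<exists>x. \<forall>\<phi>\<in>os_predual E. L \<phi> = \<phi> x))"

definition scalars :: "('f::star_field, 'f) dual_os" where
  "scalars = \<lparr>os_scale = (*), os_norm = (\<lambda>n. op_norm {..<n} {..<n}),
              os_predual = range (\<lambda>c x. c * x)\<rparr>"


section \<open>Matrices over a dual operator space\<close>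

definition sub_norms :: "('e, 'f) dual_os \<Rightarrow> 'a set \<Rightarrow> ('a, 'a, 'e) mat \<Rightarrow> real set" where
  "sub_norms E I x =
     {os_norm E n (\<lambda>i j. x (e i) (e j)) | n e. inj_on e {..<n} \<and> e ` {..<n} \<subseteq> I}"

definition mats :: "('e::zero, 'f) dual_os \<Rightarrow> 'a set \<Rightarrow> ('a, 'a, 'e) mat set" where
  "mats E I = {x. (\<forall>i j. i \<notin> I \<or> j \<notin> I \<longrightarrow> x i j = 0) \<and> bdd_above (sub_norms E I x)}"

definition mats_norm :: "('e, 'f) dual_os \<Rightarrow> 'a set \<Rightarrow> ('a, 'a, 'e) mat \<Rightarrow> real" where
  "mats_norm E I x = Sup (sub_norms E I x)"

text \<open>\<open>\<alpha> x \<beta>\<close>.  For bounded \<open>\<alpha>\<close>, \<open>x\<close>, \<open>\<beta>\<close> the iterated sums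
  converge unconditionally in norm; a sum over pairs of indices need not.\<close>

definition sandwich :: "('e::real_normed_vector, 'f) dual_os \<Rightarrow>
    ('a, 'b, 'f) mat \<Rightarrow> ('b, 'b, 'e) mat \<Rightarrow> ('b, 'c, 'f) mat \<Rightarrow> ('a, 'c, 'e) mat" where
  "sandwich E \<alpha> x \<beta> =
     (\<lambda>i j. \<Sum>\<^sub>\<infinity>k. os_scale E (\<alpha> i k) (\<Sum>\<^sub>\<infinity>l. os_scale E (\<beta> l j) (x k l)))"

definition direct_sum :: "('e::real_normed_vector, 'f::star_field) dual_os \<Rightarrow> 's set \<Rightarrow>
    ('s \<Rightarrow> ('a, 'b, 'f) mat) \<Rightarrow> ('s \<Rightarrow> ('b, 'b, 'e) mat) \<Rightarrow> ('a, 'a, 'e) mat" where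
  "direct_sum E S \<alpha> x = (\<lambda>p q. \<Sum>\<^sub>\<infinity>s\<in>S. sandwich E (\<alpha> s) (x s) (madj (\<alpha> s)) p q)"

text \<open>The predual of \<open>M\<^sub>I(E) = CB(E\<^sub>*, B(\<ell>\<^sup>2(I)))\<close> is the projective tensor
  product of \<open>E\<^sub>*\<close> with the trace class, in which the finitely supported matrices over
  \<open>E\<^sub>*\<close> are dense: the functionals below are the norm limits of those.\<close>

definition mats_predual :: "('e::real_normed_vector, 'f::star_field) dual_os \<Rightarrow> 'a set \<Rightarrow>
    (('a, 'a, 'e) mat \<Rightarrow> 'f) set" where
  "mats_predual E I =
     {\<Phi>. \<forall>\<epsilon>>0. \<exists>F \<phi>. finite F \<and> F \<subseteq> I \<and> (\<forall>i j. \<phi> i j \<in> os_predual E) \<and>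
        (\<forall>x\<in>mats E I. norm (\<Phi> x - (\<Sum>i\<in>F. \<Sum>j\<in>F. \<phi> i j (x i j))) \<le> \<epsilon> * mats_norm E I x)}"

definition weak_star :: "('e::real_normed_vector, 'f::star_field) dual_os \<Rightarrow> 'a set \<Rightarrow>
    ('a, 'a, 'e) mat topology" where
  "weak_star E I = topology_generated_by
     {{x \<in> mats E I. \<Phi> x \<in> U} | \<Phi> U. \<Phi> \<in> mats_predual E I \<and> open U}"


section \<open>nc convex sets\<close>

text \<open>\<open>'k\<close> is an infinite type of cardinality \<open>\<kappa>\<close>.  The nonzero cardinals
  \<open>m \<le> \<kappa>\<close> are represented by the nonempty \<open>I \<subseteq> UNIV :: 'k set\<close>, and a graded
  set by one level for each such \<open>I\<close>.  Levels of the same cardinality are identified by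
  unitaries \<open>\<ell>\<^sup>2(J) \<rightarrow> \<ell>\<^sup>2(I)\<close>, which are among the isometries in the closure
  conditions.  Levels at \<open>I = {}\<close> are never used.  A family of isometries with
  \<open>\<Sum>\<^sub>s \<alpha>\<^sub>s \<alpha>\<^sub>s\<^sup>* = 1\<close> has at most \<open>\<kappa>\<close> members, so
  \<open>'k\<close> also indexes families.\<close>

definition sum_family :: "'k set \<Rightarrow> 'k set \<Rightarrow> ('k \<Rightarrow> 'k set) \<Rightarrow>
    ('k \<Rightarrow> ('k, 'k, 'f::star_field) mat) \<Rightarrow> bool" where
  "sum_family I S J \<alpha> \<longleftrightarrow>
     (\<forall>s\<in>S. J s \<noteq> {} \<and> isometry_mat I (J s) (\<alpha> s)) \<and>
     (\<forall>p q. ((\<lambda>s. mmul (\<alpha> s) (madj (\<alpha> s)) p q) has_sum mone I p q) S)"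

text \<open>Closure of a graded set under direct sums of bounded families and under compressions,
  for given norms, direct sum and compression.\<close>

definition nc_closed :: "('k set \<Rightarrow> 'z \<Rightarrow> real) \<Rightarrow>
    ('k set \<Rightarrow> ('k \<Rightarrow> ('k, 'k, 'f::star_field) mat) \<Rightarrow> ('k \<Rightarrow> 'z) \<Rightarrow> 'z) \<Rightarrow>
    (('k, 'k, 'f) mat \<Rightarrow> 'z \<Rightarrow> 'z) \<Rightarrow> ('k set \<Rightarrow> 'z set) \<Rightarrow> bool" where
  "nc_closed nrm dirsum compr K \<longleftrightarrow>
     (\<forall>I S J \<alpha> x. I \<noteq> {} \<and> sum_family I S J \<alpha> \<and> (\<forall>s\<in>S. x s \<in> K (J s)) \<and>
        (\<exists>C. \<forall>s\<in>S. nrm (J s) (x s) \<le> C) \<longrightarrow> dirsum S \<alpha> x \<in> K I) \<and>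
     (\<forall>I J \<beta> x. I \<noteq> {} \<and> J \<noteq> {} \<and> isometry_mat I J \<beta> \<and> x \<in> K I \<longrightarrow> compr \<beta> x \<in> K J)"

definition nc_convex_set :: "('e::real_normed_vector, 'f::star_field) dual_os \<Rightarrow>
    ('k set \<Rightarrow> ('k, 'k, 'e) mat set) \<Rightarrow> bool" where
  "nc_convex_set E K \<longleftrightarrow>
     (\<forall>I. I \<noteq> {} \<longrightarrow> K I \<subseteq> mats E I) \<and>
     nc_closed (mats_norm E) (direct_sum E) (\<lambda>\<beta> x. sandwich E (madj \<beta>) x \<beta>) K"

definition compact_nc_convex_set :: "('e::real_normed_vector, 'f::star_field) dual_os \<Rightarrow>
    ('k set \<Rightarrow> ('k, 'k, 'e) mat set) \<Rightarrow> bool" where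
  "compact_nc_convex_set E K \<longleftrightarrow>
     nc_convex_set E K \<and> (\<forall>I. I \<noteq> {} \<longrightarrow> compactin (weak_star E I) (K I))"


section \<open>nc functions\<close>

text \<open>\<open>M\<^sub>n(M\<^sub>I(F))\<close> is the space of scalar matrices indexed by
  \<open>UNIV \<times> I :: ('n \<times> 'k) set\<close>, with \<open>n\<close> the cardinality of \<open>'n\<close>.\<close>

type_synonym ('k, 'e, 'n, 'f) ncfun = "'k set \<Rightarrow> ('k, 'k, 'e) mat \<Rightarrow> ('n \<times> 'k, 'n \<times> 'k, 'f) mat"

definition bdd_nc_funs :: "('e::real_normed_vector, 'f::star_field) dual_os \<Rightarrow>
    ('k set \<Rightarrow> ('k, 'k, 'e) mat set) \<Rightarrow> ('k, 'e, 'n, 'f) ncfun set" where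
  "bdd_nc_funs E K = {f.
     (\<forall>I. I \<noteq> {} \<longrightarrow> (\<forall>x\<in>K I. f I x \<in> mats scalars (UNIV \<times> I))) \<and>
     (\<forall>I U. I \<noteq> {} \<and> unitary_mat I U \<longrightarrow> (\<forall>x\<in>K I.
        f I (sandwich E U x (madj U)) = sandwich scalars (ampl U) (f I x) (ampl (madj U)))) \<and>
     (\<forall>I S J \<alpha> x. I \<noteq> {} \<and> sum_family I S J \<alpha> \<and> (\<forall>s\<in>S. x s \<in> K (J s)) \<and>
        (\<exists>C. \<forall>s\<in>S. mats_norm E (J s) (x s) \<le> C) \<longrightarrow>
        f I (direct_sum E S \<alpha> x) = direct_sum scalars S (\<lambda>s. ampl (\<alpha> s)) (\<lambda>s. f (J s) (x s))) \<and>
     (\<exists>C. \<forall>I. I \<noteq> {} \<longrightarrow> (\<forall>x\<in>K I. mats_norm scalars (UNIV \<times> I) (f I x) \<le> C))}"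

definition bdd_nc_funs_sa :: "('e::real_normed_vector, 'f::star_field) dual_os \<Rightarrow>
    ('k set \<Rightarrow> ('k, 'k, 'e) mat set) \<Rightarrow> ('k, 'e, 'n, 'f) ncfun set" where
  "bdd_nc_funs_sa E K =
     {f \<in> bdd_nc_funs E K. \<forall>I. I \<noteq> {} \<longrightarrow> (\<forall>x\<in>K I. madj (f I x) = f I x)}"

definition Epi :: "('k set \<Rightarrow> ('k, 'k, 'e) mat set) \<Rightarrow> ('k, 'e, 'n, 'f::star_field) ncfun \<Rightarrow>
    'k set \<Rightarrow> (('k, 'k, 'e) mat \<times> ('n \<times> 'k, 'n \<times> 'k, 'f) mat) set" where
  "Epi K f I = {(x, \<gamma>). x \<in> K I \<and> \<gamma> \<in> mats scalars (UNIV \<times> I) \<and> madj \<gamma> = \<gamma> \<and>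
                  mat_pos (UNIV \<times> I) (\<lambda>p q. \<gamma> p q - f I x p q)}"

definition nc_convex_fun :: "('e::real_normed_vector, 'f::star_field) dual_os \<Rightarrow>
    ('k set \<Rightarrow> ('k, 'k, 'e) mat set) \<Rightarrow> ('k, 'e, 'n, 'f) ncfun \<Rightarrow> bool" where
  "nc_convex_fun E K f \<longleftrightarrow>
     nc_closed
       (\<lambda>I (x, \<gamma>). max (mats_norm E I x) (mats_norm scalars (UNIV \<times> I) \<gamma>))
       (\<lambda>S \<alpha> z. (direct_sum E S \<alpha> (\<lambda>s. fst (z s)),
                 direct_sum scalars S (\<lambda>s. ampl (\<alpha> s)) (\<lambda>s. snd (z s))))
       (\<lambda>\<beta> (x, \<gamma>). (sandwich E (madj \<beta>) x \<beta>,
                      sandwich scalars (ampl (madj \<beta>)) \<gamma> (ampl \<beta>)))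
       (Epi K f)"

definition nc_lsc :: "('e::real_normed_vector, 'f::star_field) dual_os \<Rightarrow>
    ('k set \<Rightarrow> ('k, 'k, 'e) mat set) \<Rightarrow> ('k, 'e, 'n, 'f) ncfun \<Rightarrow> bool" where
  "nc_lsc E K f \<longleftrightarrow>
     (\<forall>I. I \<noteq> {} \<longrightarrow>
        closedin (prod_topology (weak_star E I) (weak_star scalars (UNIV \<times> I))) (Epi K f I))"


section \<open>Complexification\<close>

text \<open>\<open>x + iy\<close> is the pair \<open>(x, y)\<close>.\<close>

definition cmat :: "('a, 'a, 'e::ab_group_add \<times> 'e) mat \<Rightarrow> ('a + 'a, 'a + 'a, 'e) mat" where
  "cmat z = (\<lambda>p q. case (p, q) of
       (Inl i, Inl j) \<Rightarrow> fst (z i j)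
     | (Inl i, Inr j) \<Rightarrow> - snd (z i j)
     | (Inr i, Inl j) \<Rightarrow> snd (z i j)
     | (Inr i, Inr j) \<Rightarrow> fst (z i j))"

definition split_nat :: "nat \<Rightarrow> nat \<Rightarrow> nat + nat" where
  "split_nat n i = (if i < n then Inl i else Inr (i - n))"

definition complexify :: "('e::real_vector, real) dual_os \<Rightarrow> ('e \<times> 'e, complex) dual_os" where
  "complexify E =
     \<lparr>os_scale = (\<lambda>c (x, y). (Re c *\<^sub>R x - Im c *\<^sub>R y, Im c *\<^sub>R x + Re c *\<^sub>R y)),
      os_norm = (\<lambda>n z. os_norm E (2 * n) (\<lambda>i j. cmat z (split_nat n i) (split_nat n j))),
      os_predual = {(\<lambda>(x, y). Complex (\<phi> x - \<psi> y) (\<phi> y + \<psi> x)) | \<phi> \<psi>.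
                      \<phi> \<in> os_predual E \<and> \<psi> \<in> os_predual E}\<rparr>"

text \<open>A fixed identification of \<open>2\<kappa>\<close> with \<open>\<kappa>\<close>, placing \<open>2m\<close> among
  the index sets.  Another choice changes \<open>c(z)\<close> by a permutation unitary, under which
  nc convex sets and nc functions are invariant.\<close>

definition dbl :: "'k + 'k \<Rightarrow> 'k" where
  "dbl = (SOME e. bij e)"

definition dbl_set :: "'k set \<Rightarrow> 'k set" where
  "dbl_set I = dbl ` (I <+> I)"

definition cmat_dbl :: "('k, 'k, 'e::ab_group_add \<times> 'e) mat \<Rightarrow> ('k, 'k, 'e) mat" where
  "cmat_dbl z = (\<lambda>p q. cmat z (inv dbl p) (inv dbl q))"

definition set_complexify :: "('e::real_vector, real) dual_os \<Rightarrow>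
    ('k set \<Rightarrow> ('k, 'k, 'e) mat set) \<Rightarrow> 'k set \<Rightarrow> ('k, 'k, 'e \<times> 'e) mat set" where
  "set_complexify E K I = {z \<in> mats (complexify E) I. cmat_dbl z \<in> K (dbl_set I)}"

definition u_mat :: "'k set \<Rightarrow> ('k, 'k, complex) mat" where
  "u_mat I = (\<lambda>p j. case inv dbl p of
       Inl i \<Rightarrow> mone I i j / complex_of_real (sqrt 2)
     | Inr i \<Rightarrow> - \<i> * mone I i j / complex_of_real (sqrt 2))"

definition fun_complexify :: "('k, 'e::ab_group_add, 'n, real) ncfun \<Rightarrow>
    ('k, 'e \<times> 'e, 'n, complex) ncfun" where
  "fun_complexify f I z =
     sandwich scalars (ampl (madj (u_mat I)))
       (\<lambda>p q. complex_of_real (f (dbl_set I) (cmat_dbl z) p q)) (ampl (u_mat I))"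

end

theory Submission
  imports Defs
begin

text \<open>The map \<open>c\<close> carries complex matrix products, direct sums and compressions to real ones, and
  \<open>c(\<delta>) \<ge> 0\<close> iff \<open>\<delta> \<ge> 0\<close>.  Since \<open>c(z)\<close> commutes with the orthogonal
  matrix \<open>J = c(i 1)\<close>, so does \<open>f (c(z))\<close>, hence \<open>f (c(z)) = c (f\<^sub>c(z))\<close>.  Therefore
  \<open>(z, \<delta>)\<close> lies in the epigraph of \<open>f\<^sub>c\<close> iff \<open>(c(z), c(\<delta>))\<close> lies in that of \<open>f\<close>.
  Conversely \<open>c(x + i 0) = x \<oplus> x\<close> and \<open>f (x \<oplus> x) = f x \<oplus> f x\<close>, so \<open>(x, \<gamma>)\<close> lies in the
  epigraph of \<open>f\<close> iff \<open>(x + i 0, \<gamma> + i 0)\<close> lies in that of \<open>f\<^sub>c\<close>.  Both maps respect direct sums,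
  compressions and norm bounds, and are weak* continuous, so either epigraph inherits
  being nc convex or weak* closed from the other.\<close>


section \<open>Unconditional sums of bounded forms\<close>

text \<open>A divergent \<open>infsum\<close> has the default value 0, so an identity such as
  c(\<alpha> z \<beta>) = c(\<alpha>) c(z) c(\<beta>) needs summability: a series over the doubled
  index set splits into its two halves only if it converges. Convergence comes from a bound on
  finite sums of entries with real weights, which Ruan's axiom supplies over \<open>E\<close> and
  the operator norm supplies for scalars. The embedding x + i 0 meets no such obstacle, since it
  preserves and reflects summability. Entries live in two complex spaces, the complex numbers and
  pairs over \<open>E\<close>, and index sets occur with and without the factor n. The doubling is
  therefore set up once, for abstract real and imaginary parts and an arbitrary bijection. Estimates
  may lose constant factors, because only boundedness of families and of maps is ever used. The
  matrix u inverts c: its columns satisfy c(w) u = u w, and u is an isometry. Commuting with J is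
  what places f(c(z)) in the range of c.\<close>

lemma sum_le_infsum_nonneg:
  fixes g :: "'a \<Rightarrow> real"
  assumes "g summable_on UNIV" "\<And>x. 0 \<le> g x" "finite F"
  shows "sum g F \<le> infsum g UNIV"
  by (rule finite_sum_le_infsum) (use assms in auto)

text \<open>Cauchy criterion: off a finite set that captures \<open>g\<close> up to
  \<open>d\<close>, finite sums of \<open>g\<close> are at most \<open>d\<close>, so those of
  \<open>f\<close> are at most \<open>C * sqrt d\<close>. Absolute convergence cannot be expected,
  as orthogonal vectors with square summable norms show.\<close>

lemma summable_on_sqrt_bound:
  fixes f :: "'a \<Rightarrow> 'e::banach" and g :: "'a \<Rightarrow> real"
  assumes bound: "\<And>F. finite F \<Longrightarrow> norm (sum f F) \<le> C * sqrt (sum g F)"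
    and g: "g summable_on UNIV" and g0: "\<And>x. 0 \<le> g x" and C: "0 \<le> C"
  shows "f summable_on UNIV"
proof -
  have "\<exists>P. eventually P (finite_subsets_at_top UNIV) \<and>
              (\<forall>F F'. P F \<and> P F' \<longrightarrow> dist (sum f F) (sum f F') < e)" if "e > 0" for e
  proof -
    \<comment> \<open>Makes \<open>C * sqrt d\<close> equal to
      \<open>C * (e / (4 * (C + 1)))\<close>, which is below \<open>e / 2\<close>; the summand 1
      covers \<open>C = 0\<close>.\<close>
    define d where "d = (e / (4 * (C + 1)))\<^sup>2"
    have d: "d > 0" using that C by (simp add: d_def)
    obtain F0 where F0: "finite F0" "dist (sum g F0) (infsum g UNIV) \<le> d"
      using infsum_finite_approximation[OF g d] by blast
    have small: "sum g F \<le> d" if "finite F" "F \<inter> F0 = {}" for F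
    proof -
      have "sum g F0 + sum g F = sum g (F0 \<union> F)"
        using F0(1) that by (subst sum.union_disjoint) auto
      also have "\<dots> \<le> infsum g UNIV"
        using F0(1) that by (intro sum_le_infsum_nonneg g g0) auto
      finally show ?thesis using F0(2) by (simp add: dist_real_def abs_if split: if_splits)
    qed
    define P where "P F \<longleftrightarrow> finite F \<and> F0 \<subseteq> F" for F
    have P: "eventually P (finite_subsets_at_top UNIV)"
      unfolding P_def eventually_finite_subsets_at_top using F0(1) by blast
    have near: "dist (sum f F) (sum f F0) < e / 2" if "P F" for F
    proof -
      have "dist (sum f F) (sum f F0) = norm (sum f (F - F0))"
        using that by (simp add: P_def dist_norm sum_diff)
      also have "\<dots> \<le> C * sqrt (sum g (F - F0))"
        using that by (intro bound) (auto simp: P_def)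
      also have "\<dots> \<le> C * sqrt d"
        using that C by (intro mult_left_mono real_sqrt_le_mono small) (auto simp: P_def)
      also have "\<dots> = C * (e / (4 * (C + 1)))"
        using \<open>e > 0\<close> C by (simp add: d_def)
      also have "\<dots> < e / 2"
        using \<open>e > 0\<close> C by (simp add: field_simps add_strict_increasing)
      finally show ?thesis .
    qed
    have "dist (sum f F) (sum f F') < e" if "P F" "P F'" for F F'
      using near[OF that(1)] near[OF that(2)]
      by (metis dist_commute dist_triangle_half_r)
    then show ?thesis using P by blast
  qed
  then have "cauchy_filter (filtermap (sum f) (finite_subsets_at_top UNIV))"
    by (simp add: cauchy_filter_metric_filtermap)
  moreover have "complete (UNIV :: 'e set)"
    by (meson Cauchy_convergent UNIV_I complete_def convergent_def)
  ultimately obtain L where "(sum f \<longlongrightarrow> L) (finite_subsets_at_top UNIV)"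
    using complete_uniform[where S = UNIV] by (force simp add: filterlim_def)
  then show ?thesis
    using summable_on_def has_sum_def by blast
qed

lemma norm_infsum_le_sqrt:
  fixes f :: "'a \<Rightarrow> 'e::real_normed_vector" and g :: "'a \<Rightarrow> real"
  assumes f: "f summable_on UNIV"
    and bound: "\<And>F. finite F \<Longrightarrow> norm (sum f F) \<le> C * sqrt (sum g F)"
    and g: "g summable_on UNIV" and g0: "\<And>x. 0 \<le> g x" and C: "0 \<le> C"
  shows "norm (infsum f UNIV) \<le> C * sqrt (infsum g UNIV)"
proof (rule tendsto_upperbound)
  show "((\<lambda>F. norm (sum f F)) \<longlongrightarrow> norm (infsum f UNIV)) (finite_subsets_at_top UNIV)"
    using has_sum_infsum[OF f] unfolding has_sum_def by (rule tendsto_norm)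
  show "\<forall>\<^sub>F F in finite_subsets_at_top UNIV. norm (sum f F) \<le> C * sqrt (infsum g UNIV)"
  proof (rule eventually_finite_subsets_at_top_weakI)
    fix F :: "'a set" assume "finite F"
    then show "norm (sum f F) \<le> C * sqrt (infsum g UNIV)"
      using bound[of F] sum_le_infsum_nonneg[OF g g0, of F] C
      by (meson mult_left_mono order_trans real_sqrt_le_mono)
  qed
qed auto

lemma has_sum_finite_sum:
  fixes f :: "'i \<Rightarrow> 'a \<Rightarrow> 'e::topological_comm_monoid_add"
  assumes "\<And>i. i \<in> F \<Longrightarrow> (f i has_sum s i) A"
  shows "((\<lambda>x. \<Sum>i\<in>F. f i x) has_sum (\<Sum>i\<in>F. s i)) A"
  using assms by (induction F rule: infinite_finite_induct) (auto intro: has_sum_add)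

section \<open>Square summable coefficients and bounded bilinear forms with values in a Banach
  space\<close>

definition sq_summable :: "('a \<Rightarrow> real) \<Rightarrow> bool" where
  "sq_summable a \<longleftrightarrow> (\<lambda>k. (a k)\<^sup>2) summable_on UNIV"

text \<open>Common ground of real scalar operators and of matrices over a real operator space. Real
  weights suffice, because convergence is settled for the doubled real matrices and complex products
  are then read off blockwise.\<close>

definition form_bound :: "('a \<Rightarrow> 'b \<Rightarrow> 'e::real_normed_vector) \<Rightarrow> real \<Rightarrow> bool" where
  "form_bound M C \<longleftrightarrow> 0 \<le> C \<and> (\<forall>F G a b. finite F \<and> finite G \<longrightarrow>
     norm (\<Sum>k\<in>F. \<Sum>l\<in>G. (a k * b l) *\<^sub>R M k l)
       \<le> C * sqrt (\<Sum>k\<in>F. (a k)\<^sup>2) * sqrt (\<Sum>l\<in>G. (b l)\<^sup>2))"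

lemma form_boundD:
  assumes "form_bound M C" "finite F" "finite G"
  shows "norm (\<Sum>k\<in>F. \<Sum>l\<in>G. (a k * b l) *\<^sub>R M k l)
       \<le> C * sqrt (\<Sum>k\<in>F. (a k)\<^sup>2) * sqrt (\<Sum>l\<in>G. (b l)\<^sup>2)"
  using assms by (auto simp: form_bound_def)

lemma form_bound_nonneg: "form_bound M C \<Longrightarrow> 0 \<le> C"
  by (simp add: form_bound_def)

lemma row_summable:
  fixes M :: "'a \<Rightarrow> 'b \<Rightarrow> 'e::banach"
  assumes M: "form_bound M C" and b: "sq_summable b"
  shows "(\<lambda>l. b l *\<^sub>R M k l) summable_on UNIV"
proof (rule summable_on_sqrt_bound)
  show "norm (\<Sum>l\<in>F. b l *\<^sub>R M k l) \<le> C * sqrt (\<Sum>l\<in>F. (b l)\<^sup>2)" if "finite F" for F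
    using form_boundD[OF M, of "{k}" F "\<lambda>_. 1" b] that by simp
qed (use M b in \<open>auto simp: sq_summable_def form_bound_nonneg\<close>)

text \<open>The finite outer sum moves inside the inner series, whose partial sums are then values
  of the form. The row sums thus satisfy a square root bound in \<open>a\<close>, with
  \<open>C\<close> enlarged by the norm of \<open>b\<close>, and this makes the outer series
  converge.\<close>

lemma norm_sum_rows_le:
  fixes M :: "'a \<Rightarrow> 'b \<Rightarrow> 'e::banach"
  assumes M: "form_bound M C" and b: "sq_summable b" and F: "finite F"
  shows "norm (\<Sum>k\<in>F. a k *\<^sub>R (\<Sum>\<^sub>\<infinity>l. b l *\<^sub>R M k l))
       \<le> C * sqrt (\<Sum>\<^sub>\<infinity>l. (b l)\<^sup>2) * sqrt (\<Sum>k\<in>F. (a k)\<^sup>2)"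
proof -
  have hs: "((\<lambda>l. \<Sum>k\<in>F. (a k * b l) *\<^sub>R M k l) has_sum (\<Sum>k\<in>F. a k *\<^sub>R (\<Sum>\<^sub>\<infinity>l. b l *\<^sub>R M k l))) UNIV"
    unfolding scaleR_scaleR[symmetric]
    by (intro has_sum_finite_sum has_sum_scaleR has_sum_infsum row_summable[OF M b])
  have "norm (\<Sum>\<^sub>\<infinity>l. \<Sum>k\<in>F. (a k * b l) *\<^sub>R M k l)
      \<le> (C * sqrt (\<Sum>k\<in>F. (a k)\<^sup>2)) * sqrt (\<Sum>\<^sub>\<infinity>l. (b l)\<^sup>2)"
  proof (rule norm_infsum_le_sqrt)
    show "norm (\<Sum>l\<in>G. \<Sum>k\<in>F. (a k * b l) *\<^sub>R M k l)
        \<le> C * sqrt (\<Sum>k\<in>F. (a k)\<^sup>2) * sqrt (\<Sum>l\<in>G. (b l)\<^sup>2)" if "finite G" for G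
      using form_boundD[OF M F that, of a b] by (subst sum.swap)
  qed (use hs b in \<open>auto simp: sq_summable_def form_bound_nonneg[OF M] sum_nonneg has_sum_imp_summable\<close>)
  then show ?thesis using infsumI[OF hs] by (simp add: mult_ac)
qed

lemma sandwich_summable:
  fixes M :: "'a \<Rightarrow> 'b \<Rightarrow> 'e::banach"
  assumes M: "form_bound M C" and a: "sq_summable a" and b: "sq_summable b"
  shows "(\<lambda>k. a k *\<^sub>R (\<Sum>\<^sub>\<infinity>l. b l *\<^sub>R M k l)) summable_on UNIV"
  by (rule summable_on_sqrt_bound[OF norm_sum_rows_le[OF M b]])
    (use a in \<open>auto simp: sq_summable_def form_bound_nonneg[OF M] infsum_nonneg\<close>)

lemma norm_sandwich_le:
  fixes M :: "'a \<Rightarrow> 'b \<Rightarrow> 'e::banach"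
  assumes M: "form_bound M C" and a: "sq_summable a" and b: "sq_summable b"
  shows "norm (\<Sum>\<^sub>\<infinity>k. a k *\<^sub>R (\<Sum>\<^sub>\<infinity>l. b l *\<^sub>R M k l))
     \<le> C * sqrt (\<Sum>\<^sub>\<infinity>l. (b l)\<^sup>2) * sqrt (\<Sum>\<^sub>\<infinity>k. (a k)\<^sup>2)"
  by (rule norm_infsum_le_sqrt[OF sandwich_summable[OF assms] norm_sum_rows_le[OF M b]])
    (use a in \<open>auto simp: sq_summable_def form_bound_nonneg[OF M] infsum_nonneg\<close>)

text \<open>Each summand is at most \<open>C\<close> times the product of the norms of
  \<open>a s\<close> and \<open>b s\<close>, hence at most \<open>C\<close> times the sum of their
  squares. For rows of isometries with ranges summing to 1 those squares are summable over
  \<open>s\<close>, so the convergence is absolute.\<close>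

lemma direct_sum_summable:
  fixes M :: "'s \<Rightarrow> 'b \<Rightarrow> 'b \<Rightarrow> 'e::banach" and a b :: "'s \<Rightarrow> 'b \<Rightarrow> real"
  assumes M: "\<And>s. s \<in> S \<Longrightarrow> form_bound (M s) C"
    and a: "\<And>s. s \<in> S \<Longrightarrow> sq_summable (a s)" and b: "\<And>s. s \<in> S \<Longrightarrow> sq_summable (b s)"
    and sa: "(\<lambda>s. \<Sum>\<^sub>\<infinity>k. (a s k)\<^sup>2) summable_on S"
    and sb: "(\<lambda>s. \<Sum>\<^sub>\<infinity>k. (b s k)\<^sup>2) summable_on S"
  shows "(\<lambda>s. \<Sum>\<^sub>\<infinity>k. a s k *\<^sub>R (\<Sum>\<^sub>\<infinity>l. b s l *\<^sub>R M s k l)) summable_on S"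
proof (cases "S = {}")
  case False
  then have C: "0 \<le> C" using M form_bound_nonneg by blast
  have amgm: "sqrt x * sqrt y \<le> x + y" if "0 \<le> x" "0 \<le> y" for x y :: real
    using arith_geo_mean_sqrt[OF that] that by (simp add: real_sqrt_mult)
  show ?thesis
  proof (rule Infinite_Sum.abs_summable_summable, rule Infinite_Sum.abs_summable_on_comparison_test')
    show "(\<lambda>s. C * ((\<Sum>\<^sub>\<infinity>k. (b s k)\<^sup>2) + (\<Sum>\<^sub>\<infinity>k. (a s k)\<^sup>2))) summable_on S"
      by (intro summable_on_cmult_right summable_on_add sa sb)
    fix s assume s: "s \<in> S"
    have "norm (\<Sum>\<^sub>\<infinity>k. a s k *\<^sub>R (\<Sum>\<^sub>\<infinity>l. b s l *\<^sub>R M s k l))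
        \<le> C * sqrt (\<Sum>\<^sub>\<infinity>l. (b s l)\<^sup>2) * sqrt (\<Sum>\<^sub>\<infinity>k. (a s k)\<^sup>2)"
      by (rule norm_sandwich_le[OF M a b]) (rule s)+
    also have "\<dots> \<le> C * ((\<Sum>\<^sub>\<infinity>k. (b s k)\<^sup>2) + (\<Sum>\<^sub>\<infinity>k. (a s k)\<^sup>2))"
      unfolding mult.assoc by (intro mult_left_mono amgm infsum_nonneg C) auto
    finally show "norm (\<Sum>\<^sub>\<infinity>k. a s k *\<^sub>R (\<Sum>\<^sub>\<infinity>l. b s l *\<^sub>R M s k l))
        \<le> C * ((\<Sum>\<^sub>\<infinity>k. (b s k)\<^sup>2) + (\<Sum>\<^sub>\<infinity>k. (a s k)\<^sup>2))" .
  qed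
qed simp

lemma sq_summable_mult:
  assumes a: "sq_summable a" and b: "sq_summable b"
  shows "(\<lambda>k. a k * b k) summable_on UNIV"
proof (rule Infinite_Sum.abs_summable_summable, rule Infinite_Sum.abs_summable_on_comparison_test')
  show "(\<lambda>k. (a k)\<^sup>2 + (b k)\<^sup>2) summable_on UNIV"
    using assms by (intro summable_on_add) (auto simp: sq_summable_def)
  show "norm (a k * b k) \<le> (a k)\<^sup>2 + (b k)\<^sup>2" for k
  proof -
    have "2 * (\<bar>a k\<bar> * \<bar>b k\<bar>) \<le> (a k)\<^sup>2 + (b k)\<^sup>2"
      using sum_squares_bound[of "\<bar>a k\<bar>" "\<bar>b k\<bar>"] by simp
    moreover have "0 \<le> \<bar>a k\<bar> * \<bar>b k\<bar>" by simp
    ultimately have "\<bar>a k\<bar> * \<bar>b k\<bar> \<le> (a k)\<^sup>2 + (b k)\<^sup>2" by linarith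
    then show ?thesis by (simp add: abs_mult)
  qed
qed


section \<open>Doubled matrices\<close>

text \<open>The map c. The parameters \<open>re\<close> and \<open>im\<close> let one definition
  serve complex entries and pairs over \<open>E\<close>; a free bijection \<open>d\<close> lets it
  serve the index set with the extra factor n as well.\<close>

definition dblmat :: "('a + 'a \<Rightarrow> 'a) \<Rightarrow> ('c \<Rightarrow> 'e::ab_group_add) \<Rightarrow> ('c \<Rightarrow> 'e) \<Rightarrow>
    ('a, 'a, 'c) mat \<Rightarrow> ('a, 'a, 'e) mat" where
  "dblmat d re im z = (\<lambda>p q. case (inv d p, inv d q) of
       (Inl i, Inl j) \<Rightarrow> re (z i j)
     | (Inl i, Inr j) \<Rightarrow> - im (z i j)
     | (Inr i, Inl j) \<Rightarrow> im (z i j)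
     | (Inr i, Inr j) \<Rightarrow> re (z i j))"

abbreviation cdbl :: "('a + 'a \<Rightarrow> 'a) \<Rightarrow> ('a, 'a, complex) mat \<Rightarrow> ('a, 'a, real) mat" where
  "cdbl d \<equiv> dblmat d Re Im"

lemma dblmat_simps [simp]:
  assumes "bij d"
  shows "dblmat d re im z (d (Inl i)) (d (Inl j)) = re (z i j)"
    and "dblmat d re im z (d (Inl i)) (d (Inr j)) = - im (z i j)"
    and "dblmat d re im z (d (Inr i)) (d (Inl j)) = im (z i j)"
    and "dblmat d re im z (d (Inr i)) (d (Inr j)) = re (z i j)"
  using assms by (simp_all add: dblmat_def bij_is_inj)

lemma dbl_cases:
  assumes "bij d"
  obtains i where "p = d (Inl i)" | i where "p = d (Inr i)"
  using assms by (metis bij_pointE sum.exhaust)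

lemma dbl_ext:
  assumes d: "bij d"
    and "\<And>i j. A (d (Inl i)) (d (Inl j)) = B (d (Inl i)) (d (Inl j))"
    and "\<And>i j. A (d (Inl i)) (d (Inr j)) = B (d (Inl i)) (d (Inr j))"
    and "\<And>i j. A (d (Inr i)) (d (Inl j)) = B (d (Inr i)) (d (Inl j))"
    and "\<And>i j. A (d (Inr i)) (d (Inr j)) = B (d (Inr i)) (d (Inr j))"
  shows "A = B"
proof (intro ext)
  fix p q
  show "A p q = B p q"
    by (cases p rule: dbl_cases[OF d]; cases q rule: dbl_cases[OF d]) (simp_all add: assms)
qed

text \<open>Summability of \<open>h\<close> is assumed because the paired series may converge by
  cancellation between the halves although \<open>h\<close> is not summable.\<close>

lemma has_sum_dbl:
  fixes h :: "'a \<Rightarrow> 'e::banach"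
  assumes d: "bij d" and h: "h summable_on UNIV"
  shows "((\<lambda>i. h (d (Inl i)) + h (d (Inr i))) has_sum infsum h UNIV) UNIV"
proof -
  have L: "inj (\<lambda>i. d (Inl i))" and R: "inj (\<lambda>i. d (Inr i))"
    using bij_is_inj[OF d] by (auto simp: inj_def)
  have disj: "range (\<lambda>i. d (Inl i)) \<inter> range (\<lambda>i. d (Inr i)) = {}"
    using bij_is_inj[OF d] by (auto dest: injD)
  have "p \<in> range (\<lambda>i. d (Inl i)) \<union> range (\<lambda>i. d (Inr i))" for p
    by (cases p rule: dbl_cases[OF d]) auto
  then have un: "range (\<lambda>i. d (Inl i)) \<union> range (\<lambda>i. d (Inr i)) = UNIV" by blast
  have sL: "h summable_on range (\<lambda>i. d (Inl i))" and sR: "h summable_on range (\<lambda>i. d (Inr i))"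
    using h by (auto intro: summable_on_subset_banach)
  have "infsum h UNIV = infsum h (range (\<lambda>i. d (Inl i))) + infsum h (range (\<lambda>i. d (Inr i)))"
    using infsum_Un_disjoint[OF sL sR disj] un by simp
  moreover have "((\<lambda>i. h (d (Inl i))) has_sum infsum h (range (\<lambda>i. d (Inl i)))) UNIV"
    using has_sum_infsum[OF sL] by (simp add: has_sum_reindex[OF L] o_def)
  moreover have "((\<lambda>i. h (d (Inr i))) has_sum infsum h (range (\<lambda>i. d (Inr i)))) UNIV"
    using has_sum_infsum[OF sR] by (simp add: has_sum_reindex[OF R] o_def)
  ultimately show ?thesis by (simp add: has_sum_add)
qed

lemma has_sum_Pair:
  fixes f :: "'i \<Rightarrow> 'a::real_normed_vector" and g :: "'i \<Rightarrow> 'b::real_normed_vector"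
  assumes "(f has_sum x) A" "(g has_sum y) A"
  shows "((\<lambda>i. (f i, g i)) has_sum (x, y)) A"
proof -
  have "sum (\<lambda>i. (f i, g i)) = (\<lambda>F. (sum f F, sum g F))"
    by (auto simp: fun_eq_iff sum_prod)
  then show ?thesis
    using assms by (simp add: has_sum_def tendsto_Pair)
qed

text \<open>A complex vector space presented by real and imaginary parts in \<open>'e\<close>;
  \<open>scl_eq\<close> is complex multiplication in these coordinates. Bounded linearity of
  \<open>mk\<close> allows a series to be summed componentwise and reassembled.\<close>

locale complex_pair =
  fixes re im :: "'c::real_normed_vector \<Rightarrow> 'e::banach"
    and mk :: "'e \<times> 'e \<Rightarrow> 'c"
    and scl :: "complex \<Rightarrow> 'c \<Rightarrow> 'c"
  assumes mk_linear: "bounded_linear mk"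
    and re_mk [simp]: "re (mk (x, y)) = x"
    and im_mk [simp]: "im (mk (x, y)) = y"
    and mk_re_im [simp]: "mk (re w, im w) = w"
    and scl_eq: "scl a w = mk (Re a *\<^sub>R re w - Im a *\<^sub>R im w, Re a *\<^sub>R im w + Im a *\<^sub>R re w)"
begin

lemma pair_eqI: "re w = re w' \<Longrightarrow> im w = im w' \<Longrightarrow> w = w'"
  by (metis mk_re_im)

lemma infsum_pair:
  assumes "((\<lambda>i. re (f i)) has_sum x) A" "((\<lambda>i. im (f i)) has_sum y) A"
  shows "infsum f A = mk (x, y)"
proof -
  have "((\<lambda>i. mk (re (f i), im (f i))) has_sum mk (x, y)) A"
    by (rule has_sum_bounded_linear[OF mk_linear has_sum_Pair[OF assms]])
  then show ?thesis by (simp add: infsumI)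
qed

lemma dblmat_inject:
  assumes "bij d" "dblmat d re im z = dblmat d re im w"
  shows "z = w"
proof (intro ext pair_eqI)
  fix i j
  show "re (z i j) = re (w i j)"
    using fun_cong[OF fun_cong[OF assms(2), of "d (Inl i)"], of "d (Inl j)"] assms(1) by simp
  show "im (z i j) = im (w i j)"
    using fun_cong[OF fun_cong[OF assms(2), of "d (Inr i)"], of "d (Inl j)"] assms(1) by simp
qed

text \<open>The two block relations describe the range of c; the first block column then determines
  the preimage.\<close>

lemma dblmat_ex:
  assumes d: "bij d"
    and "\<And>i j. A (d (Inr i)) (d (Inr j)) = A (d (Inl i)) (d (Inl j))"
    and "\<And>i j. A (d (Inl i)) (d (Inr j)) = - A (d (Inr i)) (d (Inl j))"
  shows "dblmat d re im (\<lambda>i j. mk (A (d (Inl i)) (d (Inl j)), A (d (Inr i)) (d (Inl j)))) = A"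
  by (rule dbl_ext[OF d]) (simp_all add: d assms)

text \<open>The left block column determines the sum. The series for the right column are the same
  up to sign, so uniqueness of sums forces the block relations on \<open>P\<close>.\<close>

lemma dblmat_infsumI:
  fixes g :: "'a \<Rightarrow> 'a \<Rightarrow> 'l \<Rightarrow> 'c"
  assumes d: "bij d"
    and LL: "\<And>i j. ((\<lambda>l. re (g i j l)) has_sum P (d (Inl i)) (d (Inl j))) S"
    and RL: "\<And>i j. ((\<lambda>l. im (g i j l)) has_sum P (d (Inr i)) (d (Inl j))) S"
    and LR: "\<And>i j. ((\<lambda>l. - im (g i j l)) has_sum P (d (Inl i)) (d (Inr j))) S"
    and RR: "\<And>i j. ((\<lambda>l. re (g i j l)) has_sum P (d (Inr i)) (d (Inr j))) S"
  shows "P = dblmat d re im (\<lambda>i j. \<Sum>\<^sub>\<infinity>l\<in>S. g i j l)"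
  unfolding infsum_pair[OF LL RL]
proof (rule dblmat_ex[OF d, symmetric])
  show "P (d (Inr i)) (d (Inr j)) = P (d (Inl i)) (d (Inl j))" for i j
    using has_sum_unique[OF LL RR] by simp
  have "((\<lambda>l. - im (g i j l)) has_sum - P (d (Inr i)) (d (Inl j))) S" for i j
    using RL by (simp add: has_sum_uminus)
  from has_sum_unique[OF LR this]
  show "P (d (Inl i)) (d (Inr j)) = - P (d (Inr i)) (d (Inl j))" for i j .
qed

text \<open>Splitting the inner index into its halves turns each entry into two real products, which
  are the real or imaginary part of a complex product up to sign. Left and right factors are treated
  separately because \<open>sandwich\<close> is an iterated sum.\<close>

lemma dblmat_mult_right:
  assumes d: "bij d"
    and summ: "\<And>k q. (\<lambda>l. cdbl d \<beta> l q *\<^sub>R dblmat d re im z k l) summable_on UNIV"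
  shows "(\<lambda>k q. \<Sum>\<^sub>\<infinity>l. cdbl d \<beta> l q *\<^sub>R dblmat d re im z k l) =
    dblmat d re im (\<lambda>k j. \<Sum>\<^sub>\<infinity>l. scl (\<beta> l j) (z k l))"
proof -
  define P where "P = (\<lambda>k q. \<Sum>\<^sub>\<infinity>l. cdbl d \<beta> l q *\<^sub>R dblmat d re im z k l)"
  have hs: "((\<lambda>l. cdbl d \<beta> (d (Inl l)) q *\<^sub>R dblmat d re im z k (d (Inl l)) +
      cdbl d \<beta> (d (Inr l)) q *\<^sub>R dblmat d re im z k (d (Inr l))) has_sum P k q) UNIV" for k q
    using has_sum_dbl[OF d summ[where k = k and q = q]] by (simp add: P_def)
  have LL: "((\<lambda>l. re (scl (\<beta> l j) (z i l))) has_sum P (d (Inl i)) (d (Inl j))) UNIV" for i j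
    using hs[of "d (Inl j)" "d (Inl i)"] d by (simp add: scl_eq)
  have RL: "((\<lambda>l. im (scl (\<beta> l j) (z i l))) has_sum P (d (Inr i)) (d (Inl j))) UNIV" for i j
    using hs[of "d (Inl j)" "d (Inr i)"] d by (simp add: scl_eq add.commute)
  have LR: "((\<lambda>l. - im (scl (\<beta> l j) (z i l))) has_sum P (d (Inl i)) (d (Inr j))) UNIV" for i j
    using hs[of "d (Inr j)" "d (Inl i)"] d by (simp add: scl_eq algebra_simps)
  have RR: "((\<lambda>l. re (scl (\<beta> l j) (z i l))) has_sum P (d (Inr i)) (d (Inr j))) UNIV" for i j
    using hs[of "d (Inr j)" "d (Inr i)"] d by (simp add: scl_eq algebra_simps)
  show ?thesis
    unfolding P_def[symmetric] by (rule dblmat_infsumI[OF d LL RL LR RR])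
qed

lemma dblmat_mult_left:
  assumes d: "bij d"
    and summ: "\<And>p q. (\<lambda>k. cdbl d \<alpha> p k *\<^sub>R dblmat d re im z k q) summable_on UNIV"
  shows "(\<lambda>p q. \<Sum>\<^sub>\<infinity>k. cdbl d \<alpha> p k *\<^sub>R dblmat d re im z k q) =
    dblmat d re im (\<lambda>i j. \<Sum>\<^sub>\<infinity>k. scl (\<alpha> i k) (z k j))"
proof -
  define P where "P = (\<lambda>p q. \<Sum>\<^sub>\<infinity>k. cdbl d \<alpha> p k *\<^sub>R dblmat d re im z k q)"
  have hs: "((\<lambda>k. cdbl d \<alpha> p (d (Inl k)) *\<^sub>R dblmat d re im z (d (Inl k)) q +
      cdbl d \<alpha> p (d (Inr k)) *\<^sub>R dblmat d re im z (d (Inr k)) q) has_sum P p q) UNIV" for p q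
    using has_sum_dbl[OF d summ[where p = p and q = q]] by (simp add: P_def)
  have LL: "((\<lambda>k. re (scl (\<alpha> i k) (z k j))) has_sum P (d (Inl i)) (d (Inl j))) UNIV" for i j
    using hs[of "d (Inl i)" "d (Inl j)"] d by (simp add: scl_eq)
  have RL: "((\<lambda>k. im (scl (\<alpha> i k) (z k j))) has_sum P (d (Inr i)) (d (Inl j))) UNIV" for i j
    using hs[of "d (Inr i)" "d (Inl j)"] d by (simp add: scl_eq add.commute)
  have LR: "((\<lambda>k. - im (scl (\<alpha> i k) (z k j))) has_sum P (d (Inl i)) (d (Inr j))) UNIV" for i j
    using hs[of "d (Inl i)" "d (Inr j)"] d by (simp add: scl_eq algebra_simps)
  have RR: "((\<lambda>k. re (scl (\<alpha> i k) (z k j))) has_sum P (d (Inr i)) (d (Inr j))) UNIV" for i j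
    using hs[of "d (Inr i)" "d (Inr j)"] d by (simp add: scl_eq algebra_simps)
  show ?thesis
    unfolding P_def[symmetric] by (rule dblmat_infsumI[OF d LL RL LR RR])
qed

text \<open>The inner product with \<beta> is again a doubled matrix, so the outer product with
  \<alpha> falls under the left-hand case. The form bound supplies convergence at both
  stages.\<close>

lemma dblmat_sandwich:
  assumes d: "bij d" and E: "os_scale E = scaleR" and E': "os_scale E' = scl"
    and z: "form_bound (dblmat d re im z) C"
    and \<alpha>: "\<And>p. sq_summable (cdbl d \<alpha> p)"
    and \<beta>: "\<And>q. sq_summable (\<lambda>l. cdbl d \<beta> l q)"
  shows "sandwich E (cdbl d \<alpha>) (dblmat d re im z) (cdbl d \<beta>) = dblmat d re im (sandwich E' \<alpha> z \<beta>)"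
proof -
  define w where "w = (\<lambda>k j. \<Sum>\<^sub>\<infinity>l. scl (\<beta> l j) (z k l))"
  have w: "(\<Sum>\<^sub>\<infinity>l. cdbl d \<beta> l q *\<^sub>R dblmat d re im z k l) = dblmat d re im w k q" for k q
    using fun_cong[OF fun_cong[OF dblmat_mult_right[OF d row_summable[OF z \<beta>]]]]
    by (simp add: w_def)
  have "(\<lambda>k. cdbl d \<alpha> p k *\<^sub>R dblmat d re im w k q) summable_on UNIV" for p q
    using sandwich_summable[OF z \<alpha> \<beta>, of p q] by (simp add: w)
  from dblmat_mult_left[OF d this] show ?thesis
    by (simp add: sandwich_def E E' w w_def)
qed

lemma dblmat_infsum:
  assumes d: "bij d"
    and summ: "\<And>p q. (\<lambda>s. dblmat d re im (w s) p q) summable_on S"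
  shows "(\<lambda>p q. \<Sum>\<^sub>\<infinity>s\<in>S. dblmat d re im (w s) p q) = dblmat d re im (\<lambda>p q. \<Sum>\<^sub>\<infinity>s\<in>S. w s p q)"
proof -
  define P where "P = (\<lambda>p q. \<Sum>\<^sub>\<infinity>s\<in>S. dblmat d re im (w s) p q)"
  have hs: "((\<lambda>s. dblmat d re im (w s) p q) has_sum P p q) S" for p q
    using summ by (simp add: P_def)
  have LL: "((\<lambda>s. re (w s i j)) has_sum P (d (Inl i)) (d (Inl j))) S" for i j
    using hs[of "d (Inl i)" "d (Inl j)"] d by simp
  have RL: "((\<lambda>s. im (w s i j)) has_sum P (d (Inr i)) (d (Inl j))) S" for i j
    using hs[of "d (Inr i)" "d (Inl j)"] d by simp
  have LR: "((\<lambda>s. - im (w s i j)) has_sum P (d (Inl i)) (d (Inr j))) S" for i j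
    using hs[of "d (Inl i)" "d (Inr j)"] d by simp
  have RR: "((\<lambda>s. re (w s i j)) has_sum P (d (Inr i)) (d (Inr j))) S" for i j
    using hs[of "d (Inr i)" "d (Inr j)"] d by simp
  show ?thesis
    unfolding P_def[symmetric] by (rule dblmat_infsumI[OF d LL RL LR RR])
qed

end

interpretation complex_pair_complex: complex_pair Re Im "\<lambda>(x, y). Complex x y" "(*)"
proof (rule complex_pair.intro)
  show "bounded_linear (\<lambda>(x, y). Complex x y)"
  proof -
    have "bounded_linear (\<lambda>p. complex_of_real (fst p) + \<i> * complex_of_real (snd p))"
      by (intro bounded_linear_add bounded_linear_mult_right[THEN bounded_linear_compose]
          bounded_linear_of_real[THEN bounded_linear_compose] bounded_linear_fst bounded_linear_snd)
    moreover have "(\<lambda>p. complex_of_real (fst p) + \<i> * complex_of_real (snd p)) = (\<lambda>(x, y). Complex x y)"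
      by (auto simp: complex_eq_iff)
    ultimately show ?thesis by simp
  qed
qed (auto simp: complex_eq_iff)

interpretation complex_pair_prod: complex_pair fst snd "\<lambda>p. p"
    "\<lambda>c (x :: 'e::banach, y). (Re c *\<^sub>R x - Im c *\<^sub>R y, Im c *\<^sub>R x + Re c *\<^sub>R y)"
  by (rule complex_pair.intro) (auto simp: bounded_linear_ident add.commute)

section \<open>Adjoints, products and identities of scalar matrices under doubling\<close>

lemma madj_cdbl:
  assumes "bij d"
  shows "madj (cdbl d \<alpha>) = cdbl d (madj \<alpha>)"
  by (rule dbl_ext[OF assms]) (simp_all add: madj_def assms star_real_def star_complex_def)

lemma mmul_cdbl:
  assumes d: "bij d"
    and \<alpha>: "\<And>p. sq_summable (cdbl d \<alpha> p)" and \<beta>: "\<And>q. sq_summable (\<lambda>l. cdbl d \<beta> l q)"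
  shows "mmul (cdbl d \<alpha>) (cdbl d \<beta>) = cdbl d (mmul \<alpha> \<beta>)"
  using complex_pair_complex.dblmat_mult_right[OF d, of \<beta> \<alpha>] sq_summable_mult[OF \<beta> \<alpha>]
  by (simp add: mmul_def mult.commute)

lemma cdbl_mone:
  assumes "bij d"
  shows "cdbl d (mone I) = mone (d ` (I <+> I))"
proof -
  have "inj d" using assms by (rule bij_is_inj)
  then have "d (Inl i) \<in> d ` (I <+> I) \<longleftrightarrow> i \<in> I" "d (Inr i) \<in> d ` (I <+> I) \<longleftrightarrow> i \<in> I"
    "d x = d y \<longleftrightarrow> x = y" for i x y
    by (auto simp: inj_image_mem_iff inj_eq)
  then show ?thesis
    by (intro dbl_ext[OF assms]) (auto simp: assms mone_def)
qed


section \<open>Operator bounds of scalar matrices\<close>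

lemma star_zero [simp]: "star (0::'f::star_field) = 0"
  using star_add[of "0::'f" 0] by simp

lemma star_real [simp]: "star (x::real) = x"
  by (simp add: star_real_def)

lemma star_complex [simp]: "star (z::complex) = cnj z"
  by (simp add: star_complex_def)

lemma op_boundD:
  assumes "op_bound I J \<alpha> C" "finite F" "F \<subseteq> I" "finite G" "G \<subseteq> J"
  shows "norm (\<Sum>i\<in>F. \<Sum>j\<in>G. star (\<eta> i) * \<alpha> i j * \<xi> j)
          \<le> C * sqrt (\<Sum>i\<in>F. (norm (\<eta> i))\<^sup>2) * sqrt (\<Sum>j\<in>G. (norm (\<xi> j))\<^sup>2)"
  using assms by (auto simp: op_bound_def)

lemma op_bound_nonneg: "op_bound I J \<alpha> C \<Longrightarrow> 0 \<le> C"
  by (simp add: op_bound_def)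

lemma op_bound_mono:
  fixes \<alpha> :: "('a, 'b, 'f::star_field) mat"
  assumes "op_bound I J \<alpha> C" "C \<le> C'" "I' \<subseteq> I" "J' \<subseteq> J"
  shows "op_bound I' J' \<alpha> C'"
  unfolding op_bound_def
proof (intro conjI allI impI)
  show "0 \<le> C'" using op_bound_nonneg[OF assms(1)] assms(2) by simp
  fix F :: "'a set" and G :: "'b set" and \<eta> :: "'a \<Rightarrow> 'f" and \<xi> :: "'b \<Rightarrow> 'f"
  assume FG: "finite F \<and> F \<subseteq> I' \<and> finite G \<and> G \<subseteq> J'"
  have "norm (\<Sum>i\<in>F. \<Sum>j\<in>G. star (\<eta> i) * \<alpha> i j * \<xi> j)
      \<le> C * sqrt (\<Sum>i\<in>F. (norm (\<eta> i))\<^sup>2) * sqrt (\<Sum>j\<in>G. (norm (\<xi> j))\<^sup>2)"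
    using FG assms by (intro op_boundD) auto
  also have "\<dots> \<le> C' * sqrt (\<Sum>i\<in>F. (norm (\<eta> i))\<^sup>2) * sqrt (\<Sum>j\<in>G. (norm (\<xi> j))\<^sup>2)"
    by (intro mult_right_mono assms(2)) (auto simp: sum_nonneg)
  finally show "norm (\<Sum>i\<in>F. \<Sum>j\<in>G. star (\<eta> i) * \<alpha> i j * \<xi> j)
      \<le> C' * sqrt (\<Sum>i\<in>F. (norm (\<eta> i))\<^sup>2) * sqrt (\<Sum>j\<in>G. (norm (\<xi> j))\<^sup>2)" .
qed

lemma op_bound_reindex:
  fixes e :: "'a \<Rightarrow> 'c" and e' :: "'b \<Rightarrow> 'd" and \<alpha> :: "('c, 'd, 'f::star_field) mat"
  assumes e: "inj_on e A" and e': "inj_on e' B"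
  shows "op_bound (e ` A) (e' ` B) \<alpha> C \<longleftrightarrow> op_bound A B (\<lambda>i j. \<alpha> (e i) (e' j)) C"
proof
  assume L: "op_bound (e ` A) (e' ` B) \<alpha> C"
  show "op_bound A B (\<lambda>i j. \<alpha> (e i) (e' j)) C"
    unfolding op_bound_def
  proof (intro conjI allI impI op_bound_nonneg[OF L])
    fix F :: "'a set" and G :: "'b set" and \<eta> :: "'a \<Rightarrow> 'f" and \<xi> :: "'b \<Rightarrow> 'f"
    assume FG: "finite F \<and> F \<subseteq> A \<and> finite G \<and> G \<subseteq> B"
    then have inj: "inj_on e F" "inj_on e' G" using e e' by (auto intro: inj_on_subset)
    have inv: "the_inv_into A e (e i) = i" if "i \<in> F" for i
      using that FG by (auto intro: the_inv_into_f_f[OF e])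
    have inv': "the_inv_into B e' (e' i) = i" if "i \<in> G" for i
      using that FG by (auto intro: the_inv_into_f_f[OF e'])
    show "norm (\<Sum>i\<in>F. \<Sum>j\<in>G. star (\<eta> i) * \<alpha> (e i) (e' j) * \<xi> j)
        \<le> C * sqrt (\<Sum>i\<in>F. (norm (\<eta> i))\<^sup>2) * sqrt (\<Sum>j\<in>G. (norm (\<xi> j))\<^sup>2)"
      using op_boundD[OF L, of "e ` F" "e' ` G" "\<eta> \<circ> the_inv_into A e" "\<xi> \<circ> the_inv_into B e'"] FG
      by (simp add: sum.reindex inj inv inv' image_mono cong: sum.cong)
  qed
next
  assume R: "op_bound A B (\<lambda>i j. \<alpha> (e i) (e' j)) C"
  show "op_bound (e ` A) (e' ` B) \<alpha> C"
    unfolding op_bound_def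
  proof (intro conjI allI impI op_bound_nonneg[OF R])
    fix F :: "'c set" and G :: "'d set" and \<eta> :: "'c \<Rightarrow> 'f" and \<xi> :: "'d \<Rightarrow> 'f"
    assume FG: "finite F \<and> F \<subseteq> e ` A \<and> finite G \<and> G \<subseteq> e' ` B"
    then obtain F0 G0 where FG0: "F = e ` F0" "F0 \<subseteq> A" "finite F0" "G = e' ` G0" "G0 \<subseteq> B" "finite G0"
      by (metis finite_subset_image)
    then have inj: "inj_on e F0" "inj_on e' G0" using e e' by (auto intro: inj_on_subset)
    show "norm (\<Sum>i\<in>F. \<Sum>j\<in>G. star (\<eta> i) * \<alpha> i j * \<xi> j)
        \<le> C * sqrt (\<Sum>i\<in>F. (norm (\<eta> i))\<^sup>2) * sqrt (\<Sum>j\<in>G. (norm (\<xi> j))\<^sup>2)"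
      using op_boundD[OF R, of F0 G0 "\<eta> \<circ> e" "\<xi> \<circ> e'"] FG0 by (simp add: sum.reindex inj)
  qed
qed

lemma op_norm_le: "op_bound I J \<alpha> C \<Longrightarrow> op_norm I J \<alpha> \<le> C"
  unfolding op_norm_def by (rule cInf_lower) (auto simp: op_bound_def intro: bdd_belowI[of _ 0])

text \<open>The infimum in \<open>op_norm\<close> is attained, since each defining inequality is
  preserved under infima of admissible constants. Some finite bound must exist for the infimum to be
  over a nonempty set.\<close>

lemma op_bound_op_norm:
  fixes \<alpha> :: "('a, 'b, 'f::star_field) mat"
  assumes "op_bound I J \<alpha> C"
  shows "op_bound I J \<alpha> (op_norm I J \<alpha>)"
  unfolding op_bound_def
proof (intro conjI allI impI)
  have ne: "{C. op_bound I J \<alpha> C} \<noteq> {}" using assms by blast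
  show "0 \<le> op_norm I J \<alpha>"
    unfolding op_norm_def using ne by (rule cInf_greatest) (simp add: op_bound_nonneg)
  fix F :: "'a set" and G :: "'b set" and \<eta> :: "'a \<Rightarrow> 'f" and \<xi> :: "'b \<Rightarrow> 'f"
  assume FG: "finite F \<and> F \<subseteq> I \<and> finite G \<and> G \<subseteq> J"
  define v where "v = sqrt (\<Sum>i\<in>F. (norm (\<eta> i))\<^sup>2) * sqrt (\<Sum>j\<in>G. (norm (\<xi> j))\<^sup>2)"
  define t where "t = norm (\<Sum>i\<in>F. \<Sum>j\<in>G. star (\<eta> i) * \<alpha> i j * \<xi> j)"
  have v: "0 \<le> v" by (simp add: v_def sum_nonneg)
  have tv: "t \<le> D * v" if "op_bound I J \<alpha> D" for D
    using op_boundD[OF that, of F G \<eta> \<xi>] FG by (simp add: t_def v_def mult.assoc)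
  have "t \<le> op_norm I J \<alpha> * v"
  \<comment> \<open>Division by \<open>v\<close> is impossible here; the given bound already forces
    \<open>t\<close> to vanish.\<close>
  proof (cases "v = 0")
    case True then show ?thesis using tv[OF assms] by simp
  next
    case False
    then have "v > 0" using v by simp
    have "t / v \<le> op_norm I J \<alpha>"
      unfolding op_norm_def
    proof (rule cInf_greatest[OF ne])
      fix D assume "D \<in> {C. op_bound I J \<alpha> C}"
      then show "t / v \<le> D" using tv \<open>v > 0\<close> by (simp add: pos_divide_le_eq)
    qed
    then show ?thesis using \<open>v > 0\<close> by (simp add: pos_divide_le_eq)
  qed
  then show "norm (\<Sum>i\<in>F. \<Sum>j\<in>G. star (\<eta> i) * \<alpha> i j * \<xi> j) \<le>
      op_norm I J \<alpha> * sqrt (\<Sum>i\<in>F. (norm (\<eta> i))\<^sup>2) * sqrt (\<Sum>j\<in>G. (norm (\<xi> j))\<^sup>2)"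
    by (simp add: t_def v_def mult.assoc)
qed

lemma norm_star [simp]: "norm (star (x::'f::star_field)) = norm x"
proof (cases "x = 0")
  case False
  have "norm (x * star x) = (norm x)\<^sup>2" by (simp add: mult_star)
  then show ?thesis using False by (simp add: norm_mult power2_eq_square)
qed simp

lemma norm_le_sqrt_sum:
  assumes "finite F" "i \<in> F"
  shows "norm (\<eta> i) \<le> sqrt (\<Sum>i\<in>F. (norm (\<eta> i))\<^sup>2)"
proof (rule real_le_rsqrt)
  show "(norm (\<eta> i))\<^sup>2 \<le> (\<Sum>i\<in>F. (norm (\<eta> i))\<^sup>2)"
    using assms by (intro member_le_sum[of i F "\<lambda>i. (norm (\<eta> i))\<^sup>2"]) auto
qed

text \<open>A crude constant is enough: it only shows that \<open>op_norm\<close> of a finite matrix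
  is an infimum over a nonempty set, hence itself a bound.\<close>

lemma op_bound_finite:
  fixes \<alpha> :: "('a, 'b, 'f::star_field) mat"
  assumes "finite I" "finite J"
  shows "op_bound I J \<alpha> (\<Sum>i\<in>I. \<Sum>j\<in>J. norm (\<alpha> i j))"
  unfolding op_bound_def
proof (intro conjI allI impI)
  fix F :: "'a set" and G :: "'b set" and \<eta> :: "'a \<Rightarrow> 'f" and \<xi> :: "'b \<Rightarrow> 'f"
  assume FG: "finite F \<and> F \<subseteq> I \<and> finite G \<and> G \<subseteq> J"
  define a b where "a = sqrt (\<Sum>i\<in>F. (norm (\<eta> i))\<^sup>2)" "b = sqrt (\<Sum>j\<in>G. (norm (\<xi> j))\<^sup>2)"
  have ab: "0 \<le> a" "0 \<le> b" by (simp_all add: a_b_def sum_nonneg)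
  have "norm (\<Sum>i\<in>F. \<Sum>j\<in>G. star (\<eta> i) * \<alpha> i j * \<xi> j) \<le> (\<Sum>i\<in>F. \<Sum>j\<in>G. norm (\<eta> i) * norm (\<alpha> i j) * norm (\<xi> j))"
    by (rule sum_norm_le)+ (simp add: norm_mult)
  also have "\<dots> \<le> (\<Sum>i\<in>F. \<Sum>j\<in>G. a * norm (\<alpha> i j) * b)"
    using FG ab by (intro sum_mono mult_mono mult_right_mono) (auto simp: a_b_def norm_le_sqrt_sum sum_nonneg)
  also have "\<dots> = (\<Sum>i\<in>F. \<Sum>j\<in>G. norm (\<alpha> i j)) * (a * b)"
    by (simp add: sum_distrib_right sum_distrib_left mult_ac)
  also have "\<dots> \<le> (\<Sum>i\<in>I. \<Sum>j\<in>J. norm (\<alpha> i j)) * (a * b)"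
  proof (intro mult_right_mono)
    have "(\<Sum>i\<in>F. \<Sum>j\<in>G. norm (\<alpha> i j)) \<le> (\<Sum>i\<in>F. \<Sum>j\<in>J. norm (\<alpha> i j))"
      using FG assms by (intro sum_mono sum_mono2) auto
    also have "\<dots> \<le> (\<Sum>i\<in>I. \<Sum>j\<in>J. norm (\<alpha> i j))"
      using FG assms by (intro sum_mono2) (auto simp: sum_nonneg)
    finally show "(\<Sum>i\<in>F. \<Sum>j\<in>G. norm (\<alpha> i j)) \<le> (\<Sum>i\<in>I. \<Sum>j\<in>J. norm (\<alpha> i j))" .
  qed (use ab in simp)
  finally show "norm (\<Sum>i\<in>F. \<Sum>j\<in>G. star (\<eta> i) * \<alpha> i j * \<xi> j) \<le>
     (\<Sum>i\<in>I. \<Sum>j\<in>J. norm (\<alpha> i j)) * sqrt (\<Sum>i\<in>F. (norm (\<eta> i))\<^sup>2) * sqrt (\<Sum>j\<in>G. (norm (\<xi> j))\<^sup>2)"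
    by (simp add: a_b_def mult.assoc)
qed (simp add: sum_nonneg)

definition supported :: "'a set \<Rightarrow> 'b set \<Rightarrow> ('a, 'b, 'e::zero) mat \<Rightarrow> bool" where
  "supported I J x \<longleftrightarrow> (\<forall>i j. i \<notin> I \<or> j \<notin> J \<longrightarrow> x i j = 0)"

lemma mats_supported: "x \<in> mats E I \<Longrightarrow> supported I I x"
  by (simp add: mats_def supported_def)

lemma sub_norm_le_bound:
  assumes x: "supported I I x"
    and le: "\<And>n e. inj_on e {..<n} \<Longrightarrow> e ` {..<n} \<subseteq> I \<Longrightarrow> os_norm E' n (\<lambda>i j. x (e i) (e j)) \<le> C"
  shows "x \<in> mats E' I \<and> mats_norm E' I x \<le> C"
proof
  have le': "t \<le> C" if "t \<in> sub_norms E' I x" for t using that le by (auto simp: sub_norms_def)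
  then show "x \<in> mats E' I" using x bdd_aboveI[OF le'] by (auto simp: mats_def supported_def)
  show "mats_norm E' I x \<le> C"
    unfolding mats_norm_def
  proof (rule cSup_least[OF _ le'])
    \<comment> \<open>The empty submatrix keeps the supremum over a nonempty set, even if
      \<open>I\<close> is empty.\<close>
    have "os_norm E' 0 (\<lambda>i j. x (undefined i) (undefined j)) \<in> sub_norms E' I x"
      unfolding sub_norms_def by (intro CollectI exI[of _ 0] exI[of _ undefined]) auto
    then show "sub_norms E' I x \<noteq> {}" by blast
  qed
qed

lemma mats_norm_scalars_le:
  fixes \<delta> :: "('a, 'a, 'f::star_field) mat"
  assumes \<delta>: "supported I I \<delta>" and bound: "op_bound I I \<delta> C"
  shows "\<delta> \<in> mats scalars I \<and> mats_norm scalars I \<delta> \<le> C"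
proof (rule sub_norm_le_bound[OF \<delta>])
  fix n :: nat and e :: "nat \<Rightarrow> 'a" assume e: "inj_on e {..<n}" "e ` {..<n} \<subseteq> I"
  have "op_bound (e ` {..<n}) (e ` {..<n}) \<delta> C"
    using bound e by (auto intro: op_bound_mono)
  then show "os_norm scalars n (\<lambda>i j. \<delta> (e i) (e j)) \<le> C"
    unfolding op_bound_reindex[OF e(1) e(1)] by (simp add: scalars_def op_norm_le)
qed

text \<open>With the preceding lemma, \<open>mats_norm scalars\<close> is the operator norm. Since
  \<open>sub_norms\<close> contains only submatrices with equal rows and columns, a form on
  \<open>F\<close> and \<open>G\<close> is tested inside the submatrix on their union.\<close>

lemma op_bound_mats_norm:
  fixes \<delta> :: "('a, 'a, 'f::star_field) mat"
  assumes bdd: "bdd_above (sub_norms scalars I \<delta>)"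
  shows "op_bound I I \<delta> (mats_norm scalars I \<delta>)"
proof -
  have sub: "op_bound H H \<delta> (mats_norm scalars I \<delta>)" if H: "finite H" "H \<subseteq> I" for H
  proof -
    obtain e where e: "bij_betw e {0..<card H} H"
      using ex_bij_betw_nat_finite[OF H(1)] by blast
    let ?n = "card H"
    have inj: "inj_on e {..<?n}" and im: "e ` {..<?n} = H"
      using e by (auto simp: bij_betw_def atLeast0LessThan)
    have "op_bound {..<?n} {..<?n} (\<lambda>i j. \<delta> (e i) (e j)) (op_norm {..<?n} {..<?n} (\<lambda>i j. \<delta> (e i) (e j)))"
      by (rule op_bound_op_norm[OF op_bound_finite]) auto
    then have "op_bound H H \<delta> (op_norm {..<?n} {..<?n} (\<lambda>i j. \<delta> (e i) (e j)))"
      by (simp only: op_bound_reindex[OF inj inj, unfolded im])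
    moreover have "op_norm {..<?n} {..<?n} (\<lambda>i j. \<delta> (e i) (e j)) \<le> mats_norm scalars I \<delta>"
      unfolding mats_norm_def
    proof (rule cSup_upper[OF _ bdd])
      show "op_norm {..<?n} {..<?n} (\<lambda>i j. \<delta> (e i) (e j)) \<in> sub_norms scalars I \<delta>"
        unfolding sub_norms_def scalars_def using inj im H by fastforce
    qed
    ultimately show ?thesis by (auto intro: op_bound_mono)
  qed
  show ?thesis unfolding op_bound_def
  proof (intro conjI allI impI)
    show "0 \<le> mats_norm scalars I \<delta>" using sub[of "{}"] by (simp add: op_bound_nonneg)
    fix F G :: "'a set" and \<eta> \<xi> :: "'a \<Rightarrow> 'f"
    assume FG: "finite F \<and> F \<subseteq> I \<and> finite G \<and> G \<subseteq> I"
    show "norm (\<Sum>i\<in>F. \<Sum>j\<in>G. star (\<eta> i) * \<delta> i j * \<xi> j) \<le>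
      mats_norm scalars I \<delta> * sqrt (\<Sum>i\<in>F. (norm (\<eta> i))\<^sup>2) * sqrt (\<Sum>j\<in>G. (norm (\<xi> j))\<^sup>2)"
      using FG by (intro op_boundD[OF sub[of "F \<union> G"]]) auto
  qed
qed

text \<open>Support and bound are separated once and for all, so that index sets need not be carried
  through the doubling estimates.\<close>

lemma op_bound_UNIV:
  fixes \<alpha> :: "('a, 'b, 'f::star_field) mat"
  assumes s: "supported I J \<alpha>" and b: "op_bound I J \<alpha> C"
  shows "op_bound UNIV UNIV \<alpha> C"
  unfolding op_bound_def
proof (intro conjI allI impI op_bound_nonneg[OF b])
  fix F :: "'a set" and G :: "'b set" and \<eta> :: "'a \<Rightarrow> 'f" and \<xi> :: "'b \<Rightarrow> 'f"
  assume FG: "finite F \<and> F \<subseteq> UNIV \<and> finite G \<and> G \<subseteq> UNIV"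
  have "(\<Sum>i\<in>F. \<Sum>j\<in>G. star (\<eta> i) * \<alpha> i j * \<xi> j) = (\<Sum>i\<in>F\<inter>I. \<Sum>j\<in>G. star (\<eta> i) * \<alpha> i j * \<xi> j)"
    using FG s by (intro sum.mono_neutral_right) (auto simp: supported_def)
  also have "\<dots> = (\<Sum>i\<in>F\<inter>I. \<Sum>j\<in>G\<inter>J. star (\<eta> i) * \<alpha> i j * \<xi> j)"
    using FG s by (intro sum.cong sum.mono_neutral_right) (auto simp: supported_def)
  finally have "norm (\<Sum>i\<in>F. \<Sum>j\<in>G. star (\<eta> i) * \<alpha> i j * \<xi> j)
      \<le> C * sqrt (\<Sum>i\<in>F\<inter>I. (norm (\<eta> i))\<^sup>2) * sqrt (\<Sum>j\<in>G\<inter>J. (norm (\<xi> j))\<^sup>2)"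
    using op_boundD[OF b, of "F \<inter> I" "G \<inter> J" \<eta> \<xi>] FG by simp
  also have "\<dots> \<le> C * sqrt (\<Sum>i\<in>F. (norm (\<eta> i))\<^sup>2) * sqrt (\<Sum>j\<in>G. (norm (\<xi> j))\<^sup>2)"
    using FG op_bound_nonneg[OF b]
    by (intro mult_mono mult_left_mono real_sqrt_le_mono sum_mono2) (auto simp: sum_nonneg)
  finally show "norm (\<Sum>i\<in>F. \<Sum>j\<in>G. star (\<eta> i) * \<alpha> i j * \<xi> j)
      \<le> C * sqrt (\<Sum>i\<in>F. (norm (\<eta> i))\<^sup>2) * sqrt (\<Sum>j\<in>G. (norm (\<xi> j))\<^sup>2)" .
qed

lemma bdd_mats_iff:
  "\<alpha> \<in> bdd_mats I J \<longleftrightarrow> supported I J \<alpha> \<and> (\<exists>C. op_bound UNIV UNIV \<alpha> C)"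
  unfolding bdd_mats_def using op_bound_UNIV[of I J \<alpha>]
  by (auto simp: supported_def intro: op_bound_mono)

lemma mats_scalars_iff:
  "\<delta> \<in> mats scalars I \<longleftrightarrow> supported I I \<delta> \<and> (\<exists>C. op_bound UNIV UNIV \<delta> C)"
proof
  assume "\<delta> \<in> mats scalars I"
  then show "supported I I \<delta> \<and> (\<exists>C. op_bound UNIV UNIV \<delta> C)"
    using op_bound_UNIV[OF mats_supported op_bound_mats_norm] by (auto simp: mats_supported mats_def)
next
  assume "supported I I \<delta> \<and> (\<exists>C. op_bound UNIV UNIV \<delta> C)"
  then obtain C where C: "supported I I \<delta>" "op_bound UNIV UNIV \<delta> C" by blast
  have "op_bound I I \<delta> C" by (rule op_bound_mono[OF C(2)]) auto
  from mats_norm_scalars_le[OF C(1) this] show "\<delta> \<in> mats scalars I" ..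
qed

lemma mats_norm_scalars_le_UNIV:
  assumes "supported I I \<delta>" "op_bound UNIV UNIV \<delta> C"
  shows "mats_norm scalars I \<delta> \<le> C"
  using mats_norm_scalars_le[OF assms(1) op_bound_mono[OF assms(2)]] by simp

lemma op_bound_UNIV_mats_norm:
  "\<delta> \<in> mats scalars I \<Longrightarrow> op_bound UNIV UNIV \<delta> (mats_norm scalars I \<delta>)"
  by (rule op_bound_UNIV[OF mats_supported op_bound_mats_norm]) (auto simp: mats_def)

lemma form_bound_op_bound:
  fixes \<alpha> :: "('a, 'b, real) mat"
  assumes "op_bound UNIV UNIV \<alpha> C"
  shows "form_bound \<alpha> C"
  unfolding form_bound_def
proof (intro conjI allI impI op_bound_nonneg[OF assms])
  fix F G and a b :: "_ \<Rightarrow> real"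
  assume "finite (F :: 'a set) \<and> finite (G :: 'b set)"
  then show "norm (\<Sum>k\<in>F. \<Sum>l\<in>G. (a k * b l) *\<^sub>R \<alpha> k l)
       \<le> C * sqrt (\<Sum>k\<in>F. (a k)\<^sup>2) * sqrt (\<Sum>l\<in>G. (b l)\<^sup>2)"
    using op_boundD[OF assms, of F G a b] by (simp add: mult_ac)
qed

text \<open>With \<open>t\<close> the norm of the truncated vector, the assumption reads
  \<open>t\<^sup>2 \<le> C * t\<close>, so \<open>t \<le> C\<close> uniformly in the
  truncation.\<close>

lemma sq_summable_le:
  assumes C: "0 \<le> C" and b: "\<And>F. finite F \<Longrightarrow> (\<Sum>k\<in>F. (a k)\<^sup>2) \<le> C * sqrt (\<Sum>k\<in>F. (a k)\<^sup>2)"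
  shows "sq_summable a"
  unfolding sq_summable_def
proof (rule nonneg_bdd_above_summable_on)
  have "(\<Sum>k\<in>F. (a k)\<^sup>2) \<le> C\<^sup>2" if "finite F" for F
  proof -
    define t where "t = sqrt (\<Sum>k\<in>F. (a k)\<^sup>2)"
    have t: "t\<^sup>2 = (\<Sum>k\<in>F. (a k)\<^sup>2)" "0 \<le> t" by (simp_all add: t_def sum_nonneg)
    have "t * t \<le> C * t" using b[OF that] t by (simp add: t_def power2_eq_square)
    then have "t \<le> C" using t(2) C by (cases "t = 0") (auto simp: mult_le_cancel_right)
    then have "t\<^sup>2 \<le> C\<^sup>2" using t(2) by (rule power_mono)
    then show ?thesis using t by simp
  qed
  then show "bdd_above (sum (\<lambda>k. (a k)\<^sup>2) ` {F. F \<subseteq> UNIV \<and> finite F})"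
    by (intro bdd_aboveI2[of _ _ "C\<^sup>2"]) auto
qed simp

text \<open>Testing the operator bound on one basis vector and on the truncated row or column itself
  gives exactly the inequality required by \<open>sq_summable_le\<close>.\<close>

lemma op_bound_sq_summable:
  fixes \<alpha> :: "('a, 'b, real) mat"
  assumes "op_bound UNIV UNIV \<alpha> C"
  shows "sq_summable (\<alpha> p)" "sq_summable (\<lambda>l. \<alpha> l q)"
proof -
  show "sq_summable (\<alpha> p)"
  proof (rule sq_summable_le[OF op_bound_nonneg[OF assms]])
    fix F :: "'b set" assume "finite F"
    then show "(\<Sum>k\<in>F. (\<alpha> p k)\<^sup>2) \<le> C * sqrt (\<Sum>k\<in>F. (\<alpha> p k)\<^sup>2)"
      using op_boundD[OF assms, of "{p}" F "\<lambda>_. 1" "\<alpha> p"] by (simp add: power2_eq_square sum_nonneg)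
  qed
  show "sq_summable (\<lambda>l. \<alpha> l q)"
  proof (rule sq_summable_le[OF op_bound_nonneg[OF assms]])
    fix F :: "'a set" assume "finite F"
    then show "(\<Sum>k\<in>F. (\<alpha> k q)\<^sup>2) \<le> C * sqrt (\<Sum>k\<in>F. (\<alpha> k q)\<^sup>2)"
      using op_boundD[OF assms, of F "{q}" "\<lambda>k. \<alpha> k q" "\<lambda>_. 1"] by (simp add: power2_eq_square sum_nonneg)
  qed
qed


section \<open>Quadratic forms of doubled and of real matrices\<close>

lemma sum_dbl:
  assumes "bij d" "finite F"
  shows "sum h (d ` (F <+> F)) = (\<Sum>i\<in>F. h (d (Inl i)) + h (d (Inr i)))"
proof -
  have "sum h (d ` (F <+> F)) = sum (h \<circ> d) (F <+> F)"
    by (rule sum.reindex) (use bij_is_inj[OF assms(1)] in \<open>auto simp: inj_on_def inj_def\<close>)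
  also have "\<dots> = (\<Sum>i\<in>F. h (d (Inl i))) + (\<Sum>i\<in>F. h (d (Inr i)))"
    using assms(2) by (simp add: sum.Plus)
  finally show ?thesis by (simp add: sum.distrib)
qed

text \<open>Real forms of a doubled matrix become complex forms only over sets that contain both
  copies of each index; every finite set is enlarged to such a set.\<close>

lemma finite_dbl_cover:
  assumes d: "bij d" and P: "finite P"
  obtains F where "finite F" "P \<subseteq> d ` (F <+> F)"
proof
  have "inj (d \<circ> Inl)" "inj (d \<circ> Inr)"
    using bij_is_inj[OF d] by (auto simp: inj_def)
  then show "finite ((d \<circ> Inl) -` P \<union> (d \<circ> Inr) -` P)"
    using P by (simp add: finite_vimageI)
  show "P \<subseteq> d ` (((d \<circ> Inl) -` P \<union> (d \<circ> Inr) -` P) <+> ((d \<circ> Inl) -` P \<union> (d \<circ> Inr) -` P))"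
  proof
    fix p assume "p \<in> P"
    then show "p \<in> d ` (((d \<circ> Inl) -` P \<union> (d \<circ> Inr) -` P) <+> ((d \<circ> Inl) -` P \<union> (d \<circ> Inr) -` P))"
      by (cases p rule: dbl_cases[OF d]) auto
  qed
qed

text \<open>A real vector over the doubled indices read as a complex vector: \<open>Inl\<close>
  holds real parts, \<open>Inr\<close> imaginary parts. This identification preserves the
  norm.\<close>

definition cvec :: "('a + 'a \<Rightarrow> 'a) \<Rightarrow> ('a \<Rightarrow> real) \<Rightarrow> 'a \<Rightarrow> complex" where
  "cvec d \<eta> = (\<lambda>i. Complex (\<eta> (d (Inl i))) (\<eta> (d (Inr i))))"

definition rvec :: "('a + 'a \<Rightarrow> 'a) \<Rightarrow> ('a \<Rightarrow> complex) \<Rightarrow> 'a \<Rightarrow> real" where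
  "rvec d \<eta> = (\<lambda>p. case inv d p of Inl i \<Rightarrow> Re (\<eta> i) | Inr i \<Rightarrow> Im (\<eta> i))"

lemma cvec_rvec: "bij d \<Longrightarrow> cvec d (rvec d \<eta>) = \<eta>"
  by (auto simp: cvec_def rvec_def bij_is_inj)

lemma sum_norm_cvec:
  assumes "bij d" "finite F"
  shows "(\<Sum>i\<in>F. (norm (cvec d \<eta> i))\<^sup>2) = (\<Sum>p\<in>d ` (F <+> F). (\<eta> p)\<^sup>2)"
  by (simp add: sum_dbl assms cvec_def cmod_power2)

text \<open>c(\<alpha>) is \<alpha> regarded as a real linear map, and the real inner product is the
  real part of the complex one.\<close>

lemma cdbl_form:
  assumes d: "bij d" and F: "finite F" and G: "finite G"
  shows "(\<Sum>p\<in>d ` (F <+> F). \<Sum>q\<in>d ` (G <+> G). \<eta> p * cdbl d \<alpha> p q * \<xi> q) =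
    Re (\<Sum>i\<in>F. \<Sum>j\<in>G. cnj (cvec d \<eta> i) * \<alpha> i j * cvec d \<xi> j)"
proof -
  have "(\<Sum>p\<in>d ` (F <+> F). \<Sum>q\<in>d ` (G <+> G). \<eta> p * cdbl d \<alpha> p q * \<xi> q) =
      (\<Sum>i\<in>F. \<Sum>j\<in>G. Re (cnj (cvec d \<eta> i) * \<alpha> i j * cvec d \<xi> j))"
    unfolding sum_dbl[OF d F] sum_dbl[OF d G] sum.distrib[symmetric]
    by (intro sum.cong refl) (simp add: d cvec_def algebra_simps)
  then show ?thesis by simp
qed

text \<open>The bound survives unchanged because the real part of a number is at most its
  modulus.\<close>

lemma op_bound_cdbl:
  assumes d: "bij d" and b: "op_bound UNIV UNIV \<alpha> C"
  shows "op_bound UNIV UNIV (cdbl d \<alpha>) C"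
  unfolding op_bound_def
proof (intro conjI allI impI op_bound_nonneg[OF b])
  fix P Q :: "'a set" and \<eta> \<xi> :: "'a \<Rightarrow> real"
  assume PQ: "finite P \<and> P \<subseteq> UNIV \<and> finite Q \<and> Q \<subseteq> (UNIV :: 'a set)"
  obtain F where F: "finite F" "P \<subseteq> d ` (F <+> F)" using finite_dbl_cover[OF d] PQ by blast
  obtain G where G: "finite G" "Q \<subseteq> d ` (G <+> G)" using finite_dbl_cover[OF d] PQ by blast
  have fin: "finite (d ` (F <+> F))" "finite (d ` (G <+> G))" using F G by auto
  \<comment> \<open>Extension by zero to the symmetric set changes neither the form nor the
    norm.\<close>
  define \<eta>' where "\<eta>' = (\<lambda>p. if p \<in> P then \<eta> p else 0)"
  define \<xi>' where "\<xi>' = (\<lambda>p. if p \<in> Q then \<xi> p else 0)"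
  have "(\<Sum>p\<in>P. \<Sum>q\<in>Q. \<eta> p * cdbl d \<alpha> p q * \<xi> q) =
      (\<Sum>p\<in>P. \<Sum>q\<in>d ` (G <+> G). \<eta>' p * cdbl d \<alpha> p q * \<xi>' q)"
    using G fin by (intro sum.cong sum.mono_neutral_cong_left) (auto simp: \<eta>'_def \<xi>'_def)
  also have "\<dots> = (\<Sum>p\<in>d ` (F <+> F). \<Sum>q\<in>d ` (G <+> G). \<eta>' p * cdbl d \<alpha> p q * \<xi>' q)"
    using F fin by (intro sum.mono_neutral_left) (auto simp: \<eta>'_def)
  also have "\<dots> = Re (\<Sum>i\<in>F. \<Sum>j\<in>G. cnj (cvec d \<eta>' i) * \<alpha> i j * cvec d \<xi>' j)"
    by (rule cdbl_form[OF d F(1) G(1)])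
  finally have eq: "(\<Sum>p\<in>P. \<Sum>q\<in>Q. \<eta> p * cdbl d \<alpha> p q * \<xi> q) =
      Re (\<Sum>i\<in>F. \<Sum>j\<in>G. cnj (cvec d \<eta>' i) * \<alpha> i j * cvec d \<xi>' j)" .
  have "\<bar>\<Sum>p\<in>P. \<Sum>q\<in>Q. \<eta> p * cdbl d \<alpha> p q * \<xi> q\<bar> \<le>
      cmod (\<Sum>i\<in>F. \<Sum>j\<in>G. cnj (cvec d \<eta>' i) * \<alpha> i j * cvec d \<xi>' j)"
    unfolding eq by (rule abs_Re_le_cmod)
  also have "\<dots> \<le> C * sqrt (\<Sum>i\<in>F. (norm (cvec d \<eta>' i))\<^sup>2) * sqrt (\<Sum>j\<in>G. (norm (cvec d \<xi>' j))\<^sup>2)"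
    using op_boundD[OF b F(1) _ G(1)] by simp
  also have "(\<Sum>i\<in>F. (norm (cvec d \<eta>' i))\<^sup>2) = (\<Sum>p\<in>P. (\<eta> p)\<^sup>2)"
    unfolding sum_norm_cvec[OF d F(1)] using F fin
    by (intro sum.mono_neutral_cong_right) (auto simp: \<eta>'_def)
  also have "(\<Sum>i\<in>G. (norm (cvec d \<xi>' i))\<^sup>2) = (\<Sum>p\<in>Q. (\<xi> p)\<^sup>2)"
    unfolding sum_norm_cvec[OF d G(1)] using G fin
    by (intro sum.mono_neutral_cong_right) (auto simp: \<xi>'_def)
  finally show "norm (\<Sum>p\<in>P. \<Sum>q\<in>Q. star (\<eta> p) * cdbl d \<alpha> p q * \<xi> q) \<le>
      C * sqrt (\<Sum>p\<in>P. (norm (\<eta> p))\<^sup>2) * sqrt (\<Sum>q\<in>Q. (norm (\<xi> q))\<^sup>2)" by simp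
qed

text \<open>The doubled form sees only real parts, and the imaginary part is recovered by rotating
  the vector. Adding both estimates costs the factor 2, which is harmless where only boundedness is
  asked.\<close>

lemma op_bound_of_cdbl:
  assumes d: "bij d" and b: "op_bound UNIV UNIV (cdbl d \<alpha>) C"
  shows "op_bound UNIV UNIV \<alpha> (2 * C)"
  unfolding op_bound_def
proof (intro conjI allI impI)
  show "0 \<le> 2 * C" using op_bound_nonneg[OF b] by simp
  fix F G :: "'a set" and \<eta> \<xi> :: "'a \<Rightarrow> complex"
  assume FG: "finite F \<and> F \<subseteq> UNIV \<and> finite G \<and> G \<subseteq> (UNIV :: 'a set)"
  then have F: "finite F" and G: "finite G" by auto
  define S where "S = (\<lambda>\<eta>. \<Sum>i\<in>F. \<Sum>j\<in>G. cnj (\<eta> i) * \<alpha> i j * \<xi> j)"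
  have re: "\<bar>Re (S \<eta>)\<bar> \<le> C * sqrt (\<Sum>i\<in>F. (norm (\<eta> i))\<^sup>2) * sqrt (\<Sum>j\<in>G. (norm (\<xi> j))\<^sup>2)" for \<eta>
  proof -
    have eq: "Re (S \<eta>) = (\<Sum>p\<in>d ` (F <+> F). \<Sum>q\<in>d ` (G <+> G). rvec d \<eta> p * cdbl d \<alpha> p q * rvec d \<xi> q)"
      unfolding cdbl_form[OF d F G] by (simp add: S_def cvec_rvec[OF d])
    have "\<bar>Re (S \<eta>)\<bar> \<le> C * sqrt (\<Sum>p\<in>d ` (F <+> F). (rvec d \<eta> p)\<^sup>2) * sqrt (\<Sum>q\<in>d ` (G <+> G). (rvec d \<xi> q)\<^sup>2)"
      using op_boundD[OF b, of "d ` (F <+> F)" "d ` (G <+> G)" "rvec d \<eta>" "rvec d \<xi>"] F G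
      unfolding eq by simp
    then show ?thesis
      unfolding sum_norm_cvec[OF d F, symmetric] sum_norm_cvec[OF d G, symmetric] by (simp add: cvec_rvec[OF d])
  qed
  \<comment> \<open>The form is conjugate linear in this argument, whence the sign; the real part of
    the right-hand side is the imaginary part of \<open>S \<eta>\<close>.\<close>
  have "S (\<lambda>i. \<i> * \<eta> i) = - \<i> * S \<eta>"
    by (simp add: S_def sum_distrib_left mult_ac sum_negf)
  then have "Im (S \<eta>) = Re (S (\<lambda>i. \<i> * \<eta> i))" by simp
  then have "cmod (S \<eta>) \<le> \<bar>Re (S \<eta>)\<bar> + \<bar>Re (S (\<lambda>i. \<i> * \<eta> i))\<bar>"
    using cmod_le[of "S \<eta>"] by simp
  also have "\<dots> \<le> 2 * C * sqrt (\<Sum>i\<in>F. (norm (\<eta> i))\<^sup>2) * sqrt (\<Sum>j\<in>G. (norm (\<xi> j))\<^sup>2)"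
    using re[of \<eta>] re[of "\<lambda>i. \<i> * \<eta> i"] by (simp add: norm_mult)
  finally show "norm (\<Sum>i\<in>F. \<Sum>j\<in>G. star (\<eta> i) * \<alpha> i j * \<xi> j) \<le>
      2 * C * sqrt (\<Sum>i\<in>F. (norm (\<eta> i))\<^sup>2) * sqrt (\<Sum>j\<in>G. (norm (\<xi> j))\<^sup>2)"
    by (simp add: S_def)
qed

section \<open>Real matrices inside complex matrices\<close>

abbreviation cemb :: "('a, 'b, real) mat \<Rightarrow> ('a, 'b, complex) mat" where
  "cemb \<alpha> \<equiv> (\<lambda>i j. complex_of_real (\<alpha> i j))"

text \<open>Real and imaginary parts of both vectors give four real forms, each within the real
  bound; hence the factor 4.\<close>

lemma op_bound_cemb:
  fixes \<alpha> :: "('a, 'b, real) mat"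
  assumes b: "op_bound I J \<alpha> C"
  shows "op_bound I J (cemb \<alpha>) (4 * C)"
  unfolding op_bound_def
proof (intro conjI allI impI)
  show "0 \<le> 4 * C" using op_bound_nonneg[OF b] by simp
  fix F :: "'a set" and G :: "'b set" and \<eta> :: "'a \<Rightarrow> complex" and \<xi> :: "'b \<Rightarrow> complex"
  assume FG: "finite F \<and> F \<subseteq> I \<and> finite G \<and> G \<subseteq> J"
  define v where "v = C * sqrt (\<Sum>i\<in>F. (norm (\<eta> i))\<^sup>2) * sqrt (\<Sum>j\<in>G. (norm (\<xi> j))\<^sup>2)"
  define S where "S = (\<lambda>a b. \<Sum>i\<in>F. \<Sum>j\<in>G. a i * \<alpha> i j * b j)"
  have S: "\<bar>S a b\<bar> \<le> v" if "\<And>i. \<bar>a i\<bar> \<le> cmod (\<eta> i)" "\<And>j. \<bar>b j\<bar> \<le> cmod (\<xi> j)" for a b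
  proof -
    have "(a i)\<^sup>2 \<le> (cmod (\<eta> i))\<^sup>2" "(b j)\<^sup>2 \<le> (cmod (\<xi> j))\<^sup>2" for i j
      using that by (metis abs_ge_zero power2_abs power_mono)+
    then have "C * sqrt (\<Sum>i\<in>F. (a i)\<^sup>2) * sqrt (\<Sum>j\<in>G. (b j)\<^sup>2) \<le> v"
      unfolding v_def using op_bound_nonneg[OF b]
      by (intro mult_mono mult_left_mono real_sqrt_le_mono sum_mono) (auto simp: sum_nonneg)
    then show ?thesis using op_boundD[OF b, of F G a b] FG by (simp add: S_def)
  qed
  let ?T = "\<Sum>i\<in>F. \<Sum>j\<in>G. cnj (\<eta> i) * complex_of_real (\<alpha> i j) * \<xi> j"
  have "Re ?T = S (\<lambda>i. Re (\<eta> i)) (\<lambda>j. Re (\<xi> j)) + S (\<lambda>i. Im (\<eta> i)) (\<lambda>j. Im (\<xi> j))"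
    by (simp add: S_def sum.distrib[symmetric] algebra_simps)
  moreover have "Im ?T = S (\<lambda>i. Re (\<eta> i)) (\<lambda>j. Im (\<xi> j)) - S (\<lambda>i. Im (\<eta> i)) (\<lambda>j. Re (\<xi> j))"
    by (simp add: S_def sum_subtractf[symmetric] algebra_simps)
  moreover note cmod_le[of ?T] S[of "\<lambda>i. Re (\<eta> i)" "\<lambda>j. Re (\<xi> j)"] S[of "\<lambda>i. Im (\<eta> i)" "\<lambda>j. Im (\<xi> j)"]
    S[of "\<lambda>i. Re (\<eta> i)" "\<lambda>j. Im (\<xi> j)"] S[of "\<lambda>i. Im (\<eta> i)" "\<lambda>j. Re (\<xi> j)"]
  ultimately have "cmod ?T \<le> 4 * v" by (simp add: abs_Re_le_cmod abs_Im_le_cmod)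
  then show "norm (\<Sum>i\<in>F. \<Sum>j\<in>G. star (\<eta> i) * complex_of_real (\<alpha> i j) * \<xi> j) \<le>
      4 * C * sqrt (\<Sum>i\<in>F. (norm (\<eta> i))\<^sup>2) * sqrt (\<Sum>j\<in>G. (norm (\<xi> j))\<^sup>2)"
    by (simp add: v_def)
qed

lemma op_bound_of_cemb:
  fixes \<alpha> :: "('a, 'b, real) mat"
  assumes b: "op_bound I J (cemb \<alpha>) C"
  shows "op_bound I J \<alpha> C"
  unfolding op_bound_def
proof (intro conjI allI impI op_bound_nonneg[OF b])
  fix F :: "'a set" and G :: "'b set" and \<eta> :: "'a \<Rightarrow> real" and \<xi> :: "'b \<Rightarrow> real"
  assume FG: "finite F \<and> F \<subseteq> I \<and> finite G \<and> G \<subseteq> J"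
  have "(\<Sum>i\<in>F. \<Sum>j\<in>G. star (complex_of_real (\<eta> i)) * complex_of_real (\<alpha> i j) * complex_of_real (\<xi> j)) =
      complex_of_real (\<Sum>i\<in>F. \<Sum>j\<in>G. star (\<eta> i) * \<alpha> i j * \<xi> j)"
    by simp
  then show "norm (\<Sum>i\<in>F. \<Sum>j\<in>G. star (\<eta> i) * \<alpha> i j * \<xi> j) \<le>
      C * sqrt (\<Sum>i\<in>F. (norm (\<eta> i))\<^sup>2) * sqrt (\<Sum>j\<in>G. (norm (\<xi> j))\<^sup>2)"
    using op_boundD[OF b, of F G "\<lambda>i. complex_of_real (\<eta> i)" "\<lambda>i. complex_of_real (\<xi> i)"] FG
    by (simp only: norm_of_real real_norm_def power2_abs)
qed

lemma (in complex_pair) re_im_zero [simp]: "re 0 = 0" "im 0 = 0"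
  using linear_0[OF bounded_linear.linear[OF mk_linear]] re_mk[of 0 0] im_mk[of 0 0]
  by (simp_all add: zero_prod_def)

lemma dbl_mem_iff [simp]:
  assumes "bij d"
  shows "d (Inl i) \<in> d ` (I <+> J) \<longleftrightarrow> i \<in> I" "d (Inr i) \<in> d ` (I <+> J) \<longleftrightarrow> i \<in> J"
  using bij_is_inj[OF assms] by (auto simp: inj_image_mem_iff)

lemma (in complex_pair) supported_dblmat:
  assumes d: "bij d"
  shows "supported (d ` (I <+> I)) (d ` (J <+> J)) (dblmat d re im z) \<longleftrightarrow> supported I J z"
proof
  assume L: "supported (d ` (I <+> I)) (d ` (J <+> J)) (dblmat d re im z)"
  have "re (z i j) = 0 \<and> im (z i j) = 0" if "i \<notin> I \<or> j \<notin> J" for i j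
    using L[unfolded supported_def, rule_format, of "d (Inl i)" "d (Inl j)"]
      L[unfolded supported_def, rule_format, of "d (Inr i)" "d (Inl j)"] that d by simp
  then show "supported I J z" unfolding supported_def by (auto intro: pair_eqI)
next
  assume R: "supported I J z"
  show "supported (d ` (I <+> I)) (d ` (J <+> J)) (dblmat d re im z)"
    unfolding supported_def
  proof (intro allI impI)
    fix p q assume "p \<notin> d ` (I <+> I) \<or> q \<notin> d ` (J <+> J)"
    then show "dblmat d re im z p q = 0" using R d
      by (cases p rule: dbl_cases[OF d]; cases q rule: dbl_cases[OF d]) (simp_all add: supported_def)
  qed
qed

lemma nonneg_complex_iff: "z \<in> complex_of_real ` {0..} \<longleftrightarrow> Im z = 0 \<and> 0 \<le> Re z"
proof
  assume "Im z = 0 \<and> 0 \<le> Re z"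
  then have "z = complex_of_real (Re z)" "Re z \<in> {0..}" by (auto simp: complex_eq_iff)
  then show "z \<in> complex_of_real ` {0..}" by (rule image_eqI)
qed auto

lemma nonneg_real_iff: "(x::real) \<in> of_real ` {0..} \<longleftrightarrow> 0 \<le> x"
  by auto

lemma mat_posD:
  assumes "mat_pos I T" "finite F" "F \<subseteq> I"
  shows "(\<Sum>i\<in>F. \<Sum>j\<in>F. star (\<xi> i) * T i j * \<xi> j) \<in> of_real ` {0..}"
  using assms by (simp add: mat_pos_def)

lemma mat_pos_UNIV:
  fixes T :: "('a, 'a, 'f::star_field) mat"
  assumes s: "supported I I T"
  shows "mat_pos I T \<longleftrightarrow> mat_pos UNIV T"
proof -
  have eq: "(\<Sum>i\<in>F. \<Sum>j\<in>F. star (\<xi> i) * T i j * \<xi> j) =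
      (\<Sum>i\<in>F\<inter>I. \<Sum>j\<in>F\<inter>I. star (\<xi> i) * T i j * \<xi> j)" if "finite F" for F \<xi>
  proof -
    have "(\<Sum>i\<in>F. \<Sum>j\<in>F. star (\<xi> i) * T i j * \<xi> j) = (\<Sum>i\<in>F\<inter>I. \<Sum>j\<in>F. star (\<xi> i) * T i j * \<xi> j)"
      using that s by (intro sum.mono_neutral_right) (auto simp: supported_def)
    also have "\<dots> = (\<Sum>i\<in>F\<inter>I. \<Sum>j\<in>F\<inter>I. star (\<xi> i) * T i j * \<xi> j)"
      using that s by (intro sum.cong sum.mono_neutral_right) (auto simp: supported_def)
    finally show ?thesis .
  qed
  show ?thesis
  proof
    assume L: "mat_pos I T"
    show "mat_pos UNIV T"
      unfolding mat_pos_def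
    proof (intro conjI allI impI)
      show "madj T = T" using L by (simp add: mat_pos_def)
      fix F :: "'a set" and \<xi> :: "'a \<Rightarrow> 'f" assume "finite F \<and> F \<subseteq> UNIV"
      then have F: "finite F" by simp
      show "(\<Sum>i\<in>F. \<Sum>j\<in>F. star (\<xi> i) * T i j * \<xi> j) \<in> of_real ` {0..}"
        unfolding eq[OF F] using F by (intro mat_posD[OF L]) auto
    qed
  next
    assume "mat_pos UNIV T"
    then show "mat_pos I T" by (simp add: mat_pos_def)
  qed
qed

lemma madj_form:
  fixes w :: "('a, 'a, complex) mat"
  assumes "madj w = w"
  shows "Im (\<Sum>i\<in>F. \<Sum>j\<in>F. cnj (\<xi> i) * w i j * \<xi> j) = 0"
proof -
  have w: "cnj (w j i) = w i j" for i j
    using fun_cong[OF fun_cong[OF assms, of i], of j] by (simp add: madj_def)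
  have "cnj (\<Sum>i\<in>F. \<Sum>j\<in>F. cnj (\<xi> i) * w i j * \<xi> j) = (\<Sum>j\<in>F. \<Sum>i\<in>F. cnj (\<xi> i) * w i j * \<xi> j)"
    by (simp add: w mult_ac)
  also have "\<dots> = (\<Sum>i\<in>F. \<Sum>j\<in>F. cnj (\<xi> i) * w i j * \<xi> j)" by (rule sum.swap)
  finally have eq: "cnj (\<Sum>i\<in>F. \<Sum>j\<in>F. cnj (\<xi> i) * w i j * \<xi> j) = (\<Sum>i\<in>F. \<Sum>j\<in>F. cnj (\<xi> i) * w i j * \<xi> j)" .
  have "Im z = 0" if "cnj z = z" for z using that by (simp add: complex_eq_iff)
  from this[OF eq] show ?thesis .
qed

lemma madj_cdbl_iff:
  assumes "bij d"
  shows "madj (cdbl d w) = cdbl d w \<longleftrightarrow> madj w = w"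
  using complex_pair_complex.dblmat_inject[OF assms] by (auto simp: madj_cdbl[OF assms])

text \<open>The form of the doubled matrix is the real part of the complex form. The imaginary part
  of the latter vanishes by selfadjointness, so real positivity is full positivity.\<close>

lemma mat_pos_cdbl:
  assumes d: "bij d"
  shows "mat_pos UNIV (cdbl d w) \<longleftrightarrow> mat_pos UNIV w"
proof
  assume L: "mat_pos UNIV (cdbl d w)"
  then have w: "madj w = w" by (simp add: mat_pos_def madj_cdbl_iff[OF d])
  show "mat_pos UNIV w"
    unfolding mat_pos_def nonneg_complex_iff
  proof (intro conjI allI impI w)
    fix F :: "'a set" and \<xi> :: "'a \<Rightarrow> complex" assume F: "finite F \<and> F \<subseteq> UNIV"
    show "Im (\<Sum>i\<in>F. \<Sum>j\<in>F. star (\<xi> i) * w i j * \<xi> j) = 0" using madj_form[OF w] by simp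
    have "0 \<le> (\<Sum>p\<in>d ` (F <+> F). \<Sum>q\<in>d ` (F <+> F). rvec d \<xi> p * cdbl d w p q * rvec d \<xi> q)"
      using mat_posD[OF L, of "d ` (F <+> F)" "rvec d \<xi>"] F by (simp add: nonneg_real_iff)
    then show "0 \<le> Re (\<Sum>i\<in>F. \<Sum>j\<in>F. star (\<xi> i) * w i j * \<xi> j)"
      using F by (simp add: cdbl_form[OF d] cvec_rvec[OF d])
  qed
next
  assume R: "mat_pos UNIV w"
  show "mat_pos UNIV (cdbl d w)"
    unfolding mat_pos_def nonneg_real_iff
  proof (intro conjI allI impI)
    show "madj (cdbl d w) = cdbl d w" using R by (simp add: mat_pos_def madj_cdbl_iff[OF d])
    fix P :: "'a set" and \<xi> :: "'a \<Rightarrow> real" assume P: "finite P \<and> P \<subseteq> UNIV"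
    obtain F where F: "finite F" "P \<subseteq> d ` (F <+> F)" using finite_dbl_cover[OF d] P by blast
    have fin: "finite (d ` (F <+> F))" using F by auto
    define \<xi>' where "\<xi>' = (\<lambda>p. if p \<in> P then \<xi> p else 0)"
    have "(\<Sum>p\<in>P. \<Sum>q\<in>P. star (\<xi> p) * cdbl d w p q * \<xi> q) =
        (\<Sum>p\<in>P. \<Sum>q\<in>d ` (F <+> F). \<xi>' p * cdbl d w p q * \<xi>' q)"
      using F fin by (intro sum.cong sum.mono_neutral_cong_left) (auto simp: \<xi>'_def)
    also have "\<dots> = (\<Sum>p\<in>d ` (F <+> F). \<Sum>q\<in>d ` (F <+> F). \<xi>' p * cdbl d w p q * \<xi>' q)"
      using F fin by (intro sum.mono_neutral_left) (auto simp: \<xi>'_def)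
    also have "\<dots> = Re (\<Sum>i\<in>F. \<Sum>j\<in>F. cnj (cvec d \<xi>' i) * w i j * cvec d \<xi>' j)"
      by (rule cdbl_form[OF d F(1) F(1)])
    also have "0 \<le> \<dots>"
      using mat_posD[OF R F(1), of "cvec d \<xi>'"] by (simp add: nonneg_complex_iff)
    finally show "0 \<le> (\<Sum>p\<in>P. \<Sum>q\<in>P. star (\<xi> p) * cdbl d w p q * \<xi> q)" .
  qed
qed

text \<open>At a complex vector the form is the sum of its values at the real and imaginary parts;
  the cross terms are purely imaginary and cancel by symmetry.\<close>

lemma mat_pos_cemb: "mat_pos I (cemb T) \<longleftrightarrow> mat_pos I T"
proof
  assume L: "mat_pos I (cemb T)"
  show "mat_pos I T"
    unfolding mat_pos_def nonneg_real_iff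
  proof (intro conjI allI impI)
    show "madj T = T" using L by (simp add: mat_pos_def madj_def fun_eq_iff)
    fix F :: "'a set" and \<xi> :: "'a \<Rightarrow> real" assume F: "finite F \<and> F \<subseteq> I"
    have "(\<Sum>i\<in>F. \<Sum>j\<in>F. star (complex_of_real (\<xi> i)) * complex_of_real (T i j) * complex_of_real (\<xi> j)) =
      complex_of_real (\<Sum>i\<in>F. \<Sum>j\<in>F. star (\<xi> i) * T i j * \<xi> j)"
      by simp
    moreover have "(\<Sum>i\<in>F. \<Sum>j\<in>F. star (complex_of_real (\<xi> i)) * complex_of_real (T i j) * complex_of_real (\<xi> j))
        \<in> complex_of_real ` {0..}"
      using F by (intro mat_posD[OF L]) auto
    ultimately show "0 \<le> (\<Sum>i\<in>F. \<Sum>j\<in>F. star (\<xi> i) * T i j * \<xi> j)"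
      by (simp only: nonneg_complex_iff Re_complex_of_real)
  qed
next
  assume R: "mat_pos I T"
  show "mat_pos I (cemb T)"
    unfolding mat_pos_def nonneg_complex_iff
  proof (intro conjI allI impI)
    show m: "madj (cemb T) = cemb T" using R by (simp add: mat_pos_def madj_def fun_eq_iff)
    fix F :: "'a set" and \<xi> :: "'a \<Rightarrow> complex" assume F: "finite F \<and> F \<subseteq> I"
    show "Im (\<Sum>i\<in>F. \<Sum>j\<in>F. star (\<xi> i) * cemb T i j * \<xi> j) = 0" using madj_form[OF m] by simp
    have "Re (\<Sum>i\<in>F. \<Sum>j\<in>F. star (\<xi> i) * cemb T i j * \<xi> j) =
        (\<Sum>i\<in>F. \<Sum>j\<in>F. star (Re (\<xi> i)) * T i j * Re (\<xi> j)) + (\<Sum>i\<in>F. \<Sum>j\<in>F. star (Im (\<xi> i)) * T i j * Im (\<xi> j))"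
      by (simp add: sum.distrib[symmetric] algebra_simps)
    also have "0 \<le> \<dots>"
      using mat_posD[OF R, of F "\<lambda>i. Re (\<xi> i)"] mat_posD[OF R, of F "\<lambda>i. Im (\<xi> i)"] F
      by (intro add_nonneg_nonneg) (auto simp: nonneg_real_iff)
    finally show "0 \<le> Re (\<Sum>i\<in>F. \<Sum>j\<in>F. star (\<xi> i) * cemb T i j * \<xi> j)" .
  qed
qed

text \<open>Valid for divergent families too: taking real parts shows that both sides converge
  together, and otherwise both are 0.\<close>

lemma infsum_complex_of_real:
  "(\<Sum>\<^sub>\<infinity>x\<in>A. complex_of_real (f x)) = complex_of_real (infsum f A)"
proof (rule infsum_bounded_linear_strong[OF _ bounded_linear_of_real])
  show "(\<lambda>x. complex_of_real (f x)) summable_on A \<longleftrightarrow> f summable_on A"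
    by (rule summable_on_bounded_linear_iff[OF bounded_linear_of_real bounded_linear_Re]) simp
qed

section \<open>Isometries and direct sum families under doubling and under the real
  embedding\<close>

lemma bdd_mats_cdbl:
  assumes d: "bij d" and \<alpha>: "\<alpha> \<in> bdd_mats I J"
  shows "cdbl d \<alpha> \<in> bdd_mats (d ` (I <+> I)) (d ` (J <+> J))"
  using \<alpha> op_bound_cdbl[OF d]
  by (auto simp: bdd_mats_iff complex_pair_complex.supported_dblmat[OF d])

lemma bdd_mats_sq_summable:
  fixes \<alpha> :: "('a, 'b, real) mat"
  assumes "\<alpha> \<in> bdd_mats I J"
  shows "sq_summable (\<alpha> p)" "sq_summable (\<lambda>l. \<alpha> l q)"
  using assms op_bound_sq_summable by (auto simp: bdd_mats_iff)

lemma mmul_cdbl_bdd: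
  assumes d: "bij d" and "\<alpha> \<in> bdd_mats I J" "\<beta> \<in> bdd_mats J' L"
  shows "mmul (cdbl d \<alpha>) (cdbl d \<beta>) = cdbl d (mmul \<alpha> \<beta>)"
    and "mmul (madj (cdbl d \<beta>)) (cdbl d \<beta>) = cdbl d (mmul (madj \<beta>) \<beta>)"
    and "mmul (cdbl d \<alpha>) (madj (cdbl d \<alpha>)) = cdbl d (mmul \<alpha> (madj \<alpha>))"
proof -
  note \<alpha> = bdd_mats_sq_summable[OF bdd_mats_cdbl[OF d assms(2)]]
    and \<beta> = bdd_mats_sq_summable[OF bdd_mats_cdbl[OF d assms(3)]]
  show "mmul (cdbl d \<alpha>) (cdbl d \<beta>) = cdbl d (mmul \<alpha> \<beta>)"
    by (rule mmul_cdbl[OF d \<alpha>(1) \<beta>(2)])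
  show "mmul (madj (cdbl d \<beta>)) (cdbl d \<beta>) = cdbl d (mmul (madj \<beta>) \<beta>)"
    unfolding madj_cdbl[OF d] using \<beta>(2) madj_cdbl[OF d, of \<beta>, symmetric]
    by (intro mmul_cdbl[OF d]) (auto simp: madj_def)
  show "mmul (cdbl d \<alpha>) (madj (cdbl d \<alpha>)) = cdbl d (mmul \<alpha> (madj \<alpha>))"
    unfolding madj_cdbl[OF d] using \<alpha>(1) madj_cdbl[OF d, of \<alpha>, symmetric]
    by (intro mmul_cdbl[OF d]) (auto simp: madj_def)
qed

lemma isometry_cdbl:
  assumes d: "bij d" and \<alpha>: "isometry_mat I J \<alpha>"
  shows "isometry_mat (d ` (I <+> I)) (d ` (J <+> J)) (cdbl d \<alpha>)"
  using \<alpha> bdd_mats_cdbl[OF d] mmul_cdbl_bdd(2)[OF d, of \<alpha> I J \<alpha> I J] cdbl_mone[OF d, of J]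
  by (simp add: isometry_mat_def)

lemma sum_family_cdbl:
  assumes d: "bij d" and \<alpha>: "sum_family I S J \<alpha>"
  shows "sum_family (d ` (I <+> I)) S (\<lambda>s. d ` (J s <+> J s)) (\<lambda>s. cdbl d (\<alpha> s))"
  unfolding sum_family_def
proof (intro conjI ballI allI)
  fix s assume s: "s \<in> S"
  then show "d ` (J s <+> J s) \<noteq> {}" using \<alpha> by (auto simp: sum_family_def)
  show "isometry_mat (d ` (I <+> I)) (d ` (J s <+> J s)) (cdbl d (\<alpha> s))"
    using \<alpha> s by (intro isometry_cdbl[OF d]) (auto simp: sum_family_def)
next
  fix p q
  have bdd: "\<alpha> s \<in> bdd_mats I (J s)" if "s \<in> S" for s
    using \<alpha> that by (auto simp: sum_family_def isometry_mat_def)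
  have "((\<lambda>s. cdbl d (mmul (\<alpha> s) (madj (\<alpha> s))) p q) has_sum cdbl d (mone I) p q) S"
  proof -
    have hs: "((\<lambda>s. mmul (\<alpha> s) (madj (\<alpha> s)) i j) has_sum mone I i j) S" for i j
      using \<alpha> by (auto simp: sum_family_def)
    show ?thesis
      \<comment> \<open>The four blocks of a doubled series are its real part, its imaginary part
        and the negative of the latter.\<close>
      using has_sum_Re[OF hs] has_sum_Im[OF hs] has_sum_Im[OF hs, THEN has_sum_uminusI]
      by (cases p rule: dbl_cases[OF d]; cases q rule: dbl_cases[OF d]) (simp_all add: d)
  qed
  then show "((\<lambda>s. mmul (cdbl d (\<alpha> s)) (madj (cdbl d (\<alpha> s))) p q) has_sum mone (d ` (I <+> I)) p q) S"
    unfolding cdbl_mone[OF d] using mmul_cdbl_bdd(3)[OF d bdd bdd]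
    by (simp cong: has_sum_cong)
qed

lemma isometry_cemb:
  assumes \<alpha>: "isometry_mat I J \<alpha>"
  shows "isometry_mat I J (cemb \<alpha>)"
proof -
  have "mmul (madj (cemb \<alpha>)) (cemb \<alpha>) = cemb (mmul (madj \<alpha>) \<alpha>)"
    by (simp add: mmul_def madj_def of_real_mult[symmetric] infsum_complex_of_real del: of_real_mult)
  moreover have "cemb (mone J) = mone J" by (auto simp: mone_def fun_eq_iff)
  ultimately show ?thesis
    using \<alpha> op_bound_cemb by (fastforce simp: isometry_mat_def bdd_mats_def)
qed

lemma sum_family_cemb:
  assumes \<alpha>: "sum_family I S J \<alpha>"
  shows "sum_family I S J (\<lambda>s. cemb (\<alpha> s))"
proof -
  have "mmul (cemb (\<alpha> s)) (madj (cemb (\<alpha> s))) = cemb (mmul (\<alpha> s) (madj (\<alpha> s)))" for s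
    by (simp add: mmul_def madj_def of_real_mult[symmetric] infsum_complex_of_real del: of_real_mult)
  moreover have "((\<lambda>s. complex_of_real (mmul (\<alpha> s) (madj (\<alpha> s)) p q)) has_sum mone I p q) S" for p q
  proof -
    have "((\<lambda>s. mmul (\<alpha> s) (madj (\<alpha> s)) p q) has_sum mone I p q) S"
      using \<alpha> by (simp add: sum_family_def)
    from has_sum_of_real[OF this, where 'a = complex] show ?thesis
      by (cases "p = q \<and> p \<in> I") (auto simp: mone_def)
  qed
  ultimately show ?thesis
    using \<alpha> isometry_cemb by (fastforce simp: sum_family_def)
qed

text \<open>The squared norms of row \<open>p\<close> are the diagonal entries of \<alpha> times its
  adjoint, which sum to an entry of the identity.\<close>

lemma sum_family_rows:
  fixes \<alpha> :: "'k \<Rightarrow> ('k, 'k, real) mat"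
  assumes "sum_family I S J \<alpha>"
  shows "(\<lambda>s. \<Sum>\<^sub>\<infinity>k. (\<alpha> s p k)\<^sup>2) summable_on S"
proof -
  have "(\<lambda>s. mmul (\<alpha> s) (madj (\<alpha> s)) p p) summable_on S"
    using assms by (auto simp: sum_family_def intro: has_sum_imp_summable)
  then show ?thesis by (simp add: mmul_def madj_def power2_eq_square)
qed

text \<open>The doubling acts on the second coordinate, so that amplification by n and doubling
  commute as matrices over the same indices.\<close>

definition amp_dbl :: "('a + 'a \<Rightarrow> 'a) \<Rightarrow> ('n \<times> 'a) + ('n \<times> 'a) \<Rightarrow> 'n \<times> 'a" where
  "amp_dbl d x = (case x of Inl (r, i) \<Rightarrow> (r, d (Inl i)) | Inr (r, i) \<Rightarrow> (r, d (Inr i)))"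

lemma amp_dbl_simps [simp]:
  "amp_dbl d (Inl (r, i)) = (r, d (Inl i))" "amp_dbl d (Inr (r, i)) = (r, d (Inr i))"
  by (simp_all add: amp_dbl_def)

lemma bij_amp_dbl:
  assumes d: "bij d"
  shows "bij (amp_dbl d)"
proof (rule bijI)
  have "d x = d y \<longleftrightarrow> x = y" for x y using bij_is_inj[OF d] by (simp add: inj_eq)
  then show "inj (amp_dbl d)"
    by (auto simp: inj_def amp_dbl_def split: sum.splits)
  have "y \<in> range (amp_dbl d)" for y
  proof (cases y)
    case (Pair r p)
    show ?thesis
    proof (cases p rule: dbl_cases[OF d])
      case (1 i)
      then have "y = amp_dbl d (Inl (r, i))" using Pair by simp
      then show ?thesis by blast
    next
      case (2 i)
      then have "y = amp_dbl d (Inr (r, i))" using Pair by simp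
      then show ?thesis by blast
    qed
  qed
  then show "surj (amp_dbl d)" by blast
qed

lemma amp_dbl_image: "amp_dbl d ` ((A \<times> I) <+> (A \<times> I)) = A \<times> d ` (I <+> I)"
  by (force simp: amp_dbl_def image_iff split: sum.splits)

lemma ampl_cdbl:
  assumes d: "bij d"
  shows "ampl (cdbl d \<alpha>) = cdbl (amp_dbl d) (ampl \<alpha>)"
  by (rule dbl_ext[OF bij_amp_dbl[OF d]])
    (auto simp: bij_amp_dbl[OF d] d ampl_def split: prod.splits)

lemma dblmat_amp_dbl:
  assumes "bij d"
  shows "dblmat (amp_dbl d) re im z (r, d (Inl i)) (s, d (Inl j)) = re (z (r, i) (s, j))"
    and "dblmat (amp_dbl d) re im z (r, d (Inl i)) (s, d (Inr j)) = - im (z (r, i) (s, j))"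
    and "dblmat (amp_dbl d) re im z (r, d (Inr i)) (s, d (Inl j)) = im (z (r, i) (s, j))"
    and "dblmat (amp_dbl d) re im z (r, d (Inr i)) (s, d (Inr j)) = re (z (r, i) (s, j))"
  using dblmat_simps[OF bij_amp_dbl[OF assms], of re im z "(r, i)" "(s, j)"] by simp_all

text \<open>Only block \<open>r\<close> of the amplified row is nonzero. As an equivalence it
  transfers summability as well as the value of the sum.\<close>

lemma has_sum_ampl_row:
  fixes \<alpha> :: "('a, 'b, real) mat"
  shows "((\<lambda>x. (ampl \<alpha> (r, p) x)\<^sup>2) has_sum t) UNIV \<longleftrightarrow> ((\<lambda>k. (\<alpha> p k)\<^sup>2) has_sum t) UNIV"
proof -
  have "((\<lambda>x. (ampl \<alpha> (r, p) x)\<^sup>2) has_sum t) UNIV \<longleftrightarrow>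
      ((\<lambda>x. (ampl \<alpha> (r, p) x)\<^sup>2) has_sum t) (range (Pair r))"
    by (rule has_sum_cong_neutral) (auto simp: ampl_def)
  also have "\<dots> \<longleftrightarrow> ((\<lambda>k. (\<alpha> p k)\<^sup>2) has_sum t) UNIV"
    by (subst has_sum_reindex) (auto simp: inj_def o_def ampl_def)
  finally show ?thesis .
qed

lemma sq_summable_ampl:
  "sq_summable (ampl \<alpha> (r, p)) \<longleftrightarrow> sq_summable (\<alpha> p)"
  by (simp add: sq_summable_def summable_on_def has_sum_ampl_row)

lemma infsum_ampl_row:
  fixes \<alpha> :: "('a, 'b, real) mat"
  shows "(\<Sum>\<^sub>\<infinity>x. (ampl \<alpha> (r, p) x)\<^sup>2) = (\<Sum>\<^sub>\<infinity>k. (\<alpha> p k)\<^sup>2)"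
proof (cases "(\<lambda>k. (\<alpha> p k)\<^sup>2) summable_on UNIV")
  case True
  then show ?thesis by (intro infsumI has_sum_ampl_row[THEN iffD2] has_sum_infsum)
next
  case False
  then have "\<not> (\<lambda>x. (ampl \<alpha> (r, p) x)\<^sup>2) summable_on UNIV"
    by (simp add: summable_on_def has_sum_ampl_row)
  then show ?thesis using False by (simp add: infsum_not_exists)
qed


section \<open>Real operator spaces and their complexifications\<close>

text \<open>A signed partial permutation: injectivity leaves at most one nonzero entry in each row
  and column, so the form is a sum over matched pairs and Cauchy-Schwarz applies. Row selections,
  the rotation and the inclusions of the halves all have this shape.\<close>

lemma op_bound_partial_injection:
  fixes s :: "'a \<Rightarrow> 'b \<Rightarrow> real" and a :: "'a \<Rightarrow> 'c"
  assumes a: "inj_on a A" and h: "inj_on h B" and s: "\<And>i k. \<bar>s i k\<bar> \<le> 1"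
  shows "op_bound A B (\<lambda>i k. if h k = a i then s i k else 0) 1"
  unfolding op_bound_def
proof (intro conjI allI impI)
  fix F :: "'a set" and G :: "'b set" and \<eta> :: "'a \<Rightarrow> real" and \<xi> :: "'b \<Rightarrow> real"
  assume FG: "finite F \<and> F \<subseteq> A \<and> finite G \<and> G \<subseteq> B"
  then have F: "finite F" and G: "finite G" by auto
  \<comment> \<open>The matched pairs; both projections are injective on them, so neither vector is
    counted twice.\<close>
  define P where "P = {x \<in> F \<times> G. h (snd x) = a (fst x)}"
  have P: "finite P" using F G by (simp add: P_def)
  have fst: "inj_on fst P"
  proof (rule inj_onI)
    fix x y assume xy: "x \<in> P" "y \<in> P" "fst x = fst y"
    then have "h (snd x) = h (snd y)" "snd x \<in> B" "snd y \<in> B" using FG by (auto simp: P_def)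
    then have "snd x = snd y" by (rule inj_onD[OF h])
    then show "x = y" using xy(3) by (simp add: prod_eq_iff)
  qed
  have snd: "inj_on snd P"
  proof (rule inj_onI)
    fix x y assume xy: "x \<in> P" "y \<in> P" "snd x = snd y"
    then have "a (fst x) = a (fst y)" "fst x \<in> A" "fst y \<in> A" using FG by (auto simp: P_def)
    then have "fst x = fst y" by (rule inj_onD[OF a])
    then show "x = y" using xy(3) by (simp add: prod_eq_iff)
  qed
  have "(\<Sum>i\<in>F. \<Sum>j\<in>G. star (\<eta> i) * (if h j = a i then s i j else 0) * \<xi> j) =
      (\<Sum>x\<in>F \<times> G. \<eta> (fst x) * (if h (snd x) = a (fst x) then s (fst x) (snd x) else 0) * \<xi> (snd x))"
    by (simp add: sum.cartesian_product split_def)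
  also have "\<dots> = (\<Sum>x\<in>P. \<eta> (fst x) * s (fst x) (snd x) * \<xi> (snd x))"
    using F G by (intro sum.mono_neutral_cong_right) (auto simp: P_def)
  also have "\<bar>\<dots>\<bar> \<le> (\<Sum>x\<in>P. \<bar>\<eta> (fst x)\<bar> * \<bar>\<xi> (snd x)\<bar>)"
  proof (rule order_trans[OF sum_abs sum_mono])
    fix x assume "x \<in> P"
    have "\<bar>\<eta> (fst x)\<bar> * \<bar>s (fst x) (snd x)\<bar> * \<bar>\<xi> (snd x)\<bar> \<le> \<bar>\<eta> (fst x)\<bar> * 1 * \<bar>\<xi> (snd x)\<bar>"
      by (intro mult_right_mono mult_left_mono s) auto
    then show "\<bar>\<eta> (fst x) * s (fst x) (snd x) * \<xi> (snd x)\<bar> \<le> \<bar>\<eta> (fst x)\<bar> * \<bar>\<xi> (snd x)\<bar>"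
      by (simp add: abs_mult)
  qed
  also have "\<dots> \<le> L2_set (\<lambda>x. \<eta> (fst x)) P * L2_set (\<lambda>x. \<xi> (snd x)) P"
    by (rule L2_set_mult_ineq)
  also have "\<dots> \<le> sqrt (\<Sum>i\<in>F. (\<eta> i)\<^sup>2) * sqrt (\<Sum>j\<in>G. (\<xi> j)\<^sup>2)"
  proof (intro mult_mono)
    have "(\<Sum>x\<in>P. (\<eta> (fst x))\<^sup>2) = (\<Sum>i\<in>fst ` P. (\<eta> i)\<^sup>2)" by (simp add: sum.reindex[OF fst])
    also have "\<dots> \<le> (\<Sum>i\<in>F. (\<eta> i)\<^sup>2)" using F by (intro sum_mono2) (auto simp: P_def)
    finally show "L2_set (\<lambda>x. \<eta> (fst x)) P \<le> sqrt (\<Sum>i\<in>F. (\<eta> i)\<^sup>2)" by (simp add: L2_set_def)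
    have "(\<Sum>x\<in>P. (\<xi> (snd x))\<^sup>2) = (\<Sum>i\<in>snd ` P. (\<xi> i)\<^sup>2)" by (simp add: sum.reindex[OF snd])
    also have "\<dots> \<le> (\<Sum>i\<in>G. (\<xi> i)\<^sup>2)" using G by (intro sum_mono2) (auto simp: P_def)
    finally show "L2_set (\<lambda>x. \<xi> (snd x)) P \<le> sqrt (\<Sum>i\<in>G. (\<xi> i)\<^sup>2)" by (simp add: L2_set_def)
  qed (auto simp: sum_nonneg)
  finally show "norm (\<Sum>i\<in>F. \<Sum>j\<in>G. star (\<eta> i) * (if h j = a i then s i j else 0) * \<xi> j) \<le>
      1 * sqrt (\<Sum>i\<in>F. (norm (\<eta> i))\<^sup>2) * sqrt (\<Sum>j\<in>G. (norm (\<xi> j))\<^sup>2)" by simp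
qed simp

text \<open>One-row and one-column matrices are bounded by the Euclidean norm. Through them Ruan's
  axiom bounds a weighted sum of entries, which is a 1 by 1 matrix.\<close>

lemma op_bound_row:
  fixes v :: "'b \<Rightarrow> real"
  assumes H: "finite H"
  shows "op_bound {..<1::nat} H (\<lambda>_ k. v k) (sqrt (\<Sum>k\<in>H. (v k)\<^sup>2))"
    and "op_bound H {..<1::nat} (\<lambda>k _. v k) (sqrt (\<Sum>k\<in>H. (v k)\<^sup>2))"
proof -
  have CS: "\<bar>t\<bar> * \<bar>\<Sum>k\<in>G. v k * \<xi> k\<bar> \<le> sqrt (\<Sum>k\<in>H. (v k)\<^sup>2) * \<bar>t\<bar> * sqrt (\<Sum>k\<in>G. (\<xi> k)\<^sup>2)"
    if "finite G" "G \<subseteq> H" for G \<xi> and t :: real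
  proof -
    have "\<bar>\<Sum>k\<in>G. v k * \<xi> k\<bar> \<le> (\<Sum>k\<in>G. \<bar>v k\<bar> * \<bar>\<xi> k\<bar>)"
      using sum_abs[of "\<lambda>k. v k * \<xi> k" G] by (simp add: abs_mult)
    also have "\<dots> \<le> L2_set v G * L2_set \<xi> G" by (rule L2_set_mult_ineq)
    also have "\<dots> \<le> sqrt (\<Sum>k\<in>H. (v k)\<^sup>2) * sqrt (\<Sum>k\<in>G. (\<xi> k)\<^sup>2)"
      unfolding L2_set_def using H that by (intro mult_right_mono real_sqrt_le_mono sum_mono2) (auto simp: sum_nonneg)
    finally have "\<bar>t\<bar> * \<bar>\<Sum>k\<in>G. v k * \<xi> k\<bar> \<le> \<bar>t\<bar> * (sqrt (\<Sum>k\<in>H. (v k)\<^sup>2) * sqrt (\<Sum>k\<in>G. (\<xi> k)\<^sup>2))"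
      by (intro mult_left_mono) auto
    then show ?thesis by (simp add: mult_ac)
  qed
  have one: "F = {} \<or> F = {0}" if "F \<subseteq> {..<1::nat}" for F using that by auto
  show "op_bound {..<1::nat} H (\<lambda>_ k. v k) (sqrt (\<Sum>k\<in>H. (v k)\<^sup>2))"
    unfolding op_bound_def
  proof (intro conjI allI impI)
    fix F :: "nat set" and G :: "'b set" and \<eta> :: "nat \<Rightarrow> real" and \<xi> :: "'b \<Rightarrow> real"
    assume FG: "finite F \<and> F \<subseteq> {..<1} \<and> finite G \<and> G \<subseteq> H"
    then show "norm (\<Sum>i\<in>F. \<Sum>j\<in>G. star (\<eta> i) * v j * \<xi> j) \<le>
      sqrt (\<Sum>k\<in>H. (v k)\<^sup>2) * sqrt (\<Sum>i\<in>F. (norm (\<eta> i))\<^sup>2) * sqrt (\<Sum>j\<in>G. (norm (\<xi> j))\<^sup>2)"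
      using one[of F] CS[of G "\<eta> 0" \<xi>] by (auto simp: mult.assoc sum_distrib_left[symmetric] abs_mult)
  qed (simp add: sum_nonneg)
  show "op_bound H {..<1::nat} (\<lambda>k _. v k) (sqrt (\<Sum>k\<in>H. (v k)\<^sup>2))"
    unfolding op_bound_def
  proof (intro conjI allI impI)
    fix G :: "nat set" and F :: "'b set" and \<xi> :: "nat \<Rightarrow> real" and \<eta> :: "'b \<Rightarrow> real"
    assume FG: "finite F \<and> F \<subseteq> H \<and> finite G \<and> G \<subseteq> {..<1}"
    have "(\<Sum>i\<in>F. \<eta> i * (v i * \<xi> 0)) = \<xi> 0 * (\<Sum>i\<in>F. v i * \<eta> i)"
      by (simp add: sum_distrib_left mult_ac)
    then show "norm (\<Sum>i\<in>F. \<Sum>j\<in>G. star (\<eta> i) * v i * \<xi> j) \<le>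
      sqrt (\<Sum>k\<in>H. (v k)\<^sup>2) * sqrt (\<Sum>i\<in>F. (norm (\<eta> i))\<^sup>2) * sqrt (\<Sum>j\<in>G. (norm (\<xi> j))\<^sup>2)"
      using FG one[of G] CS[of F "\<xi> 0" \<eta>] by (auto simp: mult.assoc abs_mult mult_ac)
  qed (simp add: sum_nonneg)
qed

section \<open>Doubling and embedding for matrices over an operator space\<close>

abbreviation edbl :: "('a + 'a \<Rightarrow> 'a) \<Rightarrow> ('a, 'a, 'e::ab_group_add \<times> 'e) mat \<Rightarrow> ('a, 'a, 'e) mat" where
  "edbl d \<equiv> dblmat d fst snd"

abbreviation eemb :: "('a, 'a, 'e) mat \<Rightarrow> ('a, 'a, 'e::ab_group_add \<times> 'e) mat" where
  "eemb x \<equiv> (\<lambda>i j. (x i j, 0))"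

lemma edbl_cmat: "edbl d z = (\<lambda>p q. cmat z (inv d p) (inv d q))"
  by (simp add: dblmat_def cmat_def)

text \<open>Lists the first copies of \<open>e 0, ..., e (n - 1)\<close> and then their second
  copies. This is the order in which the norm of \<open>complexify E\<close> arranges its 2n by 2n
  real matrix.\<close>

definition dbl_enum :: "('a + 'a \<Rightarrow> 'a) \<Rightarrow> nat \<Rightarrow> (nat \<Rightarrow> 'a) \<Rightarrow> nat \<Rightarrow> 'a" where
  "dbl_enum d n e = (\<lambda>i. d (map_sum e e (split_nat n i)))"

lemma dbl_enum:
  assumes d: "bij d" and e: "inj_on e {..<n}"
  shows "inj_on (dbl_enum d n e) {..<2 * n}"
    and "dbl_enum d n e ` {..<2 * n} = d ` (e ` {..<n} <+> e ` {..<n})"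
proof -
  have dd: "d x = d y \<longleftrightarrow> x = y" for x y using bij_is_inj[OF d] by (simp add: inj_eq)
  show "inj_on (dbl_enum d n e) {..<2 * n}"
  proof (rule inj_onI)
    fix i j assume ij: "i \<in> {..<2 * n}" "j \<in> {..<2 * n}" "dbl_enum d n e i = dbl_enum d n e j"
    show "i = j"
    proof (cases "i < n")
      case True
      then have "j < n" "e i = e j" using ij(3) by (auto simp: dbl_enum_def dd split_nat_def split: if_splits)
      then show ?thesis using True inj_onD[OF e, of i j] by simp
    next
      case False
      then have j: "\<not> j < n" "e (i - n) = e (j - n)"
        using ij(3) by (auto simp: dbl_enum_def dd split_nat_def split: if_splits)
      then have "i - n = j - n" using False ij inj_onD[OF e, of "i - n" "j - n"] by auto
      then show ?thesis using False j by simp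
    qed
  qed
  have "map_sum e e ` split_nat n ` {..<2 * n} = e ` {..<n} <+> e ` {..<n}"
  proof -
    have "split_nat n ` {..<2 * n} = {..<n} <+> {..<n}"
    proof (intro equalityI subsetI)
      fix x assume "x \<in> {..<n} <+> {..<n}"
      then show "x \<in> split_nat n ` {..<2 * n}"
      proof (cases x)
        case (Inl i)
        then show ?thesis using \<open>x \<in> _\<close> by (intro image_eqI[of _ _ i]) (auto simp: split_nat_def)
      next
        case (Inr i)
        then show ?thesis using \<open>x \<in> _\<close> by (intro image_eqI[of _ _ "n + i"]) (auto simp: split_nat_def)
      qed
    qed (auto simp: split_nat_def)
    then show ?thesis by (simp add: image_Un image_image Plus_def)
  qed
  then show "dbl_enum d n e ` {..<2 * n} = d ` (e ` {..<n} <+> e ` {..<n})"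
    unfolding dbl_enum_def by (metis image_image)
qed

locale real_operator_space =
  fixes E :: "('e::banach, real) dual_os"
  assumes operator_space: "operator_space E"
begin

lemma scale [simp]: "os_scale E = scaleR"
proof (intro ext)
  have "\<forall>r x. os_scale E (of_real r) x = r *\<^sub>R x"
    using operator_space unfolding operator_space_def by (elim conjE)
  then show "os_scale E r x = r *\<^sub>R x" for r x by simp
qed

lemma os_norm_cong:
  assumes "\<And>i j. i < n \<Longrightarrow> j < n \<Longrightarrow> x i j = y i j"
  shows "os_norm E n x = os_norm E n y"
proof -
  have "\<forall>n x y. (\<forall>i<n. \<forall>j<n. x i j = y i j) \<longrightarrow> os_norm E n x = os_norm E n y"
    using operator_space unfolding operator_space_def by (elim conjE)
  then show ?thesis using assms by blast
qed

lemma os_norm_nonneg: "0 \<le> os_norm E n x"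
proof -
  have "\<forall>n x. 0 \<le> os_norm E n x \<and> (os_norm E n x = 0 \<longleftrightarrow> (\<forall>i<n. \<forall>j<n. x i j = 0))"
    using operator_space unfolding operator_space_def by (elim conjE)
  then show ?thesis by blast
qed

lemma os_norm_ge: "\<exists>a>0. \<forall>x. a * norm x \<le> os_norm E 1 (\<lambda>_ _. x)"
proof -
  have "\<exists>a>0. \<exists>b. \<forall>x. a * norm x \<le> os_norm E 1 (\<lambda>_ _. x) \<and> os_norm E 1 (\<lambda>_ _. x) \<le> b * norm x"
    using operator_space unfolding operator_space_def by (elim conjE)
  then show ?thesis by blast
qed

lemma os_norm_sum:
  "os_norm E (n + p)
          (\<lambda>i j. if i < n \<and> j < n then x i j
                 else if n \<le> i \<and> n \<le> j then y (i - n) (j - n) else 0)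
        = max (os_norm E n x) (os_norm E p y)"
proof -
  have "\<forall>n p x y. os_norm E (n + p)
          (\<lambda>i j. if i < n \<and> j < n then x i j
                 else if n \<le> i \<and> n \<le> j then y (i - n) (j - n) else 0)
        = max (os_norm E n x) (os_norm E p y)"
    using operator_space unfolding operator_space_def by (elim conjE)
  then show ?thesis by blast
qed

lemma os_norm_sandwich_le:
  assumes \<alpha>: "op_bound {..<n} {..<p} \<alpha> a" and \<beta>: "op_bound {..<p} {..<n} \<beta> b"
  shows "os_norm E n (\<lambda>i j. \<Sum>k<p. \<Sum>l<p. (\<alpha> i k * \<beta> l j) *\<^sub>R x k l) \<le> a * os_norm E p x * b"
proof -
  have "\<forall>n p \<alpha> x \<beta>. os_norm E n (\<lambda>i j. \<Sum>k<p. \<Sum>l<p. os_scale E (\<alpha> i k * \<beta> l j) (x k l))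
        \<le> op_norm {..<n} {..<p} \<alpha> * os_norm E p x * op_norm {..<p} {..<n} \<beta>"
    using operator_space unfolding operator_space_def by (elim conjE)
  then have "os_norm E n (\<lambda>i j. \<Sum>k<p. \<Sum>l<p. (\<alpha> i k * \<beta> l j) *\<^sub>R x k l)
      \<le> op_norm {..<n} {..<p} \<alpha> * os_norm E p x * op_norm {..<p} {..<n} \<beta>" by simp
  also have "\<dots> \<le> a * os_norm E p x * b"
    using op_norm_le[OF \<alpha>] op_norm_le[OF \<beta>] op_bound_nonneg[OF op_bound_op_norm[OF \<beta>]]
      op_bound_nonneg[OF \<alpha>]
    by (intro mult_mono mult_right_mono mult_nonneg_nonneg os_norm_nonneg) auto
  finally show ?thesis .
qed

text \<open>Selecting rows and signed columns is multiplication by two partial injections of norm at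
  most 1. Rows and columns are enumerated independently because multiplication by i moves only the
  columns.\<close>

lemma os_norm_submatrix_le:
  fixes X :: "('a, 'a, 'e) mat" and h a b :: "nat \<Rightarrow> 'a"
  assumes h: "inj_on h {..<p}"
    and a: "inj_on a {..<n}" "a ` {..<n} \<subseteq> h ` {..<p}"
    and b: "inj_on b {..<n}" "b ` {..<n} \<subseteq> h ` {..<p}"
    and s: "\<And>j. \<bar>s j\<bar> \<le> 1"
  shows "os_norm E n (\<lambda>i j. s j *\<^sub>R X (a i) (b j)) \<le> os_norm E p (\<lambda>k l. X (h k) (h l))"
proof -
  \<comment> \<open>Row \<open>i\<close> picks the position at which \<open>h\<close> lists
    \<open>a i\<close>; below, column \<open>j\<close> of \<beta> does the same for
    \<open>b j\<close>, with the sign.\<close>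
  define \<alpha> where "\<alpha> = (\<lambda>i k. if h k = a i then 1 else (0::real))"
  define \<beta> where "\<beta> = (\<lambda>l j. if b j = h l then s j else (0::real))"
  have "op_bound {..<n} {..<p} \<alpha> 1"
    unfolding \<alpha>_def by (rule op_bound_partial_injection[OF a(1) h]) simp
  moreover have "op_bound {..<p} {..<n} \<beta> 1"
    unfolding \<beta>_def by (rule op_bound_partial_injection[OF h b(1)]) (rule s)
  ultimately have "os_norm E n (\<lambda>i j. \<Sum>k<p. \<Sum>l<p. (\<alpha> i k * \<beta> l j) *\<^sub>R X (h k) (h l))
      \<le> 1 * os_norm E p (\<lambda>k l. X (h k) (h l)) * 1"
    by (rule os_norm_sandwich_le)
  moreover have "os_norm E n (\<lambda>i j. \<Sum>k<p. \<Sum>l<p. (\<alpha> i k * \<beta> l j) *\<^sub>R X (h k) (h l)) =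
      os_norm E n (\<lambda>i j. s j *\<^sub>R X (a i) (b j))"
  proof (rule os_norm_cong)
    fix i j assume ij: "i < n" "j < n"
    have ai: "a i \<in> h ` {..<p}" and bj: "b j \<in> h ` {..<p}" using a(2) b(2) ij by auto
    obtain k0 where "a i = h k0" "k0 \<in> {..<p}" using ai by (rule imageE)
    then have k0: "k0 < p" "h k0 = a i" by simp_all
    obtain l0 where "b j = h l0" "l0 \<in> {..<p}" using bj by (rule imageE)
    then have l0: "l0 < p" "h l0 = b j" by simp_all
    have k: "\<alpha> i k = (if k = k0 then 1 else 0)" if "k < p" for k
      using inj_on_eq_iff[OF h, of k k0] that k0 by (simp add: \<alpha>_def)
    have l: "\<beta> l j = (if l = l0 then s j else 0)" if "l < p" for l
      using inj_on_eq_iff[OF h, of l0 l] that l0 by (auto simp: \<beta>_def)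
    have "(\<Sum>k<p. \<Sum>l<p. (\<alpha> i k * \<beta> l j) *\<^sub>R X (h k) (h l)) =
        (\<Sum>k<p. \<Sum>l<p. if l = l0 then (if k = k0 then s j *\<^sub>R X (h k0) (h l0) else 0) else 0)"
      by (intro sum.cong refl) (auto simp: k l)
    also have "\<dots> = s j *\<^sub>R X (a i) (b j)"
      using k0 l0 by (simp add: sum.delta)
    finally show "(\<Sum>k<p. \<Sum>l<p. (\<alpha> i k * \<beta> l j) *\<^sub>R X (h k) (h l)) = s j *\<^sub>R X (a i) (b j)" .
  qed
  ultimately show ?thesis by simp
qed

lemma sub_norm_le_mats_norm:
  assumes "x \<in> mats E I" "inj_on e {..<n}" "e ` {..<n} \<subseteq> I"
  shows "os_norm E n (\<lambda>i j. x (e i) (e j)) \<le> mats_norm E I x"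
  unfolding mats_norm_def
  by (rule cSup_upper) (use assms in \<open>auto simp: sub_norms_def mats_def\<close>)

lemma mats_norm_nonneg: "x \<in> mats E I \<Longrightarrow> 0 \<le> mats_norm E I x"
  using sub_norm_le_mats_norm[of x I undefined 0] os_norm_nonneg[of 0] by (force intro: order_trans)

text \<open>A weighted sum of entries is row times matrix times column, so Ruan's axiom bounds it.
  The constant comes from comparing the given norm with \<open>os_norm E 1\<close>; it depends on
  \<open>E\<close> alone and so is uniform over a bounded family.\<close>

lemma mats_form_bound:
  "\<exists>c\<ge>0. \<forall>(I :: 'a set) x. x \<in> mats E I \<longrightarrow> form_bound x (c * mats_norm E I x)"
proof -
  obtain a0 where a0: "0 < a0" "\<And>x. a0 * norm x \<le> os_norm E 1 (\<lambda>_ _. x)"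
    using os_norm_ge by blast
  have "form_bound x (1 / a0 * mats_norm E I x)" if x: "x \<in> mats E I" for I :: "'a set" and x
    unfolding form_bound_def
  proof (intro conjI allI impI)
    show "0 \<le> 1 / a0 * mats_norm E I x" using a0 mats_norm_nonneg[OF x] by simp
    fix F G :: "'a set" and a b :: "'a \<Rightarrow> real" assume FG: "finite F \<and> finite G"
    \<comment> \<open>Rows and columns must be listed by one enumeration inside \<open>I\<close>;
      the weights are extended by zero.\<close>
    define H where "H = (F \<union> G) \<inter> I"
    have H: "finite H" using FG by (simp add: H_def)
    obtain h where "bij_betw h {0..<card H} H" using ex_bij_betw_nat_finite[OF H] by blast
    then obtain p where h: "inj_on h {..<p::nat}" "h ` {..<p} = H"
      by (auto simp: bij_betw_def atLeast0LessThan)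
    define a' where "a' = (\<lambda>k. if h k \<in> F then a (h k) else 0)"
    define b' where "b' = (\<lambda>k. if h k \<in> G then b (h k) else 0)"
    define v where "v = (\<Sum>k\<in>F. \<Sum>l\<in>G. (a k * b l) *\<^sub>R x k l)"
    have supp: "x k l = 0" if "k \<notin> I \<or> l \<notin> I" for k l using x that by (simp add: mats_def)
    have "v = (\<Sum>k\<in>F\<inter>I. \<Sum>l\<in>G. (a k * b l) *\<^sub>R x k l)"
      unfolding v_def using FG by (intro sum.mono_neutral_right) (auto simp: supp)
    also have "\<dots> = (\<Sum>k\<in>F\<inter>I. \<Sum>l\<in>G\<inter>I. (a k * b l) *\<^sub>R x k l)"
      using FG by (intro sum.cong sum.mono_neutral_right) (auto simp: supp)
    also have "\<dots> = (\<Sum>k\<in>H. \<Sum>l\<in>G\<inter>I. ((if k \<in> F then a k else 0) * b l) *\<^sub>R x k l)"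
      using FG by (intro sum.mono_neutral_cong_left) (auto simp: H_def)
    also have "\<dots> = (\<Sum>k\<in>H. \<Sum>l\<in>H. ((if k \<in> F then a k else 0) * (if l \<in> G then b l else 0)) *\<^sub>R x k l)"
      using FG by (intro sum.cong sum.mono_neutral_cong_left) (auto simp: H_def)
    also have "\<dots> = (\<Sum>k<p. \<Sum>l<p. (a' k * b' l) *\<^sub>R x (h k) (h l))"
      unfolding h(2)[symmetric] by (simp add: sum.reindex[OF h(1)] a'_def b'_def)
    finally have v: "v = (\<Sum>k<p. \<Sum>l<p. (a' k * b' l) *\<^sub>R x (h k) (h l))" .
    have "a0 * norm v \<le> os_norm E 1 (\<lambda>_ _. v)" by (rule a0)
    also have "\<dots> \<le> sqrt (\<Sum>k<p. (a' k)\<^sup>2) * os_norm E p (\<lambda>k l. x (h k) (h l)) * sqrt (\<Sum>k<p. (b' k)\<^sup>2)"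
      unfolding v by (rule os_norm_sandwich_le[of 1 p "\<lambda>_. a'" _ "\<lambda>k _. b' k"]) (rule op_bound_row, simp)+
    also have "\<dots> \<le> sqrt (\<Sum>k\<in>F. (a k)\<^sup>2) * mats_norm E I x * sqrt (\<Sum>k\<in>G. (b k)\<^sup>2)"
    proof (intro mult_mono mult_nonneg_nonneg)
      have "(\<Sum>k<p. (a' k)\<^sup>2) = (\<Sum>k\<in>H. (if k \<in> F then a k else 0)\<^sup>2)"
        unfolding h(2)[symmetric] by (simp add: sum.reindex[OF h(1)] a'_def)
      also have "\<dots> = (\<Sum>k\<in>H\<inter>F. (a k)\<^sup>2)"
        using H by (intro sum.mono_neutral_cong_right) auto
      also have "\<dots> \<le> (\<Sum>k\<in>F. (a k)\<^sup>2)" using FG by (intro sum_mono2) auto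
      finally show "sqrt (\<Sum>k<p. (a' k)\<^sup>2) \<le> sqrt (\<Sum>k\<in>F. (a k)\<^sup>2)" by simp
      have "(\<Sum>k<p. (b' k)\<^sup>2) = (\<Sum>k\<in>H. (if k \<in> G then b k else 0)\<^sup>2)"
        unfolding h(2)[symmetric] by (simp add: sum.reindex[OF h(1)] b'_def)
      also have "\<dots> = (\<Sum>k\<in>H\<inter>G. (b k)\<^sup>2)"
        using H by (intro sum.mono_neutral_cong_right) auto
      also have "\<dots> \<le> (\<Sum>k\<in>G. (b k)\<^sup>2)" using FG by (intro sum_mono2) auto
      finally show "sqrt (\<Sum>k<p. (b' k)\<^sup>2) \<le> sqrt (\<Sum>k\<in>G. (b k)\<^sup>2)" by simp
      show "os_norm E p (\<lambda>k l. x (h k) (h l)) \<le> mats_norm E I x"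
        using h by (intro sub_norm_le_mats_norm[OF x]) (auto simp: H_def)
    qed (auto simp: sum_nonneg os_norm_nonneg mats_norm_nonneg[OF x])
    finally show "norm (\<Sum>k\<in>F. \<Sum>l\<in>G. (a k * b l) *\<^sub>R x k l) \<le>
        1 / a0 * mats_norm E I x * sqrt (\<Sum>k\<in>F. (a k)\<^sup>2) * sqrt (\<Sum>l\<in>G. (b l)\<^sup>2)"
      using a0(1) by (simp add: v_def field_simps)
  qed
  then show ?thesis using a0(1) by (intro exI[of _ "1 / a0"]) simp
qed

lemma os_norm_complexify:
  assumes d: "bij d"
  shows "os_norm (complexify E) n (\<lambda>i j. z (e i) (e j)) =
    os_norm E (2 * n) (\<lambda>i j. edbl d z (dbl_enum d n e i) (dbl_enum d n e j))"
proof -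
  have "cmat (\<lambda>i j. z (e i) (e j)) p q = cmat z (map_sum e e p) (map_sum e e q)" for p q
    by (cases p; cases q) (simp_all add: cmat_def)
  then show ?thesis
    using bij_is_inj[OF d] by (simp add: complexify_def edbl_cmat dbl_enum_def)
qed

text \<open>A finite submatrix of c(z) may use only one copy of an index. It sits inside the
  submatrix on both copies of a finite part of \<open>I\<close>, and the norm of that is by
  definition the complex norm of a submatrix of z.\<close>

lemma mats_complexify_dbl:
  fixes d :: "'a + 'a \<Rightarrow> 'a"
  assumes d: "bij d" and z: "z \<in> mats (complexify E) I"
  shows "edbl d z \<in> mats E (d ` (I <+> I))"
    and "mats_norm E (d ` (I <+> I)) (edbl d z) \<le> mats_norm (complexify E) I z"
proof -
  have "edbl d z \<in> mats E (d ` (I <+> I)) \<and>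
      mats_norm E (d ` (I <+> I)) (edbl d z) \<le> mats_norm (complexify E) I z"
  proof (rule sub_norm_le_bound)
    show "supported (d ` (I <+> I)) (d ` (I <+> I)) (edbl d z)"
      using mats_supported[OF z] by (simp add: complex_pair_prod.supported_dblmat[OF d])
    fix n :: nat and g :: "nat \<Rightarrow> 'a" assume g: "inj_on g {..<n}" "g ` {..<n} \<subseteq> d ` (I <+> I)"
    obtain F0 where F0: "finite F0" "g ` {..<n} \<subseteq> d ` (F0 <+> F0)"
      using finite_dbl_cover[OF d, of "g ` {..<n}"] by blast
    define F where "F = F0 \<inter> I"
    have F: "finite F" "F \<subseteq> I" using F0 by (auto simp: F_def)
    have gF: "g ` {..<n} \<subseteq> d ` (F <+> F)"
    proof
      fix p assume "p \<in> g ` {..<n}"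
      then have "p \<in> d ` (F0 <+> F0)" "p \<in> d ` (I <+> I)" using F0(2) g(2) by blast+
      then show "p \<in> d ` (F <+> F)"
        by (cases p rule: dbl_cases[OF d]) (auto simp: d F_def)
    qed
    obtain e where "bij_betw e {0..<card F} F" using ex_bij_betw_nat_finite[OF F(1)] by blast
    then obtain m where e: "inj_on e {..<m::nat}" "e ` {..<m} = F"
      by (auto simp: bij_betw_def atLeast0LessThan)
    have "os_norm E n (\<lambda>i j. edbl d z (g i) (g j)) = os_norm E n (\<lambda>i j. 1 *\<^sub>R edbl d z (g i) (g j))"
      by simp
    also have "\<dots> \<le> os_norm E (2 * m) (\<lambda>i j. edbl d z (dbl_enum d m e i) (dbl_enum d m e j))"
      using g gF dbl_enum[OF d e(1)] e(2) by (intro os_norm_submatrix_le) auto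
    also have "\<dots> = os_norm (complexify E) m (\<lambda>i j. z (e i) (e j))"
      by (rule os_norm_complexify[OF d, symmetric])
    also have "\<dots> \<le> mats_norm (complexify E) I z"
      unfolding mats_norm_def
      by (rule cSup_upper) (use e F z in \<open>auto simp: sub_norms_def mats_def\<close>)
    finally show "os_norm E n (\<lambda>i j. edbl d z (g i) (g j)) \<le> mats_norm (complexify E) I z" .
  qed
  then show "edbl d z \<in> mats E (d ` (I <+> I))"
    and "mats_norm E (d ` (I <+> I)) (edbl d z) \<le> mats_norm (complexify E) I z"
    by blast+
qed

text \<open>For the converse, the submatrix norms of z are among those of c(z), taken along
  \<open>dbl_enum\<close>.\<close>

lemma mats_complexify_iff:
  assumes d: "bij d"
  shows "z \<in> mats (complexify E) I \<longleftrightarrow> edbl d z \<in> mats E (d ` (I <+> I))"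
proof
  assume L: "edbl d z \<in> mats E (d ` (I <+> I))"
  have "sub_norms (complexify E) I z \<subseteq> sub_norms E (d ` (I <+> I)) (edbl d z)"
  proof
    fix t assume "t \<in> sub_norms (complexify E) I z"
    then obtain n e where e: "inj_on e {..<n::nat}" "e ` {..<n} \<subseteq> I"
      and t: "t = os_norm (complexify E) n (\<lambda>i j. z (e i) (e j))"
      by (auto simp: sub_norms_def)
    have "d ` (e ` {..<n} <+> e ` {..<n}) \<subseteq> d ` (I <+> I)" using e(2) by (intro image_mono) auto
    then have "dbl_enum d n e ` {..<2 * n} \<subseteq> d ` (I <+> I)" by (simp add: dbl_enum[OF d e(1)])
    then show "t \<in> sub_norms E (d ` (I <+> I)) (edbl d z)"
      unfolding sub_norms_def t os_norm_complexify[OF d]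
      using dbl_enum(1)[OF d e(1)] by blast
  qed
  moreover have "supported I I z"
    using mats_supported[OF L] by (simp add: complex_pair_prod.supported_dblmat[OF d])
  ultimately show "z \<in> mats (complexify E) I"
    using L by (auto simp: mats_def supported_def intro: bdd_above_mono)
qed (rule mats_complexify_dbl(1)[OF d])

text \<open>c(i z) = c(z) J arises from c(z) by exchanging the two halves of the columns and
  changing one sign, so \<open>os_norm_submatrix_le\<close> applies. It is needed to complexify real
  functionals.\<close>

lemma complexify_i_mult:
  fixes z :: "('a, 'a, 'e \<times> 'e) mat"
  assumes d: "bij (d :: 'a + 'a \<Rightarrow> 'a)" and z: "z \<in> mats (complexify E) I"
  shows "(\<lambda>i j. (- snd (z i j), fst (z i j))) \<in> mats (complexify E) I \<and>
    mats_norm (complexify E) I (\<lambda>i j. (- snd (z i j), fst (z i j))) \<le> mats_norm (complexify E) I z"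
proof (rule sub_norm_le_bound)
  let ?iz = "\<lambda>i j. (- snd (z i j), fst (z i j))"
  show "supported I I ?iz"
    using mats_supported[OF z] by (simp add: supported_def zero_prod_def)
  fix n :: nat and e :: "nat \<Rightarrow> 'a" assume e: "inj_on e {..<n}" "e ` {..<n} \<subseteq> I"
  define \<sigma> where "\<sigma> = (\<lambda>q. case inv d q of Inl j \<Rightarrow> d (Inr j) | Inr j \<Rightarrow> d (Inl j))"
  define s where "s = (\<lambda>q. case inv d q of Inl j \<Rightarrow> (1::real) | Inr j \<Rightarrow> - 1)"
  have inv: "inv d (d x) = x" for x using bij_is_inj[OF d] by simp
  have iz: "edbl d ?iz p q = s q *\<^sub>R edbl d z p (\<sigma> q)" for p q
    by (cases p rule: dbl_cases[OF d]; cases q rule: dbl_cases[OF d])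
      (simp_all add: d \<sigma>_def s_def inv)
  have \<sigma>\<sigma>: "\<sigma> (\<sigma> q) = q" for q
    by (cases q rule: dbl_cases[OF d]) (simp_all add: \<sigma>_def inv)
  then have inj: "inj \<sigma>" by (metis injI)
  let ?h = "dbl_enum d n e"
  note h = dbl_enum[OF d e(1)]
  have "\<sigma> ` d ` (F <+> F) \<subseteq> d ` (F <+> F)" for F
    by (auto simp: \<sigma>_def inv)
  then have sub: "(\<lambda>j. \<sigma> (?h j)) ` {..<2 * n} \<subseteq> ?h ` {..<2 * n}"
    using h(2) by (metis image_image)
  have "os_norm (complexify E) n (\<lambda>i j. ?iz (e i) (e j)) =
      os_norm E (2 * n) (\<lambda>i j. s (?h j) *\<^sub>R edbl d z (?h i) (\<sigma> (?h j)))"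
    by (simp add: os_norm_complexify[OF d, of n ?iz e] iz)
  also have "\<dots> \<le> os_norm E (2 * n) (\<lambda>i j. edbl d z (?h i) (?h j))"
  proof (rule os_norm_submatrix_le[OF h(1) h(1) order_refl _ sub])
    show "inj_on (\<lambda>j. \<sigma> (?h j)) {..<2 * n}"
      using h(1) inj by (auto simp: inj_on_def inj_def)
    show "\<bar>s (?h j)\<bar> \<le> 1" for j by (simp add: s_def split: sum.split)
  qed
  also have "\<dots> = os_norm (complexify E) n (\<lambda>i j. z (e i) (e j))"
    by (rule os_norm_complexify[OF d, symmetric])
  also have "\<dots> \<le> mats_norm (complexify E) I z"
    unfolding mats_norm_def
    by (rule cSup_upper) (use e z in \<open>auto simp: sub_norms_def mats_def\<close>)
  finally show "os_norm (complexify E) n (\<lambda>i j. ?iz (e i) (e j)) \<le> mats_norm (complexify E) I z" .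
qed

text \<open>A finite submatrix doubles to two equal diagonal blocks, and the direct sum axiom gives
  it the norm of one block.\<close>

lemma mats_eemb:
  assumes x: "x \<in> mats E I"
  shows "eemb x \<in> mats (complexify E) I \<and> mats_norm (complexify E) I (eemb x) \<le> mats_norm E I x"
proof (rule sub_norm_le_bound)
  show "supported I I (eemb x)" using mats_supported[OF x] by (simp add: supported_def zero_prod_def)
  fix n :: nat and e :: "nat \<Rightarrow> 'a" assume e: "inj_on e {..<n}" "e ` {..<n} \<subseteq> I"
  let ?x = "\<lambda>i j. x (e i) (e j)"
  have "os_norm (complexify E) n (\<lambda>i j. eemb x (e i) (e j)) =
      os_norm E (n + n) (\<lambda>i j. if i < n \<and> j < n then ?x i j
                 else if n \<le> i \<and> n \<le> j then ?x (i - n) (j - n) else 0)"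
    unfolding complexify_def dual_os.simps mult_2
    by (rule os_norm_cong) (auto simp: cmat_def split_nat_def)
  also have "\<dots> = os_norm E n ?x" using os_norm_sum[of n n ?x ?x] by simp
  also have "\<dots> \<le> mats_norm E I x" by (rule sub_norm_le_mats_norm[OF x e])
  finally show "os_norm (complexify E) n (\<lambda>i j. eemb x (e i) (e j)) \<le> mats_norm E I x" .
qed

end


section \<open>Weak* continuity\<close>

text \<open>The facts about a predual on which the weak* arguments rest; they are checked for
  scalars, \<open>E\<close> and \<open>complexify E\<close>.\<close>

definition predual_ok :: "('e::real_normed_vector, 'f::star_field) dual_os \<Rightarrow> 'a set \<Rightarrow> bool" where
  "predual_ok E I \<longleftrightarrow> (\<forall>x\<in>mats E I. 0 \<le> mats_norm E I x) \<and> (\<lambda>_. 0) \<in> os_predual E \<and>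
     (\<forall>\<phi>\<in>os_predual E. \<forall>\<psi>\<in>os_predual E. (\<lambda>x. \<phi> x + \<psi> x) \<in> os_predual E)"

text \<open>The zero functional belongs to the predual, so the whole space is itself a subbasic open
  set.\<close>

lemma topspace_weak_star:
  assumes "predual_ok E I"
  shows "topspace (weak_star E I) = mats E I"
proof -
  have "(\<lambda>_. 0) \<in> mats_predual E I"
    unfolding mats_predual_def
  proof (intro CollectI allI impI)
    fix \<epsilon> :: real assume "0 < \<epsilon>"
    then show "\<exists>F \<phi>. finite F \<and> F \<subseteq> I \<and> (\<forall>i j. \<phi> i j \<in> os_predual E) \<and>
        (\<forall>x\<in>mats E I. norm ((0::'b) - (\<Sum>i\<in>F. \<Sum>j\<in>F. \<phi> i j (x i j))) \<le> \<epsilon> * mats_norm E I x)"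
      using assms unfolding predual_ok_def
      by (intro exI[of _ "{}"] exI[of _ "\<lambda>_ _ _. 0"]) auto
  qed
  then have "mats E I \<in> {{x \<in> mats E I. \<Phi> x \<in> U} | \<Phi> U. \<Phi> \<in> mats_predual E I \<and> open U}"
    by (intro CollectI exI[of _ "\<lambda>_. 0"] exI[of _ UNIV]) auto
  then show ?thesis unfolding weak_star_def topology_generated_by_topspace by blast
qed

lemma openin_weak_star:
  assumes "\<Phi> \<in> mats_predual E I" "open U"
  shows "openin (weak_star E I) {x \<in> mats E I. \<Phi> x \<in> U}"
  unfolding weak_star_def by (rule topology_generated_by_Basis) (use assms in blast)

lemma continuous_map_weak_star:
  assumes "predual_ok E I" "\<Phi> \<in> mats_predual E I"
  shows "continuous_map (weak_star E I) euclidean \<Phi>"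
  unfolding continuous_map_def using assms openin_weak_star[OF assms(2)]
  by (auto simp: topspace_weak_star)

lemma continuous_map_into_weak_star:
  assumes "predual_ok E I"
    and "\<And>x. x \<in> topspace X \<Longrightarrow> T x \<in> mats E I"
    and "\<And>\<Phi>. \<Phi> \<in> mats_predual E I \<Longrightarrow> continuous_map X euclidean (\<lambda>x. \<Phi> (T x))"
  shows "continuous_map X (weak_star E I) T"
  unfolding weak_star_def continuous_on_generated_topo_iff
proof (intro conjI allI impI)
  fix V assume "V \<in> {{x \<in> mats E I. \<Phi> x \<in> U} | \<Phi> U. \<Phi> \<in> mats_predual E I \<and> open U}"
  then obtain \<Phi> U where V: "V = {x \<in> mats E I. \<Phi> x \<in> U}" "\<Phi> \<in> mats_predual E I" "open U" by blast
  have "T -` V \<inter> topspace X = {x \<in> topspace X. \<Phi> (T x) \<in> U}" using assms(2) by (auto simp: V)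
  then show "openin X (T -` V \<inter> topspace X)"
    using openin_continuous_map_preimage[OF assms(3)[OF V(2)], of U] V(3) by simp
next
  show "T ` topspace X \<subseteq> \<Union> {{x \<in> mats E I. \<Phi> x \<in> U} | \<Phi> U. \<Phi> \<in> mats_predual E I \<and> open U}"
    unfolding topspace_weak_star[OF assms(1), unfolded weak_star_def topology_generated_by_topspace]
    using assms(2) by auto
qed

lemma predual_sum:
  assumes "predual_ok E I" "\<And>p. p \<in> F \<Longrightarrow> \<phi> p \<in> os_predual E"
  shows "(\<lambda>w. \<Sum>p\<in>F. \<phi> p w) \<in> os_predual E"
  using assms(2) by (induction F rule: infinite_finite_induct) (use assms(1) in \<open>auto simp: predual_ok_def\<close>)

text \<open>A real functional on the complex space is the real part of the complex functional
  \<open>z \<mapsto> \<Phi> z - i \<Phi> (i z)\<close>.\<close>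

lemma continuous_map_weak_star_complex_to_real:
  fixes E :: "('e::real_normed_vector, real) dual_os"
    and E' :: "('c::real_normed_vector, complex) dual_os"
    and T :: "('b, 'b, 'c) mat \<Rightarrow> ('a, 'a, 'e) mat"
  assumes ok: "predual_ok E I" and ok': "predual_ok E' I'"
    and T: "\<And>z. z \<in> mats E' I' \<Longrightarrow> T z \<in> mats E I \<and> mats_norm E I (T z) \<le> mats_norm E' I' z"
    and ii: "\<And>z. z \<in> mats E' I' \<Longrightarrow> (\<lambda>i j. ii (z i j)) \<in> mats E' I' \<and>
        mats_norm E' I' (\<lambda>i j. ii (z i j)) \<le> mats_norm E' I' z"
    and hom: "\<And>\<phi> w. \<phi> \<in> os_predual E' \<Longrightarrow> \<phi> (ii w) = \<i> * \<phi> w"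
    and entry: "\<And>\<phi> p q. \<phi> \<in> os_predual E \<Longrightarrow>
        \<exists>\<phi>'\<in>os_predual E'. \<forall>z. \<phi> (T z p q) = Re (\<phi>' (z (b p) (b q)))"
    and b: "\<And>p. p \<in> I \<Longrightarrow> b p \<in> I'"
  shows "continuous_map (weak_star E' I') (weak_star E I) T"
proof (rule continuous_map_into_weak_star[OF ok])
  show "T z \<in> mats E I" if "z \<in> topspace (weak_star E' I')" for z
    using that T by (simp add: topspace_weak_star[OF ok'])
  fix \<Phi> assume \<Phi>: "\<Phi> \<in> mats_predual E I"
  define \<Psi> where "\<Psi> = (\<lambda>z. Complex (\<Phi> (T z)) (- \<Phi> (T (\<lambda>i j. ii (z i j)))))"
  have "\<Psi> \<in> mats_predual E' I'"
    unfolding mats_predual_def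
  proof (intro CollectI allI impI)
    fix \<epsilon> :: real assume \<epsilon>: "0 < \<epsilon>"
    \<comment> \<open>Half of \<open>\<epsilon>\<close> for each of the real and imaginary
      parts.\<close>
    have "\<exists>F \<phi>. finite F \<and> F \<subseteq> I \<and> (\<forall>i j. \<phi> i j \<in> os_predual E) \<and>
        (\<forall>x\<in>mats E I. norm (\<Phi> x - (\<Sum>i\<in>F. \<Sum>j\<in>F. \<phi> i j (x i j))) \<le> \<epsilon> / 2 * mats_norm E I x)"
      using \<Phi> half_gt_zero[OF \<epsilon>] unfolding mats_predual_def by blast
    then obtain F \<phi> where F: "finite F" "F \<subseteq> I" and \<phi>: "\<And>p q. \<phi> p q \<in> os_predual E"
      and approx: "\<And>x. x \<in> mats E I \<Longrightarrow>
        norm (\<Phi> x - (\<Sum>i\<in>F. \<Sum>j\<in>F. \<phi> i j (x i j))) \<le> \<epsilon> / 2 * mats_norm E I x"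
      by blast
    have "\<exists>\<phi>'. \<phi>' \<in> os_predual E' \<and> (\<forall>z. \<phi> p q (T z p q) = Re (\<phi>' (z (b p) (b q))))" for p q
      using entry[OF \<phi>[of p q]] by blast
    then obtain \<phi>' where \<phi>': "\<And>p q. \<phi>' p q \<in> os_predual E'"
      and \<phi>'_eq: "\<And>p q z. \<phi> p q (T z p q) = Re (\<phi>' p q (z (b p) (b q)))"
      by metis
    \<comment> \<open>Both copies of an index have the same image under \<open>b\<close>, so all
      functionals over one image position are added.\<close>
    define \<psi> where "\<psi> = (\<lambda>i j w. \<Sum>p\<in>{p\<in>F. b p = i}. \<Sum>q\<in>{q\<in>F. b q = j}. \<phi>' p q w)"
    have \<psi>: "\<psi> i j \<in> os_predual E'" for i j
      unfolding \<psi>_def by (intro predual_sum[OF ok'] \<phi>')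
    have sum_eq: "(\<Sum>i\<in>b ` F. \<Sum>j\<in>b ` F. \<psi> i j (z i j)) = (\<Sum>p\<in>F. \<Sum>q\<in>F. \<phi>' p q (z (b p) (b q)))" for z
    proof -
      have "(\<Sum>i\<in>b ` F. \<Sum>j\<in>b ` F. \<psi> i j (z i j)) =
          (\<Sum>i\<in>b ` F. \<Sum>p\<in>{p\<in>F. b p = i}. \<Sum>j\<in>b ` F. \<Sum>q\<in>{q\<in>F. b q = j}. \<phi>' p q (z (b p) (b q)))"
        unfolding \<psi>_def by (intro sum.cong refl, subst sum.swap) (auto intro!: sum.cong)
      also have "\<dots> = (\<Sum>p\<in>F. \<Sum>j\<in>b ` F. \<Sum>q\<in>{q\<in>F. b q = j}. \<phi>' p q (z (b p) (b q)))"
        by (rule sum.image_gen[OF F(1), symmetric])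
      also have "\<dots> = (\<Sum>p\<in>F. \<Sum>q\<in>F. \<phi>' p q (z (b p) (b q)))"
        by (intro sum.cong refl sum.image_gen[OF F(1), symmetric])
      finally show ?thesis .
    qed
    have "norm (\<Psi> z - (\<Sum>i\<in>b ` F. \<Sum>j\<in>b ` F. \<psi> i j (z i j))) \<le> \<epsilon> * mats_norm E' I' z" if z: "z \<in> mats E' I'" for z
    proof -
      let ?iz = "\<lambda>i j. ii (z i j)"
      define S where "S = (\<lambda>z. \<Sum>p\<in>F. \<Sum>q\<in>F. \<phi>' p q (z (b p) (b q)))"
      have Re: "\<bar>\<Phi> (T z) - Re (S z)\<bar> \<le> \<epsilon> / 2 * mats_norm E' I' z" if z: "z \<in> mats E' I'" for z
      proof -
        have "\<bar>\<Phi> (T z) - Re (S z)\<bar> \<le> \<epsilon> / 2 * mats_norm E I (T z)"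
          using approx[of "T z"] T[OF z] by (simp add: S_def \<phi>'_eq)
        also have "\<dots> \<le> \<epsilon> / 2 * mats_norm E' I' z"
          using T[OF z] \<epsilon> by (intro mult_left_mono) auto
        finally show ?thesis .
      qed
      \<comment> \<open>Hence the imaginary error at z is, up to sign, the real error at i z, and
        one estimate covers both.\<close>
      have "S ?iz = \<i> * S z"
        by (simp add: S_def hom[OF \<phi>'] sum_distrib_left)
      then have "Im (\<Psi> z - S z) = - (\<Phi> (T ?iz) - Re (S ?iz))" by (simp add: \<Psi>_def)
      moreover have "Re (\<Psi> z - S z) = \<Phi> (T z) - Re (S z)" by (simp add: \<Psi>_def)
      moreover have "\<epsilon> / 2 * mats_norm E' I' ?iz \<le> \<epsilon> / 2 * mats_norm E' I' z"
        using ii[OF z] \<epsilon> by (intro mult_left_mono) auto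
      ultimately have "cmod (\<Psi> z - S z) \<le> \<epsilon> * mats_norm E' I' z"
        using cmod_le[of "\<Psi> z - S z"] Re[OF z] Re[of ?iz] ii[OF z] by (simp add: abs_minus_commute)
      then show ?thesis by (simp add: sum_eq S_def)
    qed
    then show "\<exists>F \<phi>. finite F \<and> F \<subseteq> I' \<and> (\<forall>i j. \<phi> i j \<in> os_predual E') \<and>
        (\<forall>x\<in>mats E' I'. norm (\<Psi> x - (\<Sum>i\<in>F. \<Sum>j\<in>F. \<phi> i j (x i j))) \<le> \<epsilon> * mats_norm E' I' x)"
      using F b \<psi> by (intro exI[of _ "b ` F"] exI[of _ \<psi>]) auto
  qed
  then have "continuous_map (weak_star E' I') euclidean (Re \<circ> \<Psi>)"
    by (intro continuous_map_compose[OF continuous_map_weak_star[OF ok']])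
      (auto intro: continuous_intros)
  then show "continuous_map (weak_star E' I') euclidean (\<lambda>z. \<Phi> (T z))"
    by (simp add: \<Psi>_def o_def)
qed

text \<open>The real and imaginary parts of a complex functional, composed with \<open>h\<close>,
  are limits of finitely supported real functionals. \<open>B\<close> absorbs the growth of norm
  under \<open>h\<close>: 4 for scalars and 1 over \<open>E\<close>.\<close>

lemma continuous_map_weak_star_real_to_complex:
  fixes E :: "('e::real_normed_vector, real) dual_os"
    and E' :: "('c::real_normed_vector, complex) dual_os"
    and h :: "'e \<Rightarrow> 'c" and I :: "'a set"
  assumes ok: "predual_ok E I" and ok': "predual_ok E' I"
    and B: "0 < B"
    and T: "\<And>x. x \<in> mats E I \<Longrightarrow> (\<lambda>i j. h (x i j)) \<in> mats E' I \<and>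
        mats_norm E' I (\<lambda>i j. h (x i j)) \<le> B * mats_norm E I x"
    and Re: "\<And>\<phi>. \<phi> \<in> os_predual E' \<Longrightarrow> (\<lambda>x. Re (\<phi> (h x))) \<in> os_predual E"
    and Im: "\<And>\<phi>. \<phi> \<in> os_predual E' \<Longrightarrow> (\<lambda>x. Im (\<phi> (h x))) \<in> os_predual E"
  shows "continuous_map (weak_star E I) (weak_star E' I) (\<lambda>x i j. h (x i j))"
proof (rule continuous_map_into_weak_star[OF ok'])
  show "(\<lambda>i j. h (x i j)) \<in> mats E' I" if "x \<in> topspace (weak_star E I)" for x
    using that T by (simp add: topspace_weak_star[OF ok])
  fix \<Phi> assume \<Phi>: "\<Phi> \<in> mats_predual E' I"
  have part: "(\<lambda>x. r (\<Phi> (\<lambda>i j. h (x i j)))) \<in> mats_predual E I"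
    if r: "\<And>\<phi>. \<phi> \<in> os_predual E' \<Longrightarrow> (\<lambda>x. r (\<phi> (h x))) \<in> os_predual E"
      and lin: "\<And>z w. r (z - w) = r z - r w" "\<And>f (A :: 'a set). r (sum f A) = (\<Sum>a\<in>A. r (f a))"
      and le: "\<And>z. \<bar>r z\<bar> \<le> cmod z" for r :: "complex \<Rightarrow> real"
    unfolding mats_predual_def
  proof (intro CollectI allI impI)
    fix \<epsilon> :: real assume \<epsilon>: "0 < \<epsilon>"
    have "\<exists>F \<phi>. finite F \<and> F \<subseteq> I \<and> (\<forall>i j. \<phi> i j \<in> os_predual E') \<and>
        (\<forall>x\<in>mats E' I. norm (\<Phi> x - (\<Sum>i\<in>F. \<Sum>j\<in>F. \<phi> i j (x i j))) \<le> \<epsilon> / B * mats_norm E' I x)"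
      using \<Phi> divide_pos_pos[OF \<epsilon> B] unfolding mats_predual_def by blast
    then obtain F \<phi> where F: "finite F" "F \<subseteq> I" and \<phi>: "\<And>p q. \<phi> p q \<in> os_predual E'"
      and approx: "\<And>x. x \<in> mats E' I \<Longrightarrow>
        norm (\<Phi> x - (\<Sum>i\<in>F. \<Sum>j\<in>F. \<phi> i j (x i j))) \<le> \<epsilon> / B * mats_norm E' I x"
      by blast
    have "norm (r (\<Phi> (\<lambda>i j. h (x i j))) - (\<Sum>i\<in>F. \<Sum>j\<in>F. r (\<phi> i j (h (x i j))))) \<le> \<epsilon> * mats_norm E I x"
      if x: "x \<in> mats E I" for x
    proof -
      have eq: "r (\<Phi> (\<lambda>i j. h (x i j))) - (\<Sum>i\<in>F. \<Sum>j\<in>F. r (\<phi> i j (h (x i j)))) =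
          r (\<Phi> (\<lambda>i j. h (x i j)) - (\<Sum>i\<in>F. \<Sum>j\<in>F. \<phi> i j (h (x i j))))"
        by (simp only: lin)
      have "norm (r (\<Phi> (\<lambda>i j. h (x i j))) - (\<Sum>i\<in>F. \<Sum>j\<in>F. r (\<phi> i j (h (x i j)))))
          \<le> cmod (\<Phi> (\<lambda>i j. h (x i j)) - (\<Sum>i\<in>F. \<Sum>j\<in>F. \<phi> i j (h (x i j))))"
        unfolding eq real_norm_def by (rule le)
      also have "\<dots> \<le> \<epsilon> / B * mats_norm E' I (\<lambda>i j. h (x i j))"
        using T[OF x] by (intro approx) simp
      also have "\<dots> \<le> \<epsilon> / B * (B * mats_norm E I x)"
        using T[OF x] \<epsilon> B by (intro mult_left_mono) auto
      finally show ?thesis using B by simp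
    qed
    then show "\<exists>F \<phi>. finite F \<and> F \<subseteq> I \<and> (\<forall>i j. \<phi> i j \<in> os_predual E) \<and>
        (\<forall>x\<in>mats E I. norm (r (\<Phi> (\<lambda>i j. h (x i j))) - (\<Sum>i\<in>F. \<Sum>j\<in>F. \<phi> i j (x i j))) \<le> \<epsilon> * mats_norm E I x)"
      using F r[OF \<phi>] by (intro exI[of _ F] exI[of _ "\<lambda>i j x. r (\<phi> i j (h x))"]) auto
  qed
  have re: "continuous_map (weak_star E I) euclidean (\<lambda>x. Re (\<Phi> (\<lambda>i j. h (x i j))))"
    by (rule continuous_map_weak_star[OF ok part]) (simp_all add: Re abs_Re_le_cmod)
  have im: "continuous_map (weak_star E I) euclidean (\<lambda>x. Im (\<Phi> (\<lambda>i j. h (x i j))))"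
    by (rule continuous_map_weak_star[OF ok part]) (simp_all add: Im abs_Im_le_cmod)
  have "continuous_map (weak_star E I) (prod_topology euclidean euclidean)
      (\<lambda>x. (Re (\<Phi> (\<lambda>i j. h (x i j))), Im (\<Phi> (\<lambda>i j. h (x i j)))))"
    by (rule continuous_map_pairedI[OF re im])
  moreover have "continuous_map (prod_topology euclidean euclidean) euclidean (\<lambda>(x, y). Complex x y)"
    using linear_continuous_on[OF complex_pair_complex.mk_linear] by simp
  ultimately have "continuous_map (weak_star E I) euclidean
      ((\<lambda>(x, y). Complex x y) \<circ> (\<lambda>x. (Re (\<Phi> (\<lambda>i j. h (x i j))), Im (\<Phi> (\<lambda>i j. h (x i j))))))"
    by (rule continuous_map_compose)
  then show "continuous_map (weak_star E I) euclidean (\<lambda>x. \<Phi> (\<lambda>i j. h (x i j)))"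
    by (simp add: o_def)
qed

section \<open>Continuity of doubling and embedding on scalar matrices\<close>

definition dbl_base :: "('a + 'a \<Rightarrow> 'a) \<Rightarrow> 'a \<Rightarrow> 'a" where
  "dbl_base d p = (case inv d p of Inl i \<Rightarrow> i | Inr i \<Rightarrow> i)"

lemma dbl_base_simps [simp]:
  assumes "bij d"
  shows "dbl_base d (d (Inl i)) = i" "dbl_base d (d (Inr i)) = i"
  using assms by (simp_all add: dbl_base_def bij_is_inj)

lemma predual_ok_scalars: "predual_ok (scalars :: ('f::star_field, 'f) dual_os) I"
  unfolding predual_ok_def
proof (intro conjI ballI)
  show "0 \<le> mats_norm scalars I x" if "x \<in> mats scalars I" for x :: "('a, 'a, 'f) mat"
    using op_bound_nonneg[OF op_bound_UNIV_mats_norm[OF that]] .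
  have pre: "(\<lambda>x. c * x) \<in> os_predual (scalars :: ('f, 'f) dual_os)" for c
    by (simp add: scalars_def)
  show "(\<lambda>_. 0) \<in> os_predual (scalars :: ('f, 'f) dual_os)"
    using pre[of 0] by simp
  show "(\<lambda>x. \<phi> x + \<psi> x) \<in> os_predual (scalars :: ('f, 'f) dual_os)"
    if \<phi>\<psi>: "\<phi> \<in> os_predual scalars" "\<psi> \<in> os_predual scalars" for \<phi> \<psi> :: "'f \<Rightarrow> 'f"
  proof -
    obtain a b where "\<phi> = (\<lambda>x. a * x)" "\<psi> = (\<lambda>x. b * x)"
      using \<phi>\<psi> by (auto simp: scalars_def)
    then show ?thesis using pre[of "a + b"] by (simp add: distrib_right)
  qed
qed

lemma mats_scalars_cdbl:
  assumes d: "bij d" and z: "z \<in> mats scalars I"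
  shows "cdbl d z \<in> mats scalars (d ` (I <+> I)) \<and>
    mats_norm scalars (d ` (I <+> I)) (cdbl d z) \<le> mats_norm scalars I z"
proof
  note b = op_bound_cdbl[OF d op_bound_UNIV_mats_norm[OF z]]
  show "cdbl d z \<in> mats scalars (d ` (I <+> I))"
    using b mats_supported[OF z] by (auto simp: mats_scalars_iff complex_pair_complex.supported_dblmat[OF d])
  show "mats_norm scalars (d ` (I <+> I)) (cdbl d z) \<le> mats_norm scalars I z"
    using mats_supported[OF z]
    by (intro mats_norm_scalars_le_UNIV[OF _ b]) (simp add: complex_pair_complex.supported_dblmat[OF d])
qed

lemma mats_scalars_cdbl_iff:
  assumes d: "bij d"
  shows "cdbl d z \<in> mats scalars (d ` (I <+> I)) \<longleftrightarrow> z \<in> mats scalars I"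
proof
  assume L: "cdbl d z \<in> mats scalars (d ` (I <+> I))"
  then obtain C where "op_bound UNIV UNIV (cdbl d z) C" by (auto simp: mats_scalars_iff)
  then have "op_bound UNIV UNIV z (2 * C)" by (rule op_bound_of_cdbl[OF d])
  moreover have "supported I I z"
    using mats_supported[OF L] by (simp add: complex_pair_complex.supported_dblmat[OF d])
  ultimately show "z \<in> mats scalars I" by (auto simp: mats_scalars_iff)
qed (simp add: mats_scalars_cdbl[OF d])

lemma mats_scalars_cemb:
  assumes x: "x \<in> mats scalars I"
  shows "cemb x \<in> mats scalars I \<and> mats_norm scalars I (cemb x) \<le> 4 * mats_norm scalars I x"
proof
  note b = op_bound_cemb[OF op_bound_UNIV_mats_norm[OF x]]
  show "cemb x \<in> mats scalars I"
    using b mats_supported[OF x] by (auto simp: mats_scalars_iff supported_def)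
  show "mats_norm scalars I (cemb x) \<le> 4 * mats_norm scalars I x"
    using mats_supported[OF x] by (intro mats_norm_scalars_le_UNIV[OF _ b]) (simp add: supported_def)
qed

lemma mats_scalars_cemb_iff: "cemb x \<in> mats scalars I \<longleftrightarrow> x \<in> mats scalars I"
proof
  assume L: "cemb x \<in> mats scalars I"
  then obtain C where "op_bound UNIV UNIV (cemb x) C" by (auto simp: mats_scalars_iff)
  then have "op_bound UNIV UNIV x C" by (rule op_bound_of_cemb)
  moreover have "supported I I x" using mats_supported[OF L] by (simp add: supported_def)
  ultimately show "x \<in> mats scalars I" by (auto simp: mats_scalars_iff)
qed (simp add: mats_scalars_cemb)

lemma continuous_map_cdbl:
  fixes d :: "'a + 'a \<Rightarrow> 'a"
  assumes d: "bij d"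
  shows "continuous_map (weak_star scalars I) (weak_star scalars (d ` (I <+> I))) (cdbl d)"
proof (rule continuous_map_weak_star_complex_to_real[where ii = "\<lambda>w. \<i> * w" and b = "dbl_base d"])
  show "(\<lambda>i j. \<i> * z i j) \<in> mats scalars I \<and>
      mats_norm scalars I (\<lambda>i j. \<i> * z i j) \<le> mats_norm scalars I z"
    if z: "z \<in> mats scalars I" for z
  proof -
    have "op_bound UNIV UNIV (\<lambda>i j. \<i> * z i j) (mats_norm scalars I z)"
      unfolding op_bound_def
    proof (intro conjI allI impI)
      show "0 \<le> mats_norm scalars I z" using op_bound_nonneg[OF op_bound_UNIV_mats_norm[OF z]] .
      fix F G :: "'a set" and \<eta> \<xi> :: "'a \<Rightarrow> complex"
      assume FG: "finite F \<and> F \<subseteq> UNIV \<and> finite G \<and> G \<subseteq> UNIV"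
      have "(\<Sum>i\<in>F. \<Sum>j\<in>G. star (\<eta> i) * (\<i> * z i j) * \<xi> j) =
          (\<Sum>i\<in>F. \<Sum>j\<in>G. star (\<eta> i) * z i j * (\<i> * \<xi> j))"
        by (simp add: mult_ac)
      then show "norm (\<Sum>i\<in>F. \<Sum>j\<in>G. star (\<eta> i) * (\<i> * z i j) * \<xi> j) \<le>
          mats_norm scalars I z * sqrt (\<Sum>i\<in>F. (norm (\<eta> i))\<^sup>2) * sqrt (\<Sum>j\<in>G. (norm (\<xi> j))\<^sup>2)"
        using op_boundD[OF op_bound_UNIV_mats_norm[OF z], of F G \<eta> "\<lambda>j. \<i> * \<xi> j"] FG
        by (simp add: norm_mult)
    qed
    moreover have "supported I I (\<lambda>i j. \<i> * z i j)" using mats_supported[OF z] by (simp add: supported_def)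
    ultimately show ?thesis
      using mats_norm_scalars_le_UNIV by (auto simp: mats_scalars_iff)
  qed
  show "\<phi> (\<i> * w) = \<i> * \<phi> w" if "\<phi> \<in> os_predual (scalars :: (complex, complex) dual_os)" for \<phi> w
    using that by (auto simp: scalars_def)
  show "\<exists>\<phi>'\<in>os_predual (scalars :: (complex, complex) dual_os).
      \<forall>z. \<phi> (cdbl d z p q) = Re (\<phi>' (z (dbl_base d p) (dbl_base d q)))"
    if \<phi>: "\<phi> \<in> os_predual (scalars :: (real, real) dual_os)" for \<phi> p q
  proof -
    obtain c where c: "\<phi> = (\<lambda>x. c * x)" using \<phi> by (auto simp: scalars_def)
    have pre: "(\<lambda>w. a * w) \<in> os_predual (scalars :: (complex, complex) dual_os)" for a
      by (simp add: scalars_def)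
    show ?thesis
      \<comment> \<open>The real parts of c w, i c w and -i c w are c times Re w, -Im w and Im w,
        the entries of the four blocks.\<close>
      using pre[of "complex_of_real c"] pre[of "\<i> * complex_of_real c"] pre[of "- \<i> * complex_of_real c"]
      by (cases p rule: dbl_cases[OF d]; cases q rule: dbl_cases[OF d]) (force simp: d c)+
  qed
qed (auto intro: predual_ok_scalars simp: mats_scalars_cdbl[OF d] d)

lemma continuous_map_cemb:
  "continuous_map (weak_star scalars I) (weak_star scalars I) (\<lambda>x. cemb x)"
proof (rule continuous_map_weak_star_real_to_complex[where B = 4])
  show "(\<lambda>x. Re (\<phi> (complex_of_real x))) \<in> os_predual scalars"
    "(\<lambda>x. Im (\<phi> (complex_of_real x))) \<in> os_predual scalars"
    if "\<phi> \<in> os_predual scalars" for \<phi>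
    using that by (auto simp: scalars_def)
qed (auto intro: predual_ok_scalars simp: mats_scalars_cemb)

section \<open>Continuity of doubling and embedding over a dual operator space\<close>

locale real_dual_operator_space =
  fixes E :: "('e::banach, real) dual_os"
  assumes dual_operator_space: "dual_operator_space E"

sublocale real_dual_operator_space \<subseteq> real_operator_space E
  by standard (use dual_operator_space in \<open>simp add: dual_operator_space_def\<close>)

context real_dual_operator_space
begin

lemma predual_zero: "(\<lambda>_. 0) \<in> os_predual E"
  using dual_operator_space unfolding dual_operator_space_def by (elim conjE)

lemma predual_add:
  assumes "\<phi> \<in> os_predual E" "\<psi> \<in> os_predual E"
  shows "(\<lambda>x. \<phi> x + \<psi> x) \<in> os_predual E"
proof -
  have "\<forall>\<phi>\<in>os_predual E. \<forall>\<psi>\<in>os_predual E. (\<lambda>x. \<phi> x + \<psi> x) \<in> os_predual E"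
    using dual_operator_space unfolding dual_operator_space_def by (elim conjE)
  then show ?thesis using assms by blast
qed

lemma predual_linear:
  assumes "\<phi> \<in> os_predual E"
  shows "\<phi> (r *\<^sub>R x) = r * \<phi> x" "\<phi> (- x) = - \<phi> x" "\<phi> 0 = 0"
proof -
  have "\<forall>\<phi>\<in>os_predual E.
        (\<forall>x y. \<phi> (x + y) = \<phi> x + \<phi> y) \<and> (\<forall>c x. \<phi> (os_scale E c x) = c * \<phi> x) \<and>
        (\<exists>C. \<forall>x. norm (\<phi> x) \<le> C * norm x)"
    using dual_operator_space unfolding dual_operator_space_def by (elim conjE)
  then have *: "\<phi> (r *\<^sub>R x) = r * \<phi> x" for r x using assms by simp
  show "\<phi> (r *\<^sub>R x) = r * \<phi> x" "\<phi> (- x) = - \<phi> x" "\<phi> 0 = 0"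
    using *[of r x] *[of "- 1" x] *[of 0 0] by simp_all
qed

lemma predual_uminus:
  assumes "\<phi> \<in> os_predual E"
  shows "(\<lambda>x. - \<phi> x) \<in> os_predual E"
proof -
  have "\<forall>c. \<forall>\<phi>\<in>os_predual E. (\<lambda>x. c * \<phi> x) \<in> os_predual E"
    using dual_operator_space unfolding dual_operator_space_def by (elim conjE)
  then have "(\<lambda>x. (- 1) * \<phi> x) \<in> os_predual E" using assms by blast
  then show ?thesis by simp
qed

text \<open>The complex functional \<phi> + i \<psi> evaluated at x + i y.\<close>

definition cpredual :: "('e \<Rightarrow> real) \<Rightarrow> ('e \<Rightarrow> real) \<Rightarrow> 'e \<times> 'e \<Rightarrow> complex" where
  "cpredual \<phi> \<psi> = (\<lambda>(x, y). Complex (\<phi> x - \<psi> y) (\<phi> y + \<psi> x))"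

lemma complexify_predual:
  "os_predual (complexify E) = {cpredual \<phi> \<psi> | \<phi> \<psi>. \<phi> \<in> os_predual E \<and> \<psi> \<in> os_predual E}"
  by (simp add: complexify_def cpredual_def)

lemma predual_ok_E: "predual_ok E I"
  by (auto simp: predual_ok_def mats_norm_nonneg predual_zero predual_add)

lemma predual_ok_complexify:
  fixes I :: "'a set"
  assumes d: "bij (d :: 'a + 'a \<Rightarrow> 'a)"
  shows "predual_ok (complexify E) I"
  unfolding predual_ok_def
proof (intro conjI ballI)
  show "0 \<le> mats_norm (complexify E) I z" if "z \<in> mats (complexify E) I" for z
    using mats_norm_nonneg[OF mats_complexify_dbl(1)[OF d that]] mats_complexify_dbl(2)[OF d that] by simp
  have "(\<lambda>_. 0) = cpredual (\<lambda>_. 0) (\<lambda>_. 0)" by (auto simp: cpredual_def complex_eq_iff)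
  then show "(\<lambda>_. 0) \<in> os_predual (complexify E)" using predual_zero unfolding complexify_predual by blast
  fix \<Phi> \<Psi> assume "\<Phi> \<in> os_predual (complexify E)" "\<Psi> \<in> os_predual (complexify E)"
  then obtain \<phi>1 \<phi>2 \<psi>1 \<psi>2 where *: "\<Phi> = cpredual \<phi>1 \<phi>2" "\<Psi> = cpredual \<psi>1 \<psi>2"
      "\<phi>1 \<in> os_predual E" "\<phi>2 \<in> os_predual E" "\<psi>1 \<in> os_predual E" "\<psi>2 \<in> os_predual E"
    unfolding complexify_predual by blast
  have "(\<lambda>x. \<Phi> x + \<Psi> x) = cpredual (\<lambda>x. \<phi>1 x + \<psi>1 x) (\<lambda>x. \<phi>2 x + \<psi>2 x)"
    by (auto simp: * cpredual_def complex_eq_iff)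
  then show "(\<lambda>x. \<Phi> x + \<Psi> x) \<in> os_predual (complexify E)"
    using predual_add * unfolding complexify_predual by blast
qed

lemma continuous_map_edbl:
  fixes d :: "'a + 'a \<Rightarrow> 'a"
  assumes d: "bij d"
  shows "continuous_map (weak_star (complexify E) I) (weak_star E (d ` (I <+> I))) (edbl d)"
proof (rule continuous_map_weak_star_complex_to_real[where ii = "\<lambda>w. (- snd w, fst w)" and b = "dbl_base d"])
  show "\<phi> (- snd w, fst w) = \<i> * \<phi> w" if "\<phi> \<in> os_predual (complexify E)" for \<phi> w
    using that predual_linear unfolding complexify_predual
    by (auto simp: cpredual_def complex_eq_iff split: prod.split)
  show "\<exists>\<phi>'\<in>os_predual (complexify E). \<forall>z. \<phi> (edbl d z p q) = Re (\<phi>' (z (dbl_base d p) (dbl_base d q)))"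
    if \<phi>: "\<phi> \<in> os_predual E" for \<phi> p q
  proof -
    \<comment> \<open>The functionals \<phi>, i \<phi> and -i \<phi>, whose real parts give the
      entries of the four blocks.\<close>
    have "cpredual \<phi> (\<lambda>_. 0) \<in> os_predual (complexify E)" "cpredual (\<lambda>_. 0) \<phi> \<in> os_predual (complexify E)"
      "cpredual (\<lambda>_. 0) (\<lambda>x. - \<phi> x) \<in> os_predual (complexify E)"
      unfolding complexify_predual using \<phi> predual_zero predual_uminus by blast+
    moreover have "Re (cpredual \<phi> (\<lambda>_. 0) w) = \<phi> (fst w)" "Re (cpredual (\<lambda>_. 0) \<phi> w) = - \<phi> (snd w)"
      "Re (cpredual (\<lambda>_. 0) (\<lambda>x. - \<phi> x) w) = \<phi> (snd w)" for w
      by (simp_all add: cpredual_def split: prod.split)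
    ultimately show ?thesis
      using predual_linear(2)[OF \<phi>]
      by (cases p rule: dbl_cases[OF d]; cases q rule: dbl_cases[OF d]) (simp_all add: d, metis+)
  qed
qed (auto intro: predual_ok_E predual_ok_complexify[OF d]
    simp: mats_complexify_dbl[OF d] complexify_i_mult[OF d] d)

lemma continuous_map_eemb:
  fixes I :: "'a set"
  assumes d: "bij (d :: 'a + 'a \<Rightarrow> 'a)"
  shows "continuous_map (weak_star E I) (weak_star (complexify E) I) (\<lambda>x. eemb x)"
proof (rule continuous_map_weak_star_real_to_complex[where B = 1])
  show "(\<lambda>x. Re (\<phi> (x, 0))) \<in> os_predual E" "(\<lambda>x. Im (\<phi> (x, 0))) \<in> os_predual E"
    if "\<phi> \<in> os_predual (complexify E)" for \<phi>
  proof -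
    obtain \<phi>1 \<phi>2 where \<phi>: "\<phi> = cpredual \<phi>1 \<phi>2" "\<phi>1 \<in> os_predual E" "\<phi>2 \<in> os_predual E"
      using \<open>\<phi> \<in> _\<close> unfolding complexify_predual by blast
    then show "(\<lambda>x. Re (\<phi> (x, 0))) \<in> os_predual E" "(\<lambda>x. Im (\<phi> (x, 0))) \<in> os_predual E"
      by (simp_all add: cpredual_def predual_linear(3)[OF \<phi>(2)] predual_linear(3)[OF \<phi>(3)])
  qed
qed (auto intro: predual_ok_E predual_ok_complexify[OF d] simp: mats_eemb)

end


section \<open>Direct sums, the rotation and the matrix u\<close>

text \<open>An infinite cardinal equals its double, so the choice in \<open>dbl\<close> has a
  witness.\<close>

lemma bij_dbl:
  assumes "infinite (UNIV :: 'k set)"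
  shows "bij (dbl :: 'k + 'k \<Rightarrow> 'k)"
proof -
  have "\<exists>e. bij_betw e (UNIV <+> UNIV :: ('k + 'k) set) (UNIV :: 'k set)"
    using card_of_Plus_infinite[OF assms card_of_mono1[OF subset_UNIV]] card_of_ordIso by blast
  then have "\<exists>e :: 'k + 'k \<Rightarrow> 'k. bij e" by (simp add: UNIV_Plus_UNIV)
  then show ?thesis unfolding dbl_def by (rule someI_ex)
qed

lemma form_bound_mono: "form_bound M C \<Longrightarrow> C \<le> D \<Longrightarrow> form_bound M D"
  unfolding form_bound_def
  by (fastforce intro: order_trans mult_right_mono simp: sum_nonneg)

lemma scale_scalars: "os_scale (scalars :: ('f::star_field, 'f) dual_os) = (*)"
  by (simp add: scalars_def)

lemma scale_scalars_real: "os_scale (scalars :: (real, real) dual_os) = scaleR"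
  by (auto simp: scalars_def fun_eq_iff)

lemma scale_complexify:
  "os_scale (complexify E) = (\<lambda>c (x, y). (Re c *\<^sub>R x - Im c *\<^sub>R y, Im c *\<^sub>R x + Re c *\<^sub>R y))"
  by (simp add: complexify_def)

text \<open>Each summand is handled by \<open>dblmat_sandwich\<close>; the common bound
  \<open>C\<close> and the summable row norms then allow the series over \<open>s\<close> to be
  taken blockwise.\<close>

lemma (in complex_pair) dblmat_direct_sum:
  assumes d: "bij d" and E: "os_scale E = scaleR" and E': "os_scale E' = scl"
    and z: "\<And>s. s \<in> S \<Longrightarrow> form_bound (dblmat d re im (z s)) C"
    and rows: "\<And>s p. s \<in> S \<Longrightarrow> sq_summable (cdbl d (\<alpha> s) p)"
    and summ: "\<And>p. (\<lambda>s. \<Sum>\<^sub>\<infinity>k. (cdbl d (\<alpha> s) p k)\<^sup>2) summable_on S"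
  shows "direct_sum E S (\<lambda>s. cdbl d (\<alpha> s)) (\<lambda>s. dblmat d re im (z s)) =
    dblmat d re im (direct_sum E' S \<alpha> z)"
proof -
  define w where "w = (\<lambda>s. sandwich E' (\<alpha> s) (z s) (madj (\<alpha> s)))"
  have cols: "sq_summable (\<lambda>l. cdbl d (madj (\<alpha> s)) l q)" if "s \<in> S" for s q
    unfolding madj_cdbl[OF d, symmetric] using rows[OF that, of q] by (simp add: madj_def[of "cdbl d (\<alpha> s)"])
  have w: "sandwich E (cdbl d (\<alpha> s)) (dblmat d re im (z s)) (madj (cdbl d (\<alpha> s))) = dblmat d re im (w s)"
    if "s \<in> S" for s
    unfolding w_def madj_cdbl[OF d]
    by (rule dblmat_sandwich[OF d E E' z[OF that] rows[OF that] cols[OF that]])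
  have "(\<lambda>s. dblmat d re im (w s) p q) summable_on S" for p q
  proof -
    have "(\<lambda>s. \<Sum>\<^sub>\<infinity>k. cdbl d (\<alpha> s) p k *\<^sub>R (\<Sum>\<^sub>\<infinity>l. cdbl d (\<alpha> s) q l *\<^sub>R dblmat d re im (z s) k l)) summable_on S"
      \<comment> \<open>Rows serve on both sides, since the right factor is the adjoint and its
        columns are rows of \<alpha>.\<close>
      by (rule direct_sum_summable[OF z rows rows summ summ])
    then show ?thesis
      by (rule summable_on_cong[THEN iffD1, rotated])
        (simp add: w[symmetric] sandwich_def E madj_def)
  qed
  from dblmat_infsum[OF d this]
  have "(\<lambda>p q. \<Sum>\<^sub>\<infinity>s\<in>S. dblmat d re im (w s) p q) = dblmat d re im (direct_sum E' S \<alpha> z)"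
    by (simp add: w_def direct_sum_def)
  moreover have "direct_sum E S (\<lambda>s. cdbl d (\<alpha> s)) (\<lambda>s. dblmat d re im (z s)) =
      (\<lambda>p q. \<Sum>\<^sub>\<infinity>s\<in>S. dblmat d re im (w s) p q)"
    unfolding direct_sum_def by (intro ext infsum_cong) (simp add: w)
  ultimately show ?thesis by simp
qed

text \<open>Removes every convergence question for J, u and the inclusions of the halves, whose rows
  and columns have one or two nonzero entries.\<close>

lemma sandwich_finite_support:
  assumes zero: "\<And>y. os_scale E 0 y = 0"
    and A: "finite A" "\<And>k. k \<notin> A \<Longrightarrow> \<alpha> p k = 0"
    and B: "finite B" "\<And>l. l \<notin> B \<Longrightarrow> \<beta> l q = 0"
  shows "sandwich E \<alpha> x \<beta> p q = (\<Sum>k\<in>A. os_scale E (\<alpha> p k) (\<Sum>l\<in>B. os_scale E (\<beta> l q) (x k l)))"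
proof -
  have inner: "(\<Sum>\<^sub>\<infinity>l. os_scale E (\<beta> l q) (x k l)) = (\<Sum>l\<in>B. os_scale E (\<beta> l q) (x k l))" for k
    unfolding infsum_finite[OF B(1), symmetric]
    by (rule infsum_cong_neutral) (use B zero in auto)
  show ?thesis
    unfolding sandwich_def inner infsum_finite[OF A(1), symmetric]
    by (rule infsum_cong_neutral) (use A zero in auto)
qed

lemma infsum_Pair_0:
  fixes f :: "'i \<Rightarrow> 'e::real_normed_vector"
  shows "(\<Sum>\<^sub>\<infinity>x\<in>A. (f x, 0 :: 'e)) = (infsum f A, 0)"
proof (rule infsum_bounded_linear_strong)
  show lin: "bounded_linear (\<lambda>x :: 'e. (x, 0 :: 'e))"
    by (intro bounded_linear_Pair bounded_linear_ident bounded_linear_zero)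
  show "(\<lambda>x. (f x, 0 :: 'e)) summable_on A \<longleftrightarrow> f summable_on A"
    by (rule summable_on_bounded_linear_iff[OF lin bounded_linear_fst]) simp
qed

lemma madj_cemb: "madj (cemb \<alpha>) = cemb (madj \<alpha>)"
  by (simp add: madj_def)

lemma ampl_cemb: "ampl (cemb \<alpha>) = cemb (ampl \<alpha>)"
  by (auto simp: ampl_def fun_eq_iff)

lemma sandwich_cemb:
  "sandwich scalars (cemb \<alpha>) (cemb x) (cemb \<beta>) = cemb (sandwich scalars \<alpha> x \<beta>)"
  by (simp add: sandwich_def scale_scalars of_real_mult[symmetric] infsum_complex_of_real del: of_real_mult)

lemma direct_sum_cemb:
  "direct_sum scalars S (\<lambda>s. cemb (\<alpha> s)) (\<lambda>s. cemb (x s)) = cemb (direct_sum scalars S \<alpha> x)"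
  by (simp add: direct_sum_def madj_cemb sandwich_cemb infsum_complex_of_real)

lemma (in real_operator_space) sandwich_eemb:
  "sandwich (complexify E) (cemb \<alpha>) (eemb x) (cemb \<beta>) = eemb (sandwich E \<alpha> x \<beta>)"
  by (simp add: sandwich_def scale_complexify infsum_Pair_0)

lemma (in real_operator_space) direct_sum_eemb:
  "direct_sum (complexify E) S (\<lambda>s. cemb (\<alpha> s)) (\<lambda>s. eemb (x s)) = eemb (direct_sum E S \<alpha> x)"
  by (simp add: direct_sum_def madj_cemb sandwich_eemb infsum_Pair_0)

text \<open>The rotation \<open>J\<close> with \<open>J c(z) J\<^sup>* = c(z)\<close>.\<close>

definition dbl_swap :: "('a + 'a \<Rightarrow> 'a) \<Rightarrow> 'a \<Rightarrow> 'a" where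
  "dbl_swap d p = (case inv d p of Inl i \<Rightarrow> d (Inr i) | Inr i \<Rightarrow> d (Inl i))"

definition dbl_rot :: "('a + 'a \<Rightarrow> 'a) \<Rightarrow> 'a set \<Rightarrow> ('a, 'a, real) mat" where
  "dbl_rot d I = (\<lambda>p q. if dbl_swap d q = p then
     (case inv d p of Inl i \<Rightarrow> if i \<in> I then - 1 else 0 | Inr i \<Rightarrow> if i \<in> I then 1 else 0) else 0)"

lemma dbl_swap_simps [simp]:
  assumes "bij d"
  shows "dbl_swap d (d (Inl i)) = d (Inr i)" "dbl_swap d (d (Inr i)) = d (Inl i)"
  using assms by (simp_all add: dbl_swap_def bij_is_inj)

lemma dbl_swap_swap [simp]:
  assumes d: "bij d"
  shows "dbl_swap d (dbl_swap d p) = p"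
  by (cases p rule: dbl_cases[OF d]) (simp_all add: d)

lemma dbl_rot_eq:
  assumes d: "bij d"
  shows "dbl_rot d I p q = 0 \<or> p = dbl_swap d q"
    and "dbl_rot d I (d (Inl i)) (d (Inr i)) = (if i \<in> I then - 1 else 0)"
    and "dbl_rot d I (d (Inr i)) (d (Inl i)) = (if i \<in> I then 1 else 0)"
  using d by (auto simp: dbl_rot_def bij_is_inj)

text \<open>A signed permutation of the doubled set: each entry of the two products is a series with
  at most one nonzero term.\<close>

lemma unitary_dbl_rot:
  assumes d: "bij d"
  shows "unitary_mat (d ` (I <+> I)) (dbl_rot d I)"
proof -
  have zero: "dbl_rot d I p q = 0" if "q \<noteq> dbl_swap d p" for p q
    using dbl_rot_eq(1)[OF d, of I p q] that d by auto
  have supp: "supported (d ` (I <+> I)) (d ` (I <+> I)) (dbl_rot d I)"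
    unfolding supported_def
  proof (intro allI impI)
    fix p q assume *: "p \<notin> d ` (I <+> I) \<or> q \<notin> d ` (I <+> I)"
    show "dbl_rot d I p q = 0"
    proof (cases "p = dbl_swap d q")
      case True
      then show ?thesis using * d
        by (cases q rule: dbl_cases[OF d]) (auto simp: dbl_rot_eq(2,3)[OF d])
    qed (use dbl_rot_eq(1)[OF d] in blast)
  qed
  have inj: "inj (dbl_swap d)" using d by (metis dbl_swap_swap injI)
  have "op_bound UNIV UNIV (\<lambda>p q. if dbl_swap d q = id p then
     (case inv d p of Inl i \<Rightarrow> if i \<in> I then - 1 else (0::real) | Inr i \<Rightarrow> if i \<in> I then 1 else 0) else 0) 1"
    by (rule op_bound_partial_injection) (use inj in \<open>auto split: sum.split\<close>)
  then have "op_bound UNIV UNIV (dbl_rot d I) 1" by (simp add: dbl_rot_def)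
  with supp have bdd: "dbl_rot d I \<in> bdd_mats (d ` (I <+> I)) (d ` (I <+> I))"
    by (auto simp: bdd_mats_iff)
  \<comment> \<open>The identity is written through squares of the entries \<plusminus>1, the form
    in which the single surviving term appears.\<close>
  have sq: "mone (d ` (I <+> I)) p q =
      (if p = q then dbl_rot d I (dbl_swap d p) p * dbl_rot d I (dbl_swap d p) p else 0)" for p q
    by (cases p rule: dbl_cases[OF d]) (auto simp: mone_def d dbl_rot_eq(2,3)[OF d])
  have sq': "mone (d ` (I <+> I)) p q =
      (if p = q then dbl_rot d I p (dbl_swap d p) * dbl_rot d I p (dbl_swap d p) else 0)" for p q
    by (cases p rule: dbl_cases[OF d]) (auto simp: mone_def d dbl_rot_eq(2,3)[OF d])
  have "mmul (madj (dbl_rot d I)) (dbl_rot d I) = mone (d ` (I <+> I))"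
  proof (intro ext)
    fix p q
    have "mmul (madj (dbl_rot d I)) (dbl_rot d I) p q =
        (\<Sum>\<^sub>\<infinity>k\<in>{dbl_swap d p}. dbl_rot d I k p * dbl_rot d I k q)"
      unfolding mmul_def madj_def star_real
      by (rule infsum_cong_neutral) (use dbl_rot_eq(1)[OF d] in auto)
    also have "\<dots> = mone (d ` (I <+> I)) p q"
      unfolding sq using dbl_rot_eq(1)[OF d, of I "dbl_swap d p" q] injD[OF inj, of p q] by auto
    finally show "mmul (madj (dbl_rot d I)) (dbl_rot d I) p q = mone (d ` (I <+> I)) p q" .
  qed
  moreover have "mmul (dbl_rot d I) (madj (dbl_rot d I)) = mone (d ` (I <+> I))"
  proof (intro ext)
    fix p q
    have "mmul (dbl_rot d I) (madj (dbl_rot d I)) p q =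
        (\<Sum>\<^sub>\<infinity>k\<in>{dbl_swap d p}. dbl_rot d I p k * dbl_rot d I q k)"
      unfolding mmul_def madj_def star_real
      by (rule infsum_cong_neutral) (use zero in auto)
    also have "\<dots> = mone (d ` (I <+> I)) p q"
      unfolding sq' using dbl_rot_eq(1)[OF d, of I q "dbl_swap d p"] d by auto
    finally show "mmul (dbl_rot d I) (madj (dbl_rot d I)) p q = mone (d ` (I <+> I)) p q" .
  qed
  ultimately show ?thesis using bdd by (simp add: unitary_mat_def)
qed

lemma sandwich_dbl_rot:
  assumes d: "bij d" and E: "os_scale E = scaleR"
  shows "sandwich E (dbl_rot d I) x (madj (dbl_rot d I)) p q =
    (dbl_rot d I p (dbl_swap d p) * dbl_rot d I q (dbl_swap d q)) *\<^sub>R x (dbl_swap d p) (dbl_swap d q)"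
  and "sandwich E (ampl (dbl_rot d I)) y (ampl (madj (dbl_rot d I))) (r, p) (s, q) =
    (dbl_rot d I p (dbl_swap d p) * dbl_rot d I q (dbl_swap d q)) *\<^sub>R y (r, dbl_swap d p) (s, dbl_swap d q)"
proof -
  have zero: "q = dbl_swap d p" if "dbl_rot d I p q \<noteq> 0" for p q
    using dbl_rot_eq(1)[OF d, of I p q] that d by auto
  show "sandwich E (dbl_rot d I) x (madj (dbl_rot d I)) p q =
    (dbl_rot d I p (dbl_swap d p) * dbl_rot d I q (dbl_swap d q)) *\<^sub>R x (dbl_swap d p) (dbl_swap d q)"
    by (subst sandwich_finite_support[where A = "{dbl_swap d p}" and B = "{dbl_swap d q}"])
      (auto simp: E madj_def dest: zero)
  show "sandwich E (ampl (dbl_rot d I)) y (ampl (madj (dbl_rot d I))) (r, p) (s, q) =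
    (dbl_rot d I p (dbl_swap d p) * dbl_rot d I q (dbl_swap d q)) *\<^sub>R y (r, dbl_swap d p) (s, dbl_swap d q)"
    by (subst sandwich_finite_support[where A = "{(r, dbl_swap d p)}" and B = "{(s, dbl_swap d q)}"])
      (auto simp: E madj_def ampl_def dest: zero split: if_splits)
qed

text \<open>Conjugation exchanges the two halves and changes the sign of the off-diagonal blocks,
  which are the symmetries of c(z). As J vanishes off \<open>I\<close>, z must be supported
  there.\<close>

lemma sandwich_dbl_rot_edbl:
  assumes d: "bij d" and E: "os_scale E = scaleR" and z: "supported I I z"
  shows "sandwich E (dbl_rot d I) (edbl d z) (madj (dbl_rot d I)) = edbl d z"
  by (rule dbl_ext[OF d])
    (use z in \<open>auto simp: sandwich_dbl_rot[OF d E] d dbl_rot_eq(2,3)[OF d] supported_def zero_prod_def\<close>)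

section \<open>Recovering a complex matrix from its double\<close>

lemma u_mat_eq:
  assumes "bij (dbl :: 'k + 'k \<Rightarrow> 'k)"
  shows "u_mat I (dbl (Inl i) :: 'k) j = mone I i j / complex_of_real (sqrt 2)"
    and "u_mat I (dbl (Inr i) :: 'k) j = - \<i> * mone I i j / complex_of_real (sqrt 2)"
  using assms by (simp_all add: u_mat_def bij_is_inj)

text \<open>Behind the computation: c(w) u = u w, and u is an isometry on \<open>I\<close>. Each
  column of u has two possibly nonzero entries, so each entry of the compression is a sum of four
  terms.\<close>

lemma sandwich_u_mat:
  fixes w :: "('n \<times> 'k, 'n \<times> 'k, complex) mat"
  assumes d: "bij (dbl :: 'k + 'k \<Rightarrow> 'k)" and w: "supported (UNIV \<times> I) (UNIV \<times> I) w"
  shows "sandwich scalars (ampl (madj (u_mat I))) (cemb (cdbl (amp_dbl dbl) w)) (ampl (u_mat I)) = w"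
proof (intro ext)
  fix a b :: "'n \<times> 'k"
  obtain r :: 'n and i :: 'k and s :: 'n and j :: 'k where ab: "a = (r, i)" "b = (s, j)" by fastforce
  let ?A = "\<lambda>r i. {(r :: 'n, dbl (Inl i) :: 'k), (r, dbl (Inr i))}"
  have zero: "p = dbl (Inr j)" if "u_mat I p j \<noteq> 0" "p \<noteq> dbl (Inl j)" for p j
    using that by (cases p rule: dbl_cases[OF d]) (auto simp: u_mat_eq[OF d] mone_def split: if_splits)
  have ne: "dbl (Inl i :: 'k + 'k) \<noteq> dbl (Inr i)" for i
    using bij_is_inj[OF d] by (auto dest: injD)
  have "sandwich scalars (ampl (madj (u_mat I))) (cemb (cdbl (amp_dbl dbl) w)) (ampl (u_mat I)) a b =
      (\<Sum>k\<in>?A r i. ampl (madj (u_mat I)) a k * (\<Sum>l\<in>?A s j. ampl (u_mat I) l b * cemb (cdbl (amp_dbl dbl) w) k l))"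
    unfolding scale_scalars[symmetric]
    by (rule sandwich_finite_support) (auto simp: scale_scalars ab ampl_def madj_def dest: zero split: if_splits)
  also have "\<dots> = w a b"
  proof (cases "i \<in> I \<and> j \<in> I")
    case True
    then show ?thesis
      by (simp add: ab ne dblmat_amp_dbl[OF d] ampl_def madj_def u_mat_eq[OF d] mone_def complex_eq_iff field_simps)
  next
    case False
    then have "w a b = 0" using w by (auto simp: supported_def ab)
    then show ?thesis
      by (simp add: ab ne dblmat_amp_dbl[OF d] ampl_def madj_def complex_eq_iff)
  qed
  finally show "sandwich scalars (ampl (madj (u_mat I))) (cemb (cdbl (amp_dbl dbl) w)) (ampl (u_mat I)) a b = w a b" .
qed


section \<open>Epigraphs\<close>

text \<open>The isometry onto one half of the doubled space. The two of them exhibit c(x + i 0) as a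
  direct sum in the sense of nc convexity.\<close>

definition dbl_incl :: "('a + 'a \<Rightarrow> 'a) \<Rightarrow> ('a \<Rightarrow> 'a + 'a) \<Rightarrow> 'a set \<Rightarrow> ('a, 'a, 'f::star_field) mat" where
  "dbl_incl d side I = (\<lambda>p k. if p = d (side k) then if k \<in> I then 1 else 0 else 0)"

lemma isometry_dbl_incl:
  assumes d: "bij d" and side: "side = Inl \<or> side = Inr"
  shows "isometry_mat (d ` (I <+> I)) I (dbl_incl d side I :: ('a, 'a, real) mat)"
proof -
  have inj: "inj (\<lambda>k. d (side k))"
    using side bij_is_inj[OF d] by (auto simp: inj_def)
  have "supported (d ` (I <+> I)) I (dbl_incl d side I :: ('a, 'a, real) mat)"
    using side by (auto simp: supported_def dbl_incl_def d)
  moreover have "op_bound UNIV UNIV (\<lambda>p k. if d (side k) = id p then if k \<in> I then 1 else (0::real) else 0) 1"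
    by (rule op_bound_partial_injection) (use inj in auto)
  then have "op_bound UNIV UNIV (dbl_incl d side I :: ('a, 'a, real) mat) 1"
    by (simp add: dbl_incl_def eq_commute)
  ultimately have bdd: "(dbl_incl d side I :: ('a, 'a, real) mat) \<in> bdd_mats (d ` (I <+> I)) I"
    by (auto simp: bdd_mats_iff)
  have "mmul (madj (dbl_incl d side I)) (dbl_incl d side I) = (mone I :: ('a, 'a, real) mat)"
  proof (intro ext)
    fix i j
    have "mmul (madj (dbl_incl d side I)) (dbl_incl d side I :: ('a, 'a, real) mat) i j =
        (\<Sum>\<^sub>\<infinity>k\<in>{d (side i)}. dbl_incl d side I k i * dbl_incl d side I k j)"
      unfolding mmul_def madj_def star_real
      by (rule infsum_cong_neutral) (auto simp: dbl_incl_def)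
    also have "\<dots> = mone I i j"
      using injD[OF inj, of i j] by (auto simp: dbl_incl_def mone_def)
    finally show "mmul (madj (dbl_incl d side I)) (dbl_incl d side I) i j = (mone I i j :: real)" .
  qed
  with bdd show ?thesis by (simp add: isometry_mat_def)
qed

lemma mmul_dbl_incl:
  assumes d: "bij d" and side: "side = Inl \<or> side = Inr"
  shows "mmul (dbl_incl d side I) (madj (dbl_incl d side I)) p q =
    (if p = q \<and> p = d (side (dbl_base d p)) \<and> dbl_base d p \<in> I then 1 else (0::real))"
proof -
  have "mmul (dbl_incl d side I) (madj (dbl_incl d side I)) p q =
      (\<Sum>\<^sub>\<infinity>k\<in>{dbl_base d p}. dbl_incl d side I p k * dbl_incl d side I q k :: real)"
    unfolding mmul_def madj_def star_real
    by (rule infsum_cong_neutral) (use side d in \<open>auto simp: dbl_incl_def\<close>)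
  also have "\<dots> = (if p = q \<and> p = d (side (dbl_base d p)) \<and> dbl_base d p \<in> I then 1 else 0)"
    by (auto simp: dbl_incl_def)
  finally show ?thesis .
qed

text \<open>The range projections of the two inclusions are the diagonal projections onto the
  halves, whose sum is the identity.\<close>

lemma sum_family_dbl_incl:
  fixes I :: "'k set"
  assumes d: "bij d" and I: "I \<noteq> {}" and st: "s \<noteq> t"
  shows "sum_family (d ` (I <+> I)) {s, t} (\<lambda>_. I)
    (\<lambda>u. if u = s then dbl_incl d Inl I else dbl_incl d Inr I :: ('k, 'k, real) mat)"
  unfolding sum_family_def
proof (intro conjI ballI allI)
  show "I \<noteq> {}" by (rule I)
  show "isometry_mat (d ` (I <+> I)) I (if u = s then dbl_incl d Inl I else dbl_incl d Inr I :: ('k, 'k, real) mat)" for u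
    by (simp add: isometry_dbl_incl[OF d])
  fix p q
  have ne: "d (Inl i) \<noteq> d (Inr j)" "d (Inr j) \<noteq> d (Inl i)" for i j
    using bij_is_inj[OF d] by (auto dest: injD)
  have "(mone (d ` (I <+> I)) p q :: real) =
      mmul (dbl_incl d Inl I) (madj (dbl_incl d Inl I)) p q + mmul (dbl_incl d Inr I) (madj (dbl_incl d Inr I)) p q"
    by (cases p rule: dbl_cases[OF d]) (auto simp: mmul_dbl_incl[OF d] mone_def d ne)
  then show "((\<lambda>u. mmul (if u = s then dbl_incl d Inl I else dbl_incl d Inr I)
      (madj (if u = s then dbl_incl d Inl I else dbl_incl d Inr I)) p q) has_sum (mone (d ` (I <+> I)) p q :: real)) {s, t}"
    using st by (intro has_sum_finiteI) auto
qed

lemma sandwich_dbl_incl: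
  fixes x :: "('a, 'a, 'e::real_normed_vector) mat" and y :: "('n \<times> 'a, 'n \<times> 'a, 'e) mat"
  assumes d: "bij d" and E: "os_scale E = scaleR" and side: "side = Inl \<or> side = Inr"
  shows "sandwich E (dbl_incl d side I) x (madj (dbl_incl d side I)) p q =
    (dbl_incl d side I p (dbl_base d p) * dbl_incl d side I q (dbl_base d q)) *\<^sub>R x (dbl_base d p) (dbl_base d q)"
  and "sandwich E (ampl (dbl_incl d side I)) y (madj (ampl (dbl_incl d side I))) (r, p) (s, q) =
    (dbl_incl d side I p (dbl_base d p) * dbl_incl d side I q (dbl_base d q)) *\<^sub>R y (r, dbl_base d p) (s, dbl_base d q)"
proof -
  have zero: "k = dbl_base d p" if "dbl_incl d side I p k \<noteq> (0::real)" for p k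
    using that side d by (auto simp: dbl_incl_def split: if_splits)
  show "sandwich E (dbl_incl d side I) x (madj (dbl_incl d side I)) p q =
    (dbl_incl d side I p (dbl_base d p) * dbl_incl d side I q (dbl_base d q)) *\<^sub>R x (dbl_base d p) (dbl_base d q)"
    by (subst sandwich_finite_support[where A = "{dbl_base d p}" and B = "{dbl_base d q}"])
      (auto simp: E madj_def dest: zero)
  show "sandwich E (ampl (dbl_incl d side I)) y (madj (ampl (dbl_incl d side I))) (r, p) (s, q) =
    (dbl_incl d side I p (dbl_base d p) * dbl_incl d side I q (dbl_base d q)) *\<^sub>R y (r, dbl_base d p) (s, dbl_base d q)"
    by (subst sandwich_finite_support[where A = "{(r, dbl_base d p)}" and B = "{(s, dbl_base d q)}"])
      (auto simp: E madj_def ampl_def dest: zero split: if_splits)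
qed

text \<open>The coefficient of an entry is 1 if both indices lie in the same half over
  \<open>I\<close>, and 0 otherwise, which leaves two diagonal copies.\<close>

lemma direct_sum_dbl_incl:
  fixes x :: "('k, 'k, 'e::real_normed_vector) mat" and y :: "('n \<times> 'k, 'n \<times> 'k, real) mat"
  assumes d: "bij d" and E: "os_scale E = scaleR" and st: "s \<noteq> t"
  shows "supported I I x \<Longrightarrow>
      direct_sum E {s, t} (\<lambda>u. if u = s then dbl_incl d Inl I else dbl_incl d Inr I) (\<lambda>_. x) = edbl d (eemb x)"
    and "supported (UNIV \<times> I) (UNIV \<times> I) y \<Longrightarrow>
      direct_sum scalars {s, t} (\<lambda>u. ampl (if u = s then dbl_incl d Inl I else dbl_incl d Inr I)) (\<lambda>_. y) =
      cdbl (amp_dbl d) (cemb y)"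
proof -
  have ne: "d (Inl i) \<noteq> d (Inr j)" "d (Inr j) \<noteq> d (Inl i)" for i j
    using bij_is_inj[OF d] by (auto dest: injD)
  let ?L = "dbl_incl d Inl I :: ('k, 'k, real) mat" and ?R = "dbl_incl d Inr I :: ('k, 'k, real) mat"
  have E_sum: "direct_sum E {s, t} (\<lambda>u. if u = s then ?L else ?R) (\<lambda>_. x) p q =
      (?L p (dbl_base d p) * ?L q (dbl_base d q) + ?R p (dbl_base d p) * ?R q (dbl_base d q)) *\<^sub>R
        x (dbl_base d p) (dbl_base d q)" for p q
    using st by (simp add: direct_sum_def sandwich_dbl_incl(1)[OF d E] scaleR_add_left)
  show "direct_sum E {s, t} (\<lambda>u. if u = s then ?L else ?R) (\<lambda>_. x) = edbl d (eemb x)"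
    if x: "supported I I x"
    by (rule dbl_ext[OF d]; simp only: E_sum)
      (use x in \<open>auto simp: dbl_incl_def d ne supported_def\<close>)
  have S_sum: "direct_sum scalars {s, t} (\<lambda>u. ampl (if u = s then ?L else ?R)) (\<lambda>_. y) (r, p) (r', q) =
      (?L p (dbl_base d p) * ?L q (dbl_base d q) + ?R p (dbl_base d p) * ?R q (dbl_base d q)) *\<^sub>R
        y (r, dbl_base d p) (r', dbl_base d q)" for r p r' q
    using st by (simp add: direct_sum_def sandwich_dbl_incl(2)[OF d scale_scalars_real] distrib_right)
  show "direct_sum scalars {s, t} (\<lambda>u. ampl (if u = s then ?L else ?R)) (\<lambda>_. y) =
      cdbl (amp_dbl d) (cemb y)"
    if y: "supported (UNIV \<times> I) (UNIV \<times> I) y"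
    by (rule dbl_ext[OF bij_amp_dbl[OF d]]; clarsimp simp only: split_paired_all amp_dbl_simps S_sum)
      (use y in \<open>auto simp: dblmat_amp_dbl[OF d] dbl_incl_def d ne supported_def\<close>)
qed

lemma compress_dbl_incl:
  fixes x :: "('k, 'k, 'e::real_normed_vector) mat"
  assumes d: "bij d" and E: "os_scale E = scaleR" and x: "supported I I x"
  shows "sandwich E (madj (dbl_incl d Inl I)) (edbl d (eemb x)) (dbl_incl d Inl I) = x"
proof (intro ext)
  fix i j
  show "sandwich E (madj (dbl_incl d Inl I)) (edbl d (eemb x)) (dbl_incl d Inl I) i j = x i j"
    by (subst sandwich_finite_support[where A = "{d (Inl i)}" and B = "{d (Inl j)}"])
      (use x in \<open>auto simp: E madj_def dbl_incl_def d supported_def\<close>)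
qed

section \<open>The two maps between the epigraphs of \<open>f\<close> and of its
  complexification\<close>

lemma cdbl_diff: "bij d \<Longrightarrow> cdbl d (\<lambda>p q. \<gamma> p q - \<delta> p q) = (\<lambda>p q. cdbl d \<gamma> p q - cdbl d \<delta> p q)"
  by (rule dbl_ext) auto

lemma supported_diff: "supported I J \<gamma> \<Longrightarrow> supported I J \<delta> \<Longrightarrow> supported I J (\<lambda>p q. \<gamma> p q - \<delta> p q :: 'x::ab_group_add)"
  by (simp add: supported_def)

locale real_nc_function = real_dual_operator_space E
  for E :: "('e::banach, real) dual_os" +
  fixes K :: "'k set \<Rightarrow> ('k, 'k, 'e) mat set" and f :: "('k, 'e, 'n, real) ncfun"
  assumes inf: "infinite (UNIV :: 'k set)" and K: "nc_convex_set E K" and f: "f \<in> bdd_nc_funs E K"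
begin

abbreviation "D I \<equiv> dbl_set I"
abbreviation "Kc \<equiv> set_complexify E K"
abbreviation "fc \<equiv> fun_complexify f"
abbreviation "nd \<equiv> amp_dbl dbl"

lemma bij_dbl': "bij (dbl :: 'k + 'k \<Rightarrow> 'k)"
  by (rule bij_dbl[OF inf])

lemmas bij_nd = bij_amp_dbl[OF bij_dbl']

lemma D_nonempty: "I \<noteq> {} \<Longrightarrow> D I \<noteq> {}"
  by (auto simp: dbl_set_def)

lemma UNIV_times_D: "UNIV \<times> D I = nd ` ((UNIV \<times> I) <+> (UNIV \<times> I))"
  by (simp add: amp_dbl_image dbl_set_def)

lemma cmat_dbl_edbl: "cmat_dbl z = edbl dbl z"
  by (simp add: cmat_dbl_def edbl_cmat)

lemma K_mats: "I \<noteq> {} \<Longrightarrow> K I \<subseteq> mats E I"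
  using K by (simp add: nc_convex_set_def)

lemma K_direct_sum:
  assumes "I \<noteq> {}" "sum_family I S J \<alpha>" "\<forall>s\<in>S. x s \<in> K (J s)" "\<exists>C. \<forall>s\<in>S. mats_norm E (J s) (x s) \<le> C"
  shows "direct_sum E S \<alpha> x \<in> K I"
proof -
  have "\<forall>I S J \<alpha> x. I \<noteq> {} \<and> sum_family I S J \<alpha> \<and> (\<forall>s\<in>S. x s \<in> K (J s)) \<and>
      (\<exists>C. \<forall>s\<in>S. mats_norm E (J s) (x s) \<le> C) \<longrightarrow> direct_sum E S \<alpha> x \<in> K I"
    using K unfolding nc_convex_set_def nc_closed_def by (elim conjE)
  from this[rule_format, OF conjI, OF assms(1) conjI, OF assms(2) conjI, OF _ assms(4)] show ?thesis
    using assms(3) by blast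
qed

lemma K_compress:
  assumes "I \<noteq> {}" "J \<noteq> {}" "isometry_mat I J \<beta>" "x \<in> K I"
  shows "sandwich E (madj \<beta>) x \<beta> \<in> K J"
proof -
  have "\<forall>I J \<beta> x. I \<noteq> {} \<and> J \<noteq> {} \<and> isometry_mat I J \<beta> \<and> x \<in> K I \<longrightarrow> sandwich E (madj \<beta>) x \<beta> \<in> K J"
    using K unfolding nc_convex_set_def nc_closed_def by (elim conjE)
  then show ?thesis using assms by simp
qed

text \<open>Membership of z in the complex matrix space follows from that of c(z) in
  \<open>K\<close>, because \<open>K\<close> consists of bounded matrices.\<close>

lemma Kc_iff:
  assumes "I \<noteq> {}"
  shows "z \<in> Kc I \<longleftrightarrow> edbl dbl z \<in> K (D I)"
  using K_mats[OF D_nonempty[OF assms]] mats_complexify_iff[OF bij_dbl', of z I]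
  by (auto simp: set_complexify_def cmat_dbl_edbl dbl_set_def)

lemma f_mats: "I \<noteq> {} \<Longrightarrow> x \<in> K I \<Longrightarrow> f I x \<in> mats scalars (UNIV \<times> I)"
  using f by (simp add: bdd_nc_funs_def)

lemma f_unitary:
  assumes "I \<noteq> {}" "unitary_mat I U" "x \<in> K I"
  shows "f I (sandwich E U x (madj U)) = sandwich scalars (ampl U) (f I x) (ampl (madj U))"
proof -
  have "\<forall>I U. I \<noteq> {} \<and> unitary_mat I U \<longrightarrow> (\<forall>x\<in>K I.
        f I (sandwich E U x (madj U)) = sandwich scalars (ampl U) (f I x) (ampl (madj U)))"
    using f unfolding bdd_nc_funs_def mem_Collect_eq by (elim conjE)
  then show ?thesis using assms by simp
qed

lemma f_direct_sum:
  assumes "I \<noteq> {}" "sum_family I S J \<alpha>" "\<forall>s\<in>S. x s \<in> K (J s)" "\<exists>C. \<forall>s\<in>S. mats_norm E (J s) (x s) \<le> C"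
  shows "f I (direct_sum E S \<alpha> x) = direct_sum scalars S (\<lambda>s. ampl (\<alpha> s)) (\<lambda>s. f (J s) (x s))"
proof -
  have "\<forall>I S J \<alpha> x. I \<noteq> {} \<and> sum_family I S J \<alpha> \<and> (\<forall>s\<in>S. x s \<in> K (J s)) \<and>
        (\<exists>C. \<forall>s\<in>S. mats_norm E (J s) (x s) \<le> C) \<longrightarrow>
        f I (direct_sum E S \<alpha> x) = direct_sum scalars S (\<lambda>s. ampl (\<alpha> s)) (\<lambda>s. f (J s) (x s))"
    using f unfolding bdd_nc_funs_def mem_Collect_eq by (elim conjE)
  from this[rule_format, OF conjI, OF assms(1) conjI, OF assms(2) conjI, OF _ assms(4)] show ?thesis
    using assms(3) by simp
qed

lemma cdbl_fc:
  assumes I: "I \<noteq> {}" and z: "z \<in> Kc I"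
  shows "cdbl nd (fc I z) = f (D I) (edbl dbl z)"
    and "supported (UNIV \<times> I) (UNIV \<times> I) (fc I z)"
proof -
  define A where "A = f (D I) (edbl dbl z)"
  have zK: "edbl dbl z \<in> K (D I)" using z Kc_iff[OF I] by simp
  have zs: "supported I I z" using z by (auto simp: set_complexify_def intro: mats_supported)
  have As: "supported (UNIV \<times> D I) (UNIV \<times> D I) A"
    unfolding A_def by (rule mats_supported[OF f_mats[OF D_nonempty[OF I] zK]])
  let ?U = "dbl_rot dbl I"
  have U: "unitary_mat (D I) ?U"
    using unitary_dbl_rot[OF bij_dbl'] by (simp add: dbl_set_def)
  have "A = sandwich scalars (ampl ?U) A (ampl (madj ?U))"
    using f_unitary[OF D_nonempty[OF I] U zK]
    by (simp add: sandwich_dbl_rot_edbl[OF bij_dbl' scale zs] A_def)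
  \<comment> \<open>Entrywise invariance under J. The sign is +1 for two indices in the same half
    and -1 across the halves, so these are the block relations of \<open>dblmat_ex\<close>.\<close>
  then have AU: "A (r, p) (s, q) =
      (?U p (dbl_swap dbl p) * ?U q (dbl_swap dbl q)) *\<^sub>R A (r, dbl_swap dbl p) (s, dbl_swap dbl q)" for r p s q
    using sandwich_dbl_rot(2)[OF bij_dbl' scale_scalars_real] by metis
  \<comment> \<open>J vanishes off \<open>D I\<close>, so there the block relations come from the
    support of \<open>A\<close> instead.\<close>
  have A0: "A (r, p) (s, q) = 0" if "p \<notin> D I \<or> q \<notin> D I" for r p s q
    using As that by (auto simp: supported_def)
  have mem: "dbl (Inl i) \<in> D I \<longleftrightarrow> i \<in> I" "dbl (Inr i) \<in> D I \<longleftrightarrow> i \<in> I" for i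
    using bij_dbl' by (simp_all add: dbl_set_def)
  \<comment> \<open>Real and imaginary parts are read from the first block column.\<close>
  define w where "w = (\<lambda>i j. case (A (nd (Inl i)) (nd (Inl j)), A (nd (Inr i)) (nd (Inl j))) of (x, y) \<Rightarrow> Complex x y)"
  have "cdbl nd w = A"
    unfolding w_def
  proof (rule complex_pair_complex.dblmat_ex[OF bij_nd])
    show "A (nd (Inr a)) (nd (Inr b)) = A (nd (Inl a)) (nd (Inl b))" for a b
    proof -
      obtain r i s j where "a = (r, i)" "b = (s, j)" by fastforce
      then show ?thesis
        using AU[of r "dbl (Inr i)" s "dbl (Inr j)"] A0[of "dbl (Inl i)" "dbl (Inl j)" r s]
          A0[of "dbl (Inr i)" "dbl (Inr j)" r s]
        by (cases "i \<in> I \<and> j \<in> I") (auto simp: bij_dbl' dbl_rot_eq(2,3)[OF bij_dbl'] mem)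
    qed
    show "A (nd (Inl a)) (nd (Inr b)) = - A (nd (Inr a)) (nd (Inl b))" for a b
    proof -
      obtain r i s j where "a = (r, i)" "b = (s, j)" by fastforce
      then show ?thesis
        using AU[of r "dbl (Inl i)" s "dbl (Inr j)"] A0[of "dbl (Inl i)" "dbl (Inr j)" r s]
          A0[of "dbl (Inr i)" "dbl (Inl j)" r s]
        by (cases "i \<in> I \<and> j \<in> I") (auto simp: bij_dbl' dbl_rot_eq(2,3)[OF bij_dbl'] mem)
    qed
  qed
  moreover from this have ws: "supported (UNIV \<times> I) (UNIV \<times> I) w"
    using As by (simp add: UNIV_times_D flip: complex_pair_complex.supported_dblmat[OF bij_nd])
  moreover have "fc I z = w"
    using sandwich_u_mat[OF bij_dbl' ws] \<open>cdbl nd w = A\<close>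
    by (simp add: fun_complexify_def A_def cmat_dbl_edbl)
  ultimately show "cdbl nd (fc I z) = f (D I) (edbl dbl z)" "supported (UNIV \<times> I) (UNIV \<times> I) (fc I z)"
    by (simp_all add: A_def)
qed

text \<open>Since f(c(z)) is the double of the complexified value, the difference tested for
  positivity is itself a double. Outside the domains both sides fail together, by the membership
  equivalences.\<close>

lemma Epi_complexify:
  assumes I: "I \<noteq> {}"
  shows "(z, \<delta>) \<in> Epi Kc fc I \<longleftrightarrow> (edbl dbl z, cdbl nd \<delta>) \<in> Epi K f (D I)"
proof (cases "z \<in> Kc I \<and> \<delta> \<in> mats scalars (UNIV \<times> I)")
  case True
  then have zK: "edbl dbl z \<in> K (D I)" and \<delta>: "cdbl nd \<delta> \<in> mats scalars (UNIV \<times> D I)"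
    using Kc_iff[OF I] mats_scalars_cdbl[OF bij_nd] by (auto simp: UNIV_times_D)
  let ?T = "\<lambda>p q. \<delta> p q - fc I z p q"
  have T: "supported (UNIV \<times> I) (UNIV \<times> I) ?T"
    using True cdbl_fc(2)[OF I] by (intro supported_diff mats_supported[of \<delta>]) auto
  have cT: "cdbl nd ?T = (\<lambda>p q. cdbl nd \<delta> p q - f (D I) (edbl dbl z) p q)"
    using True by (simp add: cdbl_diff[OF bij_nd] cdbl_fc(1)[OF I])
  have "supported (UNIV \<times> D I) (UNIV \<times> D I) (cdbl nd ?T)"
    using T by (simp add: UNIV_times_D complex_pair_complex.supported_dblmat[OF bij_nd])
  then have "mat_pos (UNIV \<times> D I) (cdbl nd ?T) \<longleftrightarrow> mat_pos (UNIV \<times> I) ?T"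
    using T by (simp add: mat_pos_UNIV mat_pos_cdbl[OF bij_nd])
  then show ?thesis
    using True zK \<delta> by (simp add: Epi_def cT madj_cdbl_iff[OF bij_nd])
next
  case False
  then show ?thesis
    using Kc_iff[OF I, of z] mats_scalars_cdbl_iff[OF bij_nd, of \<delta> "UNIV \<times> I"]
    by (auto simp: Epi_def UNIV_times_D)
qed

text \<open>Uses both closure properties of \<open>K\<close>: compression of the double to its first
  half returns x, and the direct sum of two copies of x produces the double.\<close>

lemma eemb_mem_Kc_iff:
  assumes I: "I \<noteq> {}" and x: "supported I I x"
  shows "eemb x \<in> Kc I \<longleftrightarrow> x \<in> K I"
proof
  assume "eemb x \<in> Kc I"
  then have "edbl dbl (eemb x) \<in> K (D I)" by (simp add: Kc_iff[OF I])
  moreover have "isometry_mat (D I) I (dbl_incl dbl Inl I :: ('k, 'k, real) mat)"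
    using isometry_dbl_incl[OF bij_dbl', of Inl I] by (simp add: dbl_set_def)
  ultimately have "sandwich E (madj (dbl_incl dbl Inl I)) (edbl dbl (eemb x)) (dbl_incl dbl Inl I) \<in> K I"
    by (rule K_compress[OF D_nonempty[OF I] I, rotated])
  then show "x \<in> K I" by (simp add: compress_dbl_incl[OF bij_dbl' scale x])
next
  assume xK: "x \<in> K I"
  \<comment> \<open>Families are indexed by subsets of \<open>'k\<close>; two distinct elements
    label the two copies.\<close>
  obtain s t :: 'k where st: "s \<noteq> t" using inf by (metis finite.emptyI finite_insert finite_subset insertI1 subsetI)
  have "direct_sum E {s, t} (\<lambda>u. if u = s then dbl_incl dbl Inl I else dbl_incl dbl Inr I) (\<lambda>_. x) \<in> K (D I)"
    using sum_family_dbl_incl[OF bij_dbl' I st] xK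
    by (intro K_direct_sum[OF D_nonempty[OF I], of _ "\<lambda>_. I"]) (auto simp: dbl_set_def)
  then show "eemb x \<in> Kc I"
    by (simp add: Kc_iff[OF I] direct_sum_dbl_incl(1)[OF bij_dbl' scale st x])
qed

text \<open>Both sides have the same double, because \<open>f\<close> respects the direct sum of two
  copies of x; injectivity of c concludes.\<close>

lemma fc_eemb:
  assumes I: "I \<noteq> {}" and xK: "x \<in> K I"
  shows "fc I (eemb x) = cemb (f I x)"
proof -
  have x: "supported I I x" using xK K_mats[OF I] mats_supported by blast
  have fx: "supported (UNIV \<times> I) (UNIV \<times> I) (f I x)" by (rule mats_supported[OF f_mats[OF I xK]])
  obtain s t :: 'k where st: "s \<noteq> t" using inf by (metis finite.emptyI finite_insert finite_subset insertI1 subsetI)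
  let ?\<alpha> = "\<lambda>u. if u = s then dbl_incl dbl Inl I else dbl_incl dbl Inr I :: ('k, 'k, real) mat"
  have "f (D I) (direct_sum E {s, t} ?\<alpha> (\<lambda>_. x)) =
      direct_sum scalars {s, t} (\<lambda>u. ampl (?\<alpha> u)) (\<lambda>_. f I x)"
    using sum_family_dbl_incl[OF bij_dbl' I st] xK
    by (intro f_direct_sum[OF D_nonempty[OF I], of _ "\<lambda>_. I"]) (auto simp: dbl_set_def)
  then have "f (D I) (edbl dbl (eemb x)) = cdbl nd (cemb (f I x))"
    by (simp only: direct_sum_dbl_incl(1)[OF bij_dbl' scale st x]
        direct_sum_dbl_incl(2)[OF bij_dbl' scale st fx])
  moreover have "eemb x \<in> Kc I" using xK eemb_mem_Kc_iff[OF I x] by simp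
  ultimately show ?thesis
    using cdbl_fc(1)[OF I] complex_pair_complex.dblmat_inject[OF bij_nd] by metis
qed

lemma Epi_eemb:
  assumes I: "I \<noteq> {}"
  shows "(x, \<gamma>) \<in> Epi K f I \<longleftrightarrow> (eemb x, cemb \<gamma>) \<in> Epi Kc fc I"
proof -
  have xK: "eemb x \<in> Kc I \<longleftrightarrow> x \<in> K I"
  proof -
    have "supported I I x" if "eemb x \<in> Kc I"
      using that by (auto simp: set_complexify_def supported_def zero_prod_def dest!: mats_supported)
    then show ?thesis using eemb_mem_Kc_iff[OF I, of x] K_mats[OF I] mats_supported by blast
  qed
  have madj: "madj (cemb \<gamma>) = cemb \<gamma> \<longleftrightarrow> madj \<gamma> = \<gamma>"
    by (simp add: madj_def fun_eq_iff)
  have "mat_pos (UNIV \<times> I) (\<lambda>p q. cemb \<gamma> p q - fc I (eemb x) p q) \<longleftrightarrow>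
      mat_pos (UNIV \<times> I) (\<lambda>p q. \<gamma> p q - f I x p q)" if "x \<in> K I"
    using mat_pos_cemb[of "UNIV \<times> I" "\<lambda>p q. \<gamma> p q - f I x p q"] by (simp add: fc_eemb[OF I that])
  then show ?thesis
    using xK mats_scalars_cemb_iff[of \<gamma> "UNIV \<times> I"] madj by (auto simp: Epi_def)
qed

end


section \<open>Convexity and lower semicontinuity\<close>

lemma nc_convex_funI:
  fixes E :: "('e::real_normed_vector, 'f::star_field) dual_os" and K :: "'k set \<Rightarrow> ('k, 'k, 'e) mat set"
    and f :: "('k, 'e, 'n, 'f) ncfun"
  assumes "\<And>I S J \<alpha> x \<gamma> C. I \<noteq> {} \<Longrightarrow> sum_family I S J \<alpha> \<Longrightarrow> (\<And>s. s \<in> S \<Longrightarrow> (x s, \<gamma> s) \<in> Epi K f (J s)) \<Longrightarrow>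
      (\<And>s. s \<in> S \<Longrightarrow> mats_norm E (J s) (x s) \<le> C) \<Longrightarrow>
      (\<And>s. s \<in> S \<Longrightarrow> mats_norm scalars (UNIV \<times> J s) (\<gamma> s) \<le> C) \<Longrightarrow>
      (direct_sum E S \<alpha> x, direct_sum scalars S (\<lambda>s. ampl (\<alpha> s)) \<gamma>) \<in> Epi K f I"
    and "\<And>I J \<beta> x \<gamma>. I \<noteq> {} \<Longrightarrow> J \<noteq> {} \<Longrightarrow> isometry_mat I J \<beta> \<Longrightarrow> (x, \<gamma>) \<in> Epi K f I \<Longrightarrow>
      (sandwich E (madj \<beta>) x \<beta>, sandwich scalars (ampl (madj \<beta>)) \<gamma> (ampl \<beta>)) \<in> Epi K f J"
  shows "nc_convex_fun E K f"
  unfolding nc_convex_fun_def nc_closed_def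
proof (intro conjI allI impI; elim conjE exE)
  fix I S J and \<alpha> :: "'k \<Rightarrow> ('k, 'k, 'f) mat" and z C
  assume "I \<noteq> {}" "sum_family I S J \<alpha>" "\<forall>s\<in>S. z s \<in> Epi K f (J s)"
    "\<forall>s\<in>S. (case z s of (x, \<gamma>) \<Rightarrow> max (mats_norm E (J s) x) (mats_norm scalars (UNIV \<times> J s) \<gamma>)) \<le> C"
  then show "(direct_sum E S \<alpha> (\<lambda>s. fst (z s)), direct_sum scalars S (\<lambda>s. ampl (\<alpha> s)) (\<lambda>s. snd (z s))) \<in> Epi K f I"
    by (intro assms(1)[of I S J \<alpha> _ _ C]) (auto simp: split_def)
next
  fix I J and \<beta> :: "('k, 'k, 'f) mat" and z
  assume "I \<noteq> {}" "J \<noteq> {}" "isometry_mat I J \<beta>" "z \<in> Epi K f I"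
  then show "(case z of (x, \<gamma>) \<Rightarrow> (sandwich E (madj \<beta>) x \<beta>, sandwich scalars (ampl (madj \<beta>)) \<gamma> (ampl \<beta>))) \<in> Epi K f J"
    using assms(2) by (cases z) auto
qed

lemma nc_convex_fun_direct_sum:
  fixes E :: "('e::real_normed_vector, 'f::star_field) dual_os" and K :: "'k set \<Rightarrow> ('k, 'k, 'e) mat set"
    and f :: "('k, 'e, 'n, 'f) ncfun"
  assumes f: "nc_convex_fun E K f"
    and "I \<noteq> {}" "sum_family I S J \<alpha>" "\<And>s. s \<in> S \<Longrightarrow> (x s, \<gamma> s) \<in> Epi K f (J s)"
      "\<And>s. s \<in> S \<Longrightarrow> mats_norm E (J s) (x s) \<le> C"
      "\<And>s. s \<in> S \<Longrightarrow> mats_norm scalars (UNIV \<times> J s) (\<gamma> s) \<le> C"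
  shows "(direct_sum E S \<alpha> x, direct_sum scalars S (\<lambda>s. ampl (\<alpha> s)) \<gamma>) \<in> Epi K f I"
proof -
  have "\<forall>I S J \<alpha> z. I \<noteq> {} \<and> sum_family I S J \<alpha> \<and> (\<forall>s\<in>S. z s \<in> Epi K f (J s)) \<and>
      (\<exists>C. \<forall>s\<in>S. (\<lambda>I (x, \<gamma>). max (mats_norm E I x) (mats_norm scalars (UNIV \<times> I) \<gamma>)) (J s) (z s) \<le> C) \<longrightarrow>
      (direct_sum E S \<alpha> (\<lambda>s. fst (z s)), direct_sum scalars S (\<lambda>s. ampl (\<alpha> s)) (\<lambda>s. snd (z s))) \<in> Epi K f I"
    using f unfolding nc_convex_fun_def nc_closed_def by (elim conjE)
  note * = this[THEN spec, THEN spec, THEN spec, THEN spec, THEN spec, THEN mp, of I S J \<alpha> "\<lambda>s. (x s, \<gamma> s)"]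
  show ?thesis
    using * assms(2-) by simp blast
qed

lemma nc_convex_fun_compress:
  fixes E :: "('e::real_normed_vector, 'f::star_field) dual_os" and K :: "'k set \<Rightarrow> ('k, 'k, 'e) mat set"
    and f :: "('k, 'e, 'n, 'f) ncfun"
  assumes f: "nc_convex_fun E K f"
    and "I \<noteq> {}" "J \<noteq> {}" "isometry_mat I J \<beta>" "(x, \<gamma>) \<in> Epi K f I"
  shows "(sandwich E (madj \<beta>) x \<beta>, sandwich scalars (ampl (madj \<beta>)) \<gamma> (ampl \<beta>)) \<in> Epi K f J"
proof -
  have "\<forall>I J \<beta> z. I \<noteq> {} \<and> J \<noteq> {} \<and> isometry_mat I J \<beta> \<and> z \<in> Epi K f I \<longrightarrow>
      (\<lambda>\<beta> (x, \<gamma>). (sandwich E (madj \<beta>) x \<beta>, sandwich scalars (ampl (madj \<beta>)) \<gamma> (ampl \<beta>))) \<beta> z \<in> Epi K f J"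
    using f unfolding nc_convex_fun_def nc_closed_def by (elim conjE)
  from this[THEN spec, THEN spec, THEN spec, THEN spec, THEN mp, of I J \<beta> "(x, \<gamma>)"]
  show ?thesis using assms(2-) by simp
qed

section \<open>Transport of compressions and direct sums to the doubled space\<close>

lemma sq_summable_cdbl_madj:
  assumes d: "bij d" and \<beta>: "\<beta> \<in> bdd_mats I J"
  shows "sq_summable (cdbl d (madj \<beta>) p)" "sq_summable (\<lambda>l. cdbl d \<beta> l q)" "sq_summable (cdbl d \<beta> p)"
    and "sq_summable (ampl (cdbl d \<beta>) (r, p))" "sq_summable (ampl (cdbl d (madj \<beta>)) (r, p))"
    and "sq_summable (\<lambda>l. ampl (cdbl d \<beta>) l (r, q))"
proof -
  note b = bdd_mats_sq_summable[OF bdd_mats_cdbl[OF d \<beta>]]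
  show m: "sq_summable (cdbl d (madj \<beta>) p)" for p
    unfolding madj_cdbl[OF d, symmetric] using b(2)[of p] by (simp add: madj_def[of "cdbl d \<beta>"])
  show "sq_summable (\<lambda>l. cdbl d \<beta> l q)" "sq_summable (cdbl d \<beta> p)" by (rule b)+
  show "sq_summable (ampl (cdbl d \<beta>) (r, p))" "sq_summable (ampl (cdbl d (madj \<beta>)) (r, p))"
    unfolding sq_summable_ampl by (rule b m)+
  have "(\<lambda>l. ampl (cdbl d \<beta>) l (r, q)) = ampl (cdbl d (madj \<beta>)) (r, q)"
    unfolding madj_cdbl[OF d, symmetric] by (auto simp: ampl_def madj_def[of "cdbl d \<beta>"])
  then show "sq_summable (\<lambda>l. ampl (cdbl d \<beta>) l (r, q))"
    by (simp add: sq_summable_ampl m)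
qed

context real_nc_function
begin

lemma sandwich_edbl:
  fixes I J :: "'k set"
  assumes \<beta>: "isometry_mat I J \<beta>" and z: "z \<in> mats (complexify E) I"
  shows "sandwich E (madj (cdbl dbl \<beta>)) (edbl dbl z) (cdbl dbl \<beta>) =
    edbl dbl (sandwich (complexify E) (madj \<beta>) z \<beta>)"
proof -
  obtain c where "0 \<le> c" and c: "\<And>(I :: 'k set) x. x \<in> mats E I \<Longrightarrow> form_bound x (c * mats_norm E I x)"
    using mats_form_bound[where 'a = 'k] by auto
  have b: "\<beta> \<in> bdd_mats I J" using \<beta> by (simp add: isometry_mat_def)
  show ?thesis
    unfolding madj_cdbl[OF bij_dbl']
    by (rule complex_pair_prod.dblmat_sandwich[OF bij_dbl' scale scale_complexify
          c[OF mats_complexify_dbl(1)[OF bij_dbl' z]]])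
      (rule sq_summable_cdbl_madj[OF bij_dbl' b])+
qed

lemma sandwich_nd:
  fixes I J :: "'k set" and \<delta> :: "('n \<times> 'k, 'n \<times> 'k, complex) mat"
  assumes \<beta>: "isometry_mat I J \<beta>" and \<delta>: "\<delta> \<in> mats scalars (UNIV \<times> I)"
  shows "sandwich scalars (ampl (madj (cdbl dbl \<beta>))) (cdbl nd \<delta>) (ampl (cdbl dbl \<beta>)) =
    cdbl nd (sandwich scalars (ampl (madj \<beta>)) \<delta> (ampl \<beta>))"
proof -
  have b: "\<beta> \<in> bdd_mats I J" using \<beta> by (simp add: isometry_mat_def)
  show ?thesis
    unfolding madj_cdbl[OF bij_dbl'] ampl_cdbl[OF bij_dbl']
  proof (rule complex_pair_complex.dblmat_sandwich[OF bij_nd scale_scalars_real scale_scalars])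
    show "form_bound (cdbl nd \<delta>) (mats_norm scalars (UNIV \<times> I) \<delta>)"
      by (rule form_bound_op_bound[OF op_bound_cdbl[OF bij_nd op_bound_UNIV_mats_norm[OF \<delta>]]])
    show "sq_summable (cdbl nd (ampl (madj \<beta>)) p)" "sq_summable (\<lambda>l. cdbl nd (ampl \<beta>) l p)" for p
      unfolding ampl_cdbl[OF bij_dbl', symmetric]
      by (cases p; simp add: sq_summable_cdbl_madj[OF bij_dbl' b])+
  qed
qed

lemma direct_sum_edbl:
  fixes I :: "'k set"
  assumes \<alpha>: "sum_family I S J \<alpha>" and z: "\<And>s. s \<in> S \<Longrightarrow> z s \<in> mats (complexify E) (J s)"
    and C: "\<And>s. s \<in> S \<Longrightarrow> mats_norm (complexify E) (J s) (z s) \<le> C"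
  shows "direct_sum E S (\<lambda>s. cdbl dbl (\<alpha> s)) (\<lambda>s. edbl dbl (z s)) =
    edbl dbl (direct_sum (complexify E) S \<alpha> z)"
proof -
  obtain c where "0 \<le> c" and c: "\<And>(I :: 'k set) x. x \<in> mats E I \<Longrightarrow> form_bound x (c * mats_norm E I x)"
    using mats_form_bound[where 'a = 'k] by auto
  have b: "\<alpha> s \<in> bdd_mats I (J s)" if "s \<in> S" for s
    using \<alpha> that by (auto simp: sum_family_def isometry_mat_def)
  show ?thesis
  proof (rule complex_pair_prod.dblmat_direct_sum[OF bij_dbl' scale scale_complexify])
    \<comment> \<open>One bound for the whole family, available because \<open>c\<close> is
      independent of the level \<open>J s\<close>.\<close>
    show "form_bound (edbl dbl (z s)) (c * C)" if "s \<in> S" for s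
      using order_trans[OF mats_complexify_dbl(2)[OF bij_dbl' z[OF that]] C[OF that]] \<open>0 \<le> c\<close>
      by (intro form_bound_mono[OF c[OF mats_complexify_dbl(1)[OF bij_dbl' z[OF that]]]] mult_left_mono)
    show "sq_summable (cdbl dbl (\<alpha> s) p)" if "s \<in> S" for s p
      by (rule sq_summable_cdbl_madj[OF bij_dbl' b[OF that]])
    show "(\<lambda>s. \<Sum>\<^sub>\<infinity>k. (cdbl dbl (\<alpha> s) p k)\<^sup>2) summable_on S" for p
      by (rule sum_family_rows[OF sum_family_cdbl[OF bij_dbl' \<alpha>]])
  qed
qed

lemma direct_sum_nd:
  fixes I :: "'k set" and \<delta> :: "'k \<Rightarrow> ('n \<times> 'k, 'n \<times> 'k, complex) mat"
  assumes \<alpha>: "sum_family I S J \<alpha>" and \<delta>: "\<And>s. s \<in> S \<Longrightarrow> \<delta> s \<in> mats scalars (UNIV \<times> J s)"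
    and C: "\<And>s. s \<in> S \<Longrightarrow> mats_norm scalars (UNIV \<times> J s) (\<delta> s) \<le> C"
  shows "direct_sum scalars S (\<lambda>s. ampl (cdbl dbl (\<alpha> s))) (\<lambda>s. cdbl nd (\<delta> s)) =
    cdbl nd (direct_sum scalars S (\<lambda>s. ampl (\<alpha> s)) \<delta>)"
proof -
  have b: "\<alpha> s \<in> bdd_mats I (J s)" if "s \<in> S" for s
    using \<alpha> that by (auto simp: sum_family_def isometry_mat_def)
  show ?thesis
    unfolding ampl_cdbl[OF bij_dbl']
  proof (rule complex_pair_complex.dblmat_direct_sum[OF bij_nd scale_scalars_real scale_scalars])
    show "form_bound (cdbl nd (\<delta> s)) C" if "s \<in> S" for s
      by (rule form_bound_mono[OF form_bound_op_bound[OF op_bound_cdbl[OF bij_nd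
              op_bound_UNIV_mats_norm[OF \<delta>[OF that]]]] C[OF that]])
    show "sq_summable (cdbl nd (ampl (\<alpha> s)) p)" if "s \<in> S" for s p
      unfolding ampl_cdbl[OF bij_dbl', symmetric]
      by (cases p) (simp add: sq_summable_cdbl_madj[OF bij_dbl' b[OF that]])
    show "(\<lambda>s. \<Sum>\<^sub>\<infinity>k. (cdbl nd (ampl (\<alpha> s)) p k)\<^sup>2) summable_on S" for p
      unfolding ampl_cdbl[OF bij_dbl', symmetric]
      by (cases p) (simp only: infsum_ampl_row sum_family_rows[OF sum_family_cdbl[OF bij_dbl' \<alpha>]])
  qed
qed

lemma Epi_complexify_mats:
  assumes "(z, \<delta>) \<in> Epi Kc fc I"
  shows "z \<in> mats (complexify E) I" "\<delta> \<in> mats scalars (UNIV \<times> I)"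
  using assms by (auto simp: Epi_def set_complexify_def)

lemma nc_convex_complexify:
  assumes conv: "nc_convex_fun E K f"
  shows "nc_convex_fun (complexify E) Kc fc"
proof (rule nc_convex_funI)
  fix I S J and \<alpha> :: "'k \<Rightarrow> ('k, 'k, complex) mat" and z \<delta> C
  assume I: "I \<noteq> {}" and \<alpha>: "sum_family I S J \<alpha>"
    and epi: "\<And>s. s \<in> S \<Longrightarrow> (z s, \<delta> s) \<in> Epi Kc fc (J s)"
    and zC: "\<And>s. s \<in> S \<Longrightarrow> mats_norm (complexify E) (J s) (z s) \<le> C"
    and \<delta>C: "\<And>s. s \<in> S \<Longrightarrow> mats_norm scalars (UNIV \<times> J s) (\<delta> s) \<le> C"
  note m = Epi_complexify_mats[OF epi]
  have "(direct_sum E S (\<lambda>s. cdbl dbl (\<alpha> s)) (\<lambda>s. edbl dbl (z s)),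
      direct_sum scalars S (\<lambda>s. ampl (cdbl dbl (\<alpha> s))) (\<lambda>s. cdbl nd (\<delta> s))) \<in> Epi K f (D I)"
  proof (rule nc_convex_fun_direct_sum[OF conv D_nonempty[OF I]])
    show "sum_family (D I) S (\<lambda>s. D (J s)) (\<lambda>s. cdbl dbl (\<alpha> s))"
      unfolding dbl_set_def by (rule sum_family_cdbl[OF bij_dbl' \<alpha>])
    fix s assume s: "s \<in> S"
    then have "J s \<noteq> {}" using \<alpha> by (auto simp: sum_family_def)
    then show "(edbl dbl (z s), cdbl nd (\<delta> s)) \<in> Epi K f (D (J s))"
      using epi[OF s] by (simp add: Epi_complexify)
    show "mats_norm E (D (J s)) (edbl dbl (z s)) \<le> C"
      using order_trans[OF mats_complexify_dbl(2)[OF bij_dbl' m(1)[OF s]] zC[OF s]] by (simp add: dbl_set_def)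
    show "mats_norm scalars (UNIV \<times> D (J s)) (cdbl nd (\<delta> s)) \<le> C"
      using mats_scalars_cdbl[OF bij_nd m(2)[OF s]] \<delta>C[OF s] by (simp add: UNIV_times_D)
  qed
  then show "(direct_sum (complexify E) S \<alpha> z, direct_sum scalars S (\<lambda>s. ampl (\<alpha> s)) \<delta>) \<in> Epi Kc fc I"
    by (simp only: Epi_complexify[OF I] direct_sum_edbl[OF \<alpha> m(1) zC] direct_sum_nd[OF \<alpha> m(2) \<delta>C])
next
  fix I J and \<beta> :: "('k, 'k, complex) mat" and z \<delta>
  assume I: "I \<noteq> {}" and J: "J \<noteq> {}" and \<beta>: "isometry_mat I J \<beta>" and epi: "(z, \<delta>) \<in> Epi Kc fc I"
  note m = Epi_complexify_mats[OF epi]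
  have "isometry_mat (D I) (D J) (cdbl dbl \<beta>)"
    unfolding dbl_set_def by (rule isometry_cdbl[OF bij_dbl' \<beta>])
  from nc_convex_fun_compress[OF conv D_nonempty[OF I] D_nonempty[OF J] this
      epi[unfolded Epi_complexify[OF I]]]
  show "(sandwich (complexify E) (madj \<beta>) z \<beta>, sandwich scalars (ampl (madj \<beta>)) \<delta> (ampl \<beta>)) \<in> Epi Kc fc J"
    by (simp only: Epi_complexify[OF J] sandwich_edbl[OF \<beta> m(1)] sandwich_nd[OF \<beta> m(2)])
qed

lemma nc_convex_of_complexify:
  assumes conv: "nc_convex_fun (complexify E) Kc fc"
  shows "nc_convex_fun E K f"
proof (rule nc_convex_funI)
  fix I S J and \<alpha> :: "'k \<Rightarrow> ('k, 'k, real) mat" and x \<gamma> C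
  assume I: "I \<noteq> {}" and \<alpha>: "sum_family I S J \<alpha>"
    and epi: "\<And>s. s \<in> S \<Longrightarrow> (x s, \<gamma> s) \<in> Epi K f (J s)"
    and xC: "\<And>s. s \<in> S \<Longrightarrow> mats_norm E (J s) (x s) \<le> C"
    and \<gamma>C: "\<And>s. s \<in> S \<Longrightarrow> mats_norm scalars (UNIV \<times> J s) (\<gamma> s) \<le> C"
  have "(direct_sum (complexify E) S (\<lambda>s. cemb (\<alpha> s)) (\<lambda>s. eemb (x s)),
      direct_sum scalars S (\<lambda>s. ampl (cemb (\<alpha> s))) (\<lambda>s. cemb (\<gamma> s))) \<in> Epi Kc fc I"
  \<comment> \<open>\<open>C\<close> serves the points and \<open>4 * C\<close> the scalar matrices,
    by the constant in \<open>mats_scalars_cemb\<close>; the maximum avoids a discussion of the sign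
    of \<open>C\<close>.\<close>
  proof (rule nc_convex_fun_direct_sum[OF conv I sum_family_cemb[OF \<alpha>], where C = "max C (4 * C)"])
    fix s assume s: "s \<in> S"
    then have J: "J s \<noteq> {}" using \<alpha> by (auto simp: sum_family_def)
    have x: "x s \<in> mats E (J s)" using epi[OF s] K_mats[OF J] by (auto simp: Epi_def)
    have \<gamma>: "\<gamma> s \<in> mats scalars (UNIV \<times> J s)" using epi[OF s] by (auto simp: Epi_def)
    show "(eemb (x s), cemb (\<gamma> s)) \<in> Epi Kc fc (J s)"
      using epi[OF s] by (simp add: Epi_eemb[OF J])
    show "mats_norm (complexify E) (J s) (eemb (x s)) \<le> max C (4 * C)"
      using mats_eemb[OF x] xC[OF s] by (auto simp: le_max_iff_disj)
    show "mats_norm scalars (UNIV \<times> J s) (cemb (\<gamma> s)) \<le> max C (4 * C)"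
      using mats_scalars_cemb[OF \<gamma>] \<gamma>C[OF s] by (auto simp: le_max_iff_disj)
  qed
  then show "(direct_sum E S \<alpha> x, direct_sum scalars S (\<lambda>s. ampl (\<alpha> s)) \<gamma>) \<in> Epi K f I"
    by (simp only: Epi_eemb[OF I] direct_sum_eemb ampl_cemb direct_sum_cemb)
next
  fix I J and \<beta> :: "('k, 'k, real) mat" and x \<gamma>
  assume I: "I \<noteq> {}" and J: "J \<noteq> {}" and \<beta>: "isometry_mat I J \<beta>" and epi: "(x, \<gamma>) \<in> Epi K f I"
  from nc_convex_fun_compress[OF conv I J isometry_cemb[OF \<beta>] epi[unfolded Epi_eemb[OF I]]]
  show "(sandwich E (madj \<beta>) x \<beta>, sandwich scalars (ampl (madj \<beta>)) \<gamma> (ampl \<beta>)) \<in> Epi K f J"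
    by (simp only: Epi_eemb[OF J] madj_cemb sandwich_eemb ampl_cemb sandwich_cemb)
qed

lemma nc_lsc_complexify:
  assumes lsc: "nc_lsc E K f"
  shows "nc_lsc (complexify E) Kc fc"
  unfolding nc_lsc_def
proof (intro allI impI)
  fix I :: "'k set" assume I: "I \<noteq> {}"
  let ?X = "prod_topology (weak_star (complexify E) I) (weak_star (scalars :: (complex, complex) dual_os) (UNIV \<times> I :: ('n \<times> 'k) set))"
  let ?Y = "prod_topology (weak_star E (D I)) (weak_star (scalars :: (real, real) dual_os) (UNIV \<times> D I :: ('n \<times> 'k) set))"
  have "continuous_map ?X ?Y (\<lambda>(z, \<delta>). (edbl dbl z, cdbl nd \<delta>))"
  proof -
    have "continuous_map (weak_star (complexify E) I) (weak_star E (D I)) (edbl dbl)"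
      unfolding dbl_set_def by (rule continuous_map_edbl[OF bij_dbl'])
    moreover have "continuous_map (weak_star scalars (UNIV \<times> I :: ('n \<times> 'k) set)) (weak_star scalars (UNIV \<times> D I)) (cdbl nd)"
      unfolding UNIV_times_D by (rule continuous_map_cdbl[OF bij_nd])
    ultimately show ?thesis by (simp add: continuous_map_prod_top)
  qed
  moreover have "closedin ?Y (Epi K f (D I))"
    using lsc D_nonempty[OF I] by (simp add: nc_lsc_def)
  ultimately have "closedin ?X {w \<in> topspace ?X. (\<lambda>(z, \<delta>). (edbl dbl z, cdbl nd \<delta>)) w \<in> Epi K f (D I)}"
    by (rule closedin_continuous_map_preimage)
  \<comment> \<open>Restricting to the topological space loses nothing, since an epigraph consists
    of pairs of bounded matrices.\<close>
  also have "{w \<in> topspace ?X. (\<lambda>(z, \<delta>). (edbl dbl z, cdbl nd \<delta>)) w \<in> Epi K f (D I)} = Epi Kc fc I"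
    using Epi_complexify_mats
    by (auto simp: topspace_weak_star[OF predual_ok_complexify[OF bij_dbl']]
        topspace_weak_star[OF predual_ok_scalars] Epi_complexify[OF I])
  finally show "closedin ?X (Epi Kc fc I)" .
qed

lemma nc_lsc_of_complexify:
  assumes lsc: "nc_lsc (complexify E) Kc fc"
  shows "nc_lsc E K f"
  unfolding nc_lsc_def
proof (intro allI impI)
  fix I :: "'k set" assume I: "I \<noteq> {}"
  let ?X = "prod_topology (weak_star E I) (weak_star (scalars :: (real, real) dual_os) (UNIV \<times> I :: ('n \<times> 'k) set))"
  let ?Y = "prod_topology (weak_star (complexify E) I) (weak_star (scalars :: (complex, complex) dual_os) (UNIV \<times> I :: ('n \<times> 'k) set))"
  have "continuous_map ?X ?Y (\<lambda>(x, \<gamma>). (eemb x, cemb \<gamma>))"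
    using continuous_map_eemb[OF bij_dbl', of I] continuous_map_cemb[of "UNIV \<times> I :: ('n \<times> 'k) set"]
    by (simp add: continuous_map_prod_top)
  moreover have "closedin ?Y (Epi Kc fc I)"
    using lsc I by (simp add: nc_lsc_def)
  ultimately have "closedin ?X {w \<in> topspace ?X. (\<lambda>(x, \<gamma>). (eemb x, cemb \<gamma>)) w \<in> Epi Kc fc I}"
    by (rule closedin_continuous_map_preimage)
  also have "{w \<in> topspace ?X. (\<lambda>(x, \<gamma>). (eemb x, cemb \<gamma>)) w \<in> Epi Kc fc I} = Epi K f I"
  proof -
    have "x \<in> mats E I \<and> \<gamma> \<in> mats scalars (UNIV \<times> I)" if "(x, \<gamma>) \<in> Epi K f I" for x \<gamma>
      using that K_mats[OF I] by (auto simp: Epi_def)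
    then show ?thesis
      by (auto simp: topspace_weak_star[OF predual_ok_E]
          topspace_weak_star[OF predual_ok_scalars] Epi_eemb[OF I, symmetric])
  qed
  finally show "closedin ?X (Epi K f I)" .
qed

end

theorem proposition4p2:
  fixes E :: "('e::banach, real) dual_os"
    and K :: "'k set \<Rightarrow> ('k, 'k, 'e) mat set"
    and f :: "('k, 'e, 'n, real) ncfun"
  assumes "infinite (UNIV :: 'k set)"
    and "dual_operator_space E"
    and "compact_nc_convex_set E K"
    and "f \<in> bdd_nc_funs_sa E K"
  shows "(nc_convex_fun E K f \<longleftrightarrow>
            nc_convex_fun (complexify E) (set_complexify E K) (fun_complexify f))
       \<and> (nc_lsc E K f \<longleftrightarrow>
            nc_lsc (complexify E) (set_complexify E K) (fun_complexify f))"
proof -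
  interpret real_nc_function E K f
    by standard (use assms in \<open>simp_all add: compact_nc_convex_set_def bdd_nc_funs_sa_def\<close>)
  show ?thesis
    using nc_convex_complexify nc_convex_of_complexify nc_lsc_complexify nc_lsc_of_complexify by blast
qed

end
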